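(* Let $M$ be a monoid, $C : \mathbf{PSh}(M) \to \mathbf{Set}$ its connected components functor and $\Gamma : \mathbf{PSh}(M) \to \mathbf{Set}$ its global sections functor. The following are equivalent: (1) $M$ has a left absorbing element. (2) $M$ has a minimal non-empty right ideal whose monoid of endomorphisms as a right $M$-set is trivial. (3) The category of indecomposable right $M$-sets has an initial object. (4) Every indecomposable right $M$-set has a minimal non-empty subobject admitting no non-trivial endomorphisms. (5) The category of essential points of $\mathbf{PSh}(M)$ has a terminal object. (6) $C$ has a left adjoint $c$ which preserves connected limits. (7) $C$ has a left adjoint $c$; that is, $\mathbf{PSh}(M)$ is colocal over $\mathbf{Set}$. (8) $C$ preserves arbitrary products, so the terminal left $M$-set is product-flat. (9) $C$ preserves $\mathbf{Set}$-indexed powers.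
   Context: For a monoid $M$, $\mathbf{PSh}(M)$ denotes the category of right $M$-sets (the empty one included) and $M$-equivariant maps; subobjects of a right $M$-set are its sub-$M$-sets, and the right ideals of $M$ are the sub-$M$-sets of $M$ acting on itself by right multiplication. $\Delta : \mathbf{Set} \to \mathbf{PSh}(M)$ equips a set with the trivial action. Its right adjoint $\Gamma$ sends $X$ to its set of fixed points under the action of $M$. Its left adjoint $C$ sends $X$ to the quotient of $X$ by the equivalence relation generated by $x \sim xm$ ($x\in X$, $m \in M$), i.e. $C(X) \cong X \otimes_M 1$ with $1$ the terminal left $M$-set. $\mathbf{PSh}(M)$ is called colocal (over $\mathbf{Set}$) if $C$ has a further left adjoint. A non-empty left $M$-set $B$ is product-flat if $-\otimes_M B : \mathbf{PSh}(M) \to \mathbf{Set}$ preserves products. An element $l \in M$ is left absorbing if $nl = l$ for all $n \in M$. A right $M$-set $X$ is indecomposable if it is non-empty and $X \cong X_1 \sqcup X_2$ implies $X_1$ or $X_2$ is empty (equivalently $|C(X)|=1$); the category of indecomposable right $M$-sets is the corresponding full subcategory of $\mathbf{PSh}(M)$. A point of $\mathbf{PSh}(M)$ is a geometric morphism $\mathbf{Set} \to \mathbf{PSh}(M)$; it is essential if its inverse image functor has a left adjoint. Morphisms of points are natural transformations between inverse image functors; the category of essential points is equivalent to the category of indecomposable projective left $M$-sets and left $M$-set homomorphisms. For a set $I$ and a right $M$-set $Y$, the exponential $Y^{\Delta(I)}$ in $\mathbf{PSh}(M)$ is the set of functions $I \to Y$ with pointwise action; $C$ preserves $\mathbf{Set}$-indexed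 powers if the canonical map $C(Y^{\Delta(I)}) \to C(Y)^{I}$, $[(y_i)_{i\in I}] \mapsto ([y_i])_{i \in I}$, is an isomorphism for all sets $I$ and all right $M$-sets $Y$.
   Formalization: In (2) and (4), "minimal non-empty" is taken as "least" (contained in every non-empty one); with inclusion-minimality the claim fails for M = {1,a,b}, aa=ab=a, ba=bb=b, where {a} is a minimal right ideal with trivial endomorphisms but no element is left absorbing. *)

theory Defs
  imports "HOL-Library.FuncSet"
begin

unbundle cardinal_syntax

section \<open>Size conventions\<close>

text \<open>
  The category of sets is rendered as the category of sets with fewer than \<open>\<kappa>\<close> elements, for a
  cardinal \<open>\<kappa>\<close> subject to the conditions below. Every uncountable inaccessible
  \<open>\<kappa>\<close> above \<open>|M|\<close>, i.e. every Grothendieck universe that contains an infinite set and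
  (a copy of) \<open>M\<close>, satisfies them (\<open>inaccessible_universe_card\<close>). Inaccessibility itself is not required because
  no type of HOL can be proved to have inaccessible cardinality; the weaker conditions
  can always be met (\<open>universe_card_exists\<close>).
  Closure under \<open>M\<close>-th powers makes the right adjoint of the forgetful functor from
  right \<open>M\<close>-sets to sets available. Uncountability excludes the category of finite sets.
\<close>

definition universe_card :: "'m itself \<Rightarrow> 'u rel \<Rightarrow> bool" where
  "universe_card M \<kappa> \<longleftrightarrow>
     Card_order \<kappa> \<and> regularCard \<kappa> \<and>
     |UNIV :: nat set| <o \<kappa> \<and> |UNIV :: 'm set| <o \<kappa> \<and>
     (\<forall>A :: 'u set. |A| <o \<kappa> \<longrightarrow> |(UNIV :: 'm set) \<rightarrow>\<^sub>E A| <o \<kappa>)"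

lemma inaccessible_universe_card:
  fixes \<kappa> :: "'u rel"
  assumes "Card_order \<kappa>" "regularCard \<kappa>" "|UNIV :: nat set| <o \<kappa>" "|UNIV :: 'm set| <o \<kappa>"
    and strong_limit: "\<And>A :: 'u set. |A| <o \<kappa> \<Longrightarrow> |Pow A| <o \<kappa>"
  shows "universe_card TYPE('m) \<kappa>"
proof -
  have inf: "\<not> finite (Field \<kappa>)"
    using assms(1,3) by (metis card_of_Field_ordIso card_of_ordLeq_finite infinite_UNIV_nat
        ordLess_imp_ordLeq ordLess_ordIso_trans ordIso_symmetric)
  have "|(UNIV :: 'm set) \<rightarrow>\<^sub>E A| <o \<kappa>" if A: "|A| <o \<kappa>" for A :: "'u set"
  proof -
    let ?P = "(UNIV :: 'm set) \<times> A"
    have "|?P| <o \<kappa>"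
      using stable_elim[OF regularCard_stable[OF assms(1) inf assms(2)] assms(4), of "\<lambda>_. A"] A by simp
    then have "|?P| \<le>o |Field \<kappa>|"
      using assms(1) by (meson card_of_Field_ordIso ordIso_symmetric ordLess_imp_ordLeq ordLess_ordIso_trans)
    then obtain e where e: "inj_on e ?P" "e ` ?P \<subseteq> Field \<kappa>"
      using card_of_ordLeq[of ?P "Field \<kappa>"] by auto
    have "|e ` ?P| <o \<kappa>"
      using \<open>|?P| <o \<kappa>\<close> card_of_image ordLeq_ordLess_trans by blast
    then have P: "|Pow (e ` ?P)| <o \<kappa>"
      by (rule strong_limit)
    have "inj_on (\<lambda>f. e ` {(m, f m) | m. True}) ((UNIV :: 'm set) \<rightarrow>\<^sub>E A)"
    proof (rule inj_onI)
      fix f g :: "'m \<Rightarrow> 'u"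
      assume f: "f \<in> UNIV \<rightarrow>\<^sub>E A" and g: "g \<in> UNIV \<rightarrow>\<^sub>E A"
        and eq: "e ` {(m, f m) | m. True} = e ` {(m, g m) | m. True}"
      have "{(m, f m) | m. True} = {(m, g m) | m. True}"
      proof (subst inj_on_image_eq_iff[OF e(1), symmetric])
        show "{(m, f m) | m. True} \<subseteq> ?P" "{(m, g m) | m. True} \<subseteq> ?P"
          using f g by auto
      qed (rule eq)
      then show "f = g"
        by (auto simp: set_eq_iff)
    qed
    moreover have "(\<lambda>f. e ` {(m, f m) | m. True}) ` ((UNIV :: 'm set) \<rightarrow>\<^sub>E A) \<subseteq> Pow (e ` ?P)"
      by (auto simp: PiE_def Pi_def)
    ultimately have "|(UNIV :: 'm set) \<rightarrow>\<^sub>E A| \<le>o |Pow (e ` ?P)|"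
      using card_of_ordLeq by blast
    then show ?thesis
      using P ordLeq_ordLess_trans by blast
  qed
  then show ?thesis
    using assms by (auto simp: universe_card_def)
qed

lemma universe_card_exists: "\<exists>\<kappa> :: (nat + 'm) set set rel. universe_card TYPE('m) \<kappa>"
proof -
  let ?r = "|UNIV :: (nat + 'm) set set|"
  let ?k = "cardSuc ?r"
  have less: "|A| <o ?k" if "inj_on f A" for A :: "'z set" and f :: "'z \<Rightarrow> (nat + 'm) set"
  proof -
    have "|A| \<le>o ?r"
      using that card_of_ordLeq[of A "UNIV :: (nat + 'm) set set"] by blast
    then show ?thesis
      using cardSuc_ordLeq_ordLess[of ?r "|A|"] by (simp add: card_of_Card_order)
  qed
  have "infinite (UNIV :: (nat + 'm) set)"
    by simp
  then obtain p :: "(nat + 'm) \<times> (nat + 'm) \<Rightarrow> nat + 'm" where p: "inj p"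
    using card_of_Times_same_infinite[of "UNIV :: (nat + 'm) set"] card_of_ordIso[of "UNIV \<times> UNIV"]
    by (metis UNIV_Times_UNIV bij_betw_def)
  have inf: "infinite (UNIV :: (nat + 'm) set set)"
    by (simp add: Finite_Set.finite_set)
  have pow: "|(UNIV :: 'm set) \<rightarrow>\<^sub>E A| <o ?k" if A: "|A| <o ?k" for A :: "(nat + 'm) set set set"
  proof -
    have "|A| \<le>o ?r"
      using A cardSuc_ordLeq_ordLess[of ?r "|A|"] by (simp add: card_of_Card_order)
    then obtain g :: "(nat + 'm) set set \<Rightarrow> (nat + 'm) set" where g: "inj_on g A"
      using card_of_ordLeq[of A "UNIV :: (nat + 'm) set set"] by blast
    have "inj_on (\<lambda>f. p ` {(Inr m, z) | m z. z \<in> g (f m)}) ((UNIV :: 'm set) \<rightarrow>\<^sub>E A)"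
    proof (rule inj_onI)
      fix f h :: "'m \<Rightarrow> (nat + 'm) set set"
      assume f: "f \<in> UNIV \<rightarrow>\<^sub>E A" and h: "h \<in> UNIV \<rightarrow>\<^sub>E A"
        and eq: "p ` {(Inr m, z) | m z. z \<in> g (f m)} = p ` {(Inr m, z) | m z. z \<in> g (h m)}"
      have eq': "{(Inr m :: nat + 'm, z) | m z. z \<in> g (f m)} = {(Inr m, z) | m z. z \<in> g (h m)}"
        using eq by (simp only: inj_image_eq_iff[OF p])
      have graph: "g (k m) = {z. (Inr m :: nat + 'm, z) \<in> {(Inr m, z) | m z. z \<in> g (k m)}}"
        for k :: "'m \<Rightarrow> (nat + 'm) set set" and m
        by simp
      have "g (f m) = g (h m)" for m
        unfolding graph[of f m] graph[of h m] eq' ..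
      then show "f = h"
        using f h by (intro ext inj_onD[OF g]) auto
    qed
    then show ?thesis
      by (rule less)
  qed
  have "|UNIV :: nat set| <o ?k"
    by (rule less[of "\<lambda>n. {Inl n}"]) (auto simp: inj_on_def)
  moreover have "|UNIV :: 'm set| <o ?k"
    by (rule less[of "\<lambda>m. {Inr m}"]) (auto simp: inj_on_def)
  moreover have "Card_order ?k"
    by (simp add: cardSuc_Card_order card_of_Card_order)
  moreover have "regularCard ?k"
    using infinite_cardSuc_regularCard[of ?r] inf by (metis Field_card_of card_of_Card_order)
  ultimately show ?thesis
    using pow unfolding universe_card_def by blast
qed

definition small :: "'u rel \<Rightarrow> 'a set \<Rightarrow> bool" where
  "small \<kappa> A \<longleftrightarrow> |A| <o \<kappa>"


section \<open>Categories, functors, adjunctions and limits\<close>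

text \<open>
  Hom-sets of different pairs of objects may overlap, so identities, composition and the action of
  functors on arrows take the objects involved as arguments: \<open>Comp A x y z g f\<close> is the composite
  of \<open>f\<close> from \<open>x\<close> to \<open>y\<close> with \<open>g\<close> from \<open>y\<close> to \<open>z\<close>.
\<close>

record ('o, 'a) cat =
  Obj :: "'o set"
  Hom :: "'o \<Rightarrow> 'o \<Rightarrow> 'a set"
  Id :: "'o \<Rightarrow> 'a"
  Comp :: "'o \<Rightarrow> 'o \<Rightarrow> 'o \<Rightarrow> 'a \<Rightarrow> 'a \<Rightarrow> 'a"

definition category :: "('o, 'a) cat \<Rightarrow> bool" where
  "category A \<longleftrightarrow>
     (\<forall>x\<in>Obj A. Id A x \<in> Hom A x x) \<and>
     (\<forall>x\<in>Obj A. \<forall>y\<in>Obj A. \<forall>z\<in>Obj A. \<forall>f\<in>Hom A x y. \<forall>g\<in>Hom A y z. Comp A x y z g f \<in> Hom A x z) \<and>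
     (\<forall>x\<in>Obj A. \<forall>y\<in>Obj A. \<forall>f\<in>Hom A x y. Comp A x x y f (Id A x) = f \<and> Comp A x y y (Id A y) f = f) \<and>
     (\<forall>w\<in>Obj A. \<forall>x\<in>Obj A. \<forall>y\<in>Obj A. \<forall>z\<in>Obj A. \<forall>f\<in>Hom A w x. \<forall>g\<in>Hom A x y. \<forall>h\<in>Hom A y z.
        Comp A w x z (Comp A x y z h g) f = Comp A w y z h (Comp A w x y g f))"

definition full_subcategory :: "('o, 'a) cat \<Rightarrow> ('o \<Rightarrow> bool) \<Rightarrow> ('o, 'a) cat" where
  "full_subcategory A P = A\<lparr>Obj := {x \<in> Obj A. P x}\<rparr>"

definition has_initial :: "('o, 'a) cat \<Rightarrow> bool" where
  "has_initial A \<longleftrightarrow> (\<exists>x\<in>Obj A. \<forall>y\<in>Obj A. \<exists>!f. f \<in> Hom A x y)"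

definition has_terminal :: "('o, 'a) cat \<Rightarrow> bool" where
  "has_terminal A \<longleftrightarrow> (\<exists>x\<in>Obj A. \<forall>y\<in>Obj A. \<exists>!f. f \<in> Hom A y x)"

record ('o, 'a, 'p, 'b) ftor =
  omap :: "'o \<Rightarrow> 'p"
  amap :: "'o \<Rightarrow> 'o \<Rightarrow> 'a \<Rightarrow> 'b"

definition is_ftor :: "('o, 'a) cat \<Rightarrow> ('p, 'b) cat \<Rightarrow> ('o, 'a, 'p, 'b) ftor \<Rightarrow> bool" where
  "is_ftor A B F \<longleftrightarrow>
     (\<forall>x\<in>Obj A. omap F x \<in> Obj B) \<and>
     (\<forall>x\<in>Obj A. \<forall>y\<in>Obj A. \<forall>f\<in>Hom A x y. amap F x y f \<in> Hom B (omap F x) (omap F y)) \<and>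
     (\<forall>x\<in>Obj A. amap F x x (Id A x) = Id B (omap F x)) \<and>
     (\<forall>x\<in>Obj A. \<forall>y\<in>Obj A. \<forall>z\<in>Obj A. \<forall>f\<in>Hom A x y. \<forall>g\<in>Hom A y z.
        amap F x z (Comp A x y z g f) =
        Comp B (omap F x) (omap F y) (omap F z) (amap F y z g) (amap F x y f))"

definition comp_ftor ::
  "('p, 'b, 'q, 'c) ftor \<Rightarrow> ('o, 'a, 'p, 'b) ftor \<Rightarrow> ('o, 'a, 'q, 'c) ftor" where
  "comp_ftor G F =
     \<lparr>omap = \<lambda>x. omap G (omap F x), amap = \<lambda>x y f. amap G (omap F x) (omap F y) (amap F x y f)\<rparr>"

definition nat_trans ::
  "('o, 'a) cat \<Rightarrow> ('p, 'b) cat \<Rightarrow> ('o, 'a, 'p, 'b) ftor \<Rightarrow> ('o, 'a, 'p, 'b) ftor \<Rightarrow> ('o \<Rightarrow> 'b) set" where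
  "nat_trans A B F G =
     {\<alpha> \<in> (\<Pi>\<^sub>E x\<in>Obj A. Hom B (omap F x) (omap G x)).
        \<forall>x\<in>Obj A. \<forall>y\<in>Obj A. \<forall>f\<in>Hom A x y.
          Comp B (omap F x) (omap F y) (omap G y) (\<alpha> y) (amap F x y f) =
          Comp B (omap F x) (omap G x) (omap G y) (amap G x y f) (\<alpha> x)}"

text \<open>\<open>adjoint A B L R\<close>: the functor \<open>L\<close> from \<open>A\<close> to \<open>B\<close> is left adjoint to \<open>R\<close> from \<open>B\<close> to \<open>A\<close>.\<close>

definition adjoint ::
  "('o, 'a) cat \<Rightarrow> ('p, 'b) cat \<Rightarrow> ('o, 'a, 'p, 'b) ftor \<Rightarrow> ('p, 'b, 'o, 'a) ftor \<Rightarrow> bool" where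
  "adjoint A B L R \<longleftrightarrow> is_ftor A B L \<and> is_ftor B A R \<and>
     (\<exists>\<phi>.
        (\<forall>a\<in>Obj A. \<forall>b\<in>Obj B. bij_betw (\<phi> a b) (Hom B (omap L a) b) (Hom A a (omap R b))) \<and>
        (\<forall>a\<in>Obj A. \<forall>a'\<in>Obj A. \<forall>b\<in>Obj B. \<forall>b'\<in>Obj B.
          \<forall>h\<in>Hom A a' a. \<forall>f\<in>Hom B (omap L a) b. \<forall>k\<in>Hom B b b'.
            \<phi> a' b' (Comp B (omap L a') b b' k (Comp B (omap L a') (omap L a) b f (amap L a' a h))) =
            Comp A a' (omap R b) (omap R b') (amap R b b' k) (Comp A a' a (omap R b) (\<phi> a b f) h)))"

definition cone ::
  "('j, 'i) cat \<Rightarrow> ('o, 'a) cat \<Rightarrow> ('j, 'i, 'o, 'a) ftor \<Rightarrow> 'o \<Rightarrow> ('j \<Rightarrow> 'a) \<Rightarrow> bool" where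
  "cone J A D x \<pi> \<longleftrightarrow> x \<in> Obj A \<and>
     (\<forall>j\<in>Obj J. \<pi> j \<in> Hom A x (omap D j)) \<and>
     (\<forall>j\<in>Obj J. \<forall>k\<in>Obj J. \<forall>u\<in>Hom J j k.
        Comp A x (omap D j) (omap D k) (amap D j k u) (\<pi> j) = \<pi> k)"

definition limit_cone ::
  "('j, 'i) cat \<Rightarrow> ('o, 'a) cat \<Rightarrow> ('j, 'i, 'o, 'a) ftor \<Rightarrow> 'o \<Rightarrow> ('j \<Rightarrow> 'a) \<Rightarrow> bool" where
  "limit_cone J A D x \<pi> \<longleftrightarrow> cone J A D x \<pi> \<and>
     (\<forall>y \<mu>. cone J A D y \<mu> \<longrightarrow>
        (\<exists>!h. h \<in> Hom A y x \<and> (\<forall>j\<in>Obj J. Comp A y x (omap D j) (\<pi> j) h = \<mu> j)))"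

definition preserves_limits ::
  "('j, 'i) cat \<Rightarrow> ('o, 'a) cat \<Rightarrow> ('p, 'b) cat \<Rightarrow> ('o, 'a, 'p, 'b) ftor \<Rightarrow> bool" where
  "preserves_limits J A B F \<longleftrightarrow>
     (\<forall>D x \<pi>. is_ftor J A D \<and> limit_cone J A D x \<pi> \<longrightarrow>
        limit_cone J B (comp_ftor F D) (omap F x) (\<lambda>j. amap F x (omap D j) (\<pi> j)))"

text \<open>Every finite category is isomorphic to one whose objects and arrows are natural numbers.\<close>

definition preserves_finite_limits ::
  "('o, 'a) cat \<Rightarrow> ('p, 'b) cat \<Rightarrow> ('o, 'a, 'p, 'b) ftor \<Rightarrow> bool" where
  "preserves_finite_limits A B F \<longleftrightarrow>
     (\<forall>J :: (nat, nat) cat. category J \<and> finite (Obj J) \<and>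
        (\<forall>x\<in>Obj J. \<forall>y\<in>Obj J. finite (Hom J x y)) \<longrightarrow> preserves_limits J A B F)"

definition connected_category :: "('o, 'a) cat \<Rightarrow> bool" where
  "connected_category J \<longleftrightarrow> Obj J \<noteq> {} \<and>
     (\<forall>x\<in>Obj J. \<forall>y\<in>Obj J. equivclp (\<lambda>v w. v \<in> Obj J \<and> w \<in> Obj J \<and> Hom J v w \<noteq> {}) x y)"

definition preserves_connected_limits ::
  "'u rel \<Rightarrow> ('o, 'a) cat \<Rightarrow> ('p, 'b) cat \<Rightarrow> ('o, 'a, 'p, 'b) ftor \<Rightarrow> bool" where
  "preserves_connected_limits \<kappa> A B F \<longleftrightarrow>
     (\<forall>J :: ('u, 'u) cat. category J \<and> connected_category J \<and> small \<kappa> (Obj J) \<and>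
        (\<forall>x\<in>Obj J. \<forall>y\<in>Obj J. small \<kappa> (Hom J x y)) \<longrightarrow> preserves_limits J A B F)"

definition set_cat :: "'u rel \<Rightarrow> ('x set, 'x \<Rightarrow> 'x) cat" where
  "set_cat \<kappa> =
     \<lparr>Obj = {A. small \<kappa> A}, Hom = \<lambda>A B. A \<rightarrow>\<^sub>E B,
      Id = \<lambda>A. \<lambda>x\<in>A. x, Comp = \<lambda>A B C g f. compose A g f\<rparr>"


section \<open>Right and left M-sets\<close>

record ('m, 'x) right_act =
  rcarrier :: "'x set"
  ract :: "'x \<Rightarrow> 'm \<Rightarrow> 'x"

definition right_mset :: "('m::monoid_mult, 'x) right_act \<Rightarrow> bool" where
  "right_mset X \<longleftrightarrow>
     (\<forall>x\<in>rcarrier X. \<forall>m. ract X x m \<in> rcarrier X) \<and>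
     (\<forall>x\<in>rcarrier X. ract X x 1 = x) \<and>
     (\<forall>x\<in>rcarrier X. \<forall>m n. ract X (ract X x m) n = ract X x (m * n))"

definition rhom :: "('m::monoid_mult, 'x) right_act \<Rightarrow> ('m, 'y) right_act \<Rightarrow> ('x \<Rightarrow> 'y) set" where
  "rhom X Y = {f \<in> rcarrier X \<rightarrow>\<^sub>E rcarrier Y. \<forall>x\<in>rcarrier X. \<forall>m. f (ract X x m) = ract Y (f x) m}"

definition riso :: "('m::monoid_mult, 'x) right_act \<Rightarrow> ('m, 'y) right_act \<Rightarrow> bool" where
  "riso X Y \<longleftrightarrow> (\<exists>f\<in>rhom X Y. bij_betw f (rcarrier X) (rcarrier Y))"

definition PSh :: "'m::monoid_mult itself \<Rightarrow> 'u rel \<Rightarrow> (('m, 'u) right_act, 'u \<Rightarrow> 'u) cat" where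
  "PSh M \<kappa> =
     \<lparr>Obj = {X. right_mset X \<and> small \<kappa> (rcarrier X)}, Hom = rhom,
      Id = \<lambda>X. \<lambda>x\<in>rcarrier X. x, Comp = \<lambda>X Y Z g f. compose (rcarrier X) g f\<rparr>"

definition regular_mset :: "('m::monoid_mult, 'm) right_act" where
  "regular_mset = \<lparr>rcarrier = UNIV, ract = (*)\<rparr>"

definition sub_mset :: "('m::monoid_mult, 'x) right_act \<Rightarrow> 'x set \<Rightarrow> bool" where
  "sub_mset X Y \<longleftrightarrow> Y \<subseteq> rcarrier X \<and> (\<forall>y\<in>Y. \<forall>m. ract X y m \<in> Y)"

definition restrict_mset :: "('m::monoid_mult, 'x) right_act \<Rightarrow> 'x set \<Rightarrow> ('m, 'x) right_act" where
  "restrict_mset X Y = X\<lparr>rcarrier := Y\<rparr>"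

text \<open>
  The right ideals of \<open>M\<close> are the sub-\<open>M\<close>-sets of \<open>regular_mset\<close>.

  ``Minimal'' is meant in the sense of ``least'': contained in every non-empty sub-\<open>M\<close>-set.
  Inclusion-minimality would not do. In the monoid \<open>{1, a, b}\<close> with \<open>ab = aa = a\<close> and
  \<open>ba = bb = b\<close>, the right ideal \<open>{a}\<close> is inclusion-minimal with trivial endomorphism monoid, although
  no element is left absorbing.
\<close>

definition minimal_nonempty_sub :: "('m::monoid_mult, 'x) right_act \<Rightarrow> 'x set \<Rightarrow> bool" where
  "minimal_nonempty_sub X Y \<longleftrightarrow> sub_mset X Y \<and> Y \<noteq> {} \<and>
     (\<forall>Z. sub_mset X Z \<and> Z \<noteq> {} \<longrightarrow> Y \<subseteq> Z)"

definition trivial_endomorphisms :: "('m::monoid_mult, 'x) right_act \<Rightarrow> bool" where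
  "trivial_endomorphisms X \<longleftrightarrow> rhom X X = {\<lambda>x\<in>rcarrier X. x}"

definition coproduct_mset ::
  "('m::monoid_mult, 'x) right_act \<Rightarrow> ('m, 'y) right_act \<Rightarrow> ('m, 'x + 'y) right_act" where
  "coproduct_mset X Y =
     \<lparr>rcarrier = rcarrier X <+> rcarrier Y, ract = \<lambda>z m. map_sum (\<lambda>x. ract X x m) (\<lambda>y. ract Y y m) z\<rparr>"

text \<open>Summands of \<open>X\<close> embed into \<open>X\<close>, so it suffices to let them range over the element type of \<open>X\<close>.\<close>

definition indecomposable :: "('m::monoid_mult, 'x) right_act \<Rightarrow> bool" where
  "indecomposable X \<longleftrightarrow> rcarrier X \<noteq> {} \<and>
     (\<forall>(X1 :: ('m, 'x) right_act) (X2 :: ('m, 'x) right_act). right_mset X1 \<and> right_mset X2 \<and> riso X (coproduct_mset X1 X2) \<longrightarrow>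
        rcarrier X1 = {} \<or> rcarrier X2 = {})"

definition product_mset ::
  "'i set \<Rightarrow> ('i \<Rightarrow> ('m::monoid_mult, 'x) right_act) \<Rightarrow> ('m, 'i \<Rightarrow> 'x) right_act" where
  "product_mset I X =
     \<lparr>rcarrier = (\<Pi>\<^sub>E i\<in>I. rcarrier (X i)), ract = \<lambda>x m. \<lambda>i\<in>I. ract (X i) (x i) m\<rparr>"

record ('m, 'x) left_act =
  lcarrier :: "'x set"
  lact :: "'m \<Rightarrow> 'x \<Rightarrow> 'x"

definition left_mset :: "('m::monoid_mult, 'x) left_act \<Rightarrow> bool" where
  "left_mset B \<longleftrightarrow>
     (\<forall>b\<in>lcarrier B. \<forall>m. lact B m b \<in> lcarrier B) \<and>
     (\<forall>b\<in>lcarrier B. lact B 1 b = b) \<and>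
     (\<forall>b\<in>lcarrier B. \<forall>m n. lact B m (lact B n b) = lact B (m * n) b)"

definition terminal_left_mset :: "('m::monoid_mult, unit) left_act" where
  "terminal_left_mset = \<lparr>lcarrier = {()}, lact = \<lambda>m b. b\<rparr>"


section \<open>Connected components and tensor products\<close>

definition conn :: "('m::monoid_mult, 'x) right_act \<Rightarrow> 'x rel" where
  "conn X = {(x, y). x \<in> rcarrier X \<and> y \<in> rcarrier X \<and>
     equivclp (\<lambda>v w. v \<in> rcarrier X \<and> (\<exists>m. w = ract X v m)) x y}"

definition components :: "('m::monoid_mult, 'x) right_act \<Rightarrow> 'x set set" where
  "components X = rcarrier X // conn X"

text \<open>The map of components induced by \<open>f\<close> sends the class of \<open>x\<close> to the class of \<open>f x\<close>.\<close>

definition components_map ::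
  "('m::monoid_mult, 'x) right_act \<Rightarrow> ('m, 'y) right_act \<Rightarrow> ('x \<Rightarrow> 'y) \<Rightarrow> 'x set \<Rightarrow> 'y set" where
  "components_map X Y f = (\<lambda>c\<in>components X. conn Y `` (f ` c))"

text \<open>
  As a functor, \<open>C\<close> takes values in the category of small sets with elements of type \<open>'u set\<close>, since
  components are equivalence classes. The bound on the size is the same \<open>\<kappa>\<close> throughout.
\<close>

definition components_ftor ::
  "'m::monoid_mult itself \<Rightarrow> 'u itself \<Rightarrow>
     (('m, 'u) right_act, 'u \<Rightarrow> 'u, 'u set set, 'u set \<Rightarrow> 'u set) ftor" where
  "components_ftor M U = \<lparr>omap = components, amap = components_map\<rparr>"

definition tensor_rel ::
  "('m::monoid_mult, 'x) right_act \<Rightarrow> ('m, 'b) left_act \<Rightarrow> ('x \<times> 'b) rel" where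
  "tensor_rel X B = {(p, q). p \<in> rcarrier X \<times> lcarrier B \<and> q \<in> rcarrier X \<times> lcarrier B \<and>
     equivclp (\<lambda>v w. \<exists>x\<in>rcarrier X. \<exists>b\<in>lcarrier B. \<exists>m. v = (ract X x m, b) \<and> w = (x, lact B m b)) p q}"

definition tensor :: "('m::monoid_mult, 'x) right_act \<Rightarrow> ('m, 'b) left_act \<Rightarrow> ('x \<times> 'b) set set" where
  "tensor X B = (rcarrier X \<times> lcarrier B) // tensor_rel X B"

definition tensor_map ::
  "('m::monoid_mult, 'x) right_act \<Rightarrow> ('m, 'y) right_act \<Rightarrow> ('m, 'b) left_act \<Rightarrow>
     ('x \<Rightarrow> 'y) \<Rightarrow> ('x \<times> 'b) set \<Rightarrow> ('y \<times> 'b) set" where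
  "tensor_map X Y B f = (\<lambda>c\<in>tensor X B. tensor_rel Y B `` ((\<lambda>(x, b). (f x, b)) ` c))"

text \<open>
  Preservation of products means bijectivity of the canonical comparison map, whose \<open>i\<close>-th component
  is induced by the \<open>i\<close>-th projection. The products are the full ones,
  whether or not they have fewer than \<open>\<kappa>\<close> elements.
\<close>

definition components_preserves_products :: "'m::monoid_mult itself \<Rightarrow> 'u rel \<Rightarrow> bool" where
  "components_preserves_products M \<kappa> \<longleftrightarrow>
     (\<forall>(I :: 'u set) (X :: 'u \<Rightarrow> ('m, 'u) right_act).
        small \<kappa> I \<and> (\<forall>i\<in>I. X i \<in> Obj (PSh M \<kappa>)) \<longrightarrow>
        bij_betw (\<lambda>c. \<lambda>i\<in>I. components_map (product_mset I X) (X i) (\<lambda>x. x i) c)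
          (components (product_mset I X)) (\<Pi>\<^sub>E i\<in>I. components (X i)))"

definition product_flat :: "'u rel \<Rightarrow> ('m::monoid_mult, 'b) left_act \<Rightarrow> bool" where
  "product_flat \<kappa> B \<longleftrightarrow> left_mset B \<and> lcarrier B \<noteq> {} \<and>
     (\<forall>(I :: 'u set) (X :: 'u \<Rightarrow> ('m, 'u) right_act).
        small \<kappa> I \<and> (\<forall>i\<in>I. X i \<in> Obj (PSh TYPE('m) \<kappa>)) \<longrightarrow>
        bij_betw (\<lambda>c. \<lambda>i\<in>I. tensor_map (product_mset I X) (X i) B (\<lambda>x. x i) c)
          (tensor (product_mset I X) B) (\<Pi>\<^sub>E i\<in>I. tensor (X i) B))"

text \<open>The exponential of \<open>Y\<close> by the constant \<open>M\<close>-set on \<open>I\<close> is the set of functions from \<open>I\<close> to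
  \<open>Y\<close> with pointwise action, i.e. the product of the constant family.\<close>

definition components_preserves_powers :: "'m::monoid_mult itself \<Rightarrow> 'u rel \<Rightarrow> bool" where
  "components_preserves_powers M \<kappa> \<longleftrightarrow>
     (\<forall>(I :: 'u set) (Y :: ('m, 'u) right_act). small \<kappa> I \<and> Y \<in> Obj (PSh M \<kappa>) \<longrightarrow>
        bij_betw (\<lambda>c. \<lambda>i\<in>I. components_map (product_mset I (\<lambda>_. Y)) Y (\<lambda>y. y i) c)
          (components (product_mset I (\<lambda>_. Y))) (I \<rightarrow>\<^sub>E components Y))"


section \<open>Points\<close>

text \<open>
  A point is a pair of the inverse image functor and the direct image functor. Morphisms of
  points are natural transformations between the inverse image functors.
\<close>

type_synonym ('m, 'u) psh_to_set = "(('m, 'u) right_act, 'u \<Rightarrow> 'u, 'u set set, 'u set \<Rightarrow> 'u set) ftor"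
type_synonym ('m, 'u) set_to_psh = "('u set set, 'u set \<Rightarrow> 'u set, ('m, 'u) right_act, 'u \<Rightarrow> 'u) ftor"
type_synonym ('m, 'u) point = "('m, 'u) psh_to_set \<times> ('m, 'u) set_to_psh"

definition points ::
  "'m::monoid_mult itself \<Rightarrow> 'u rel \<Rightarrow>
     (('m, 'u) point, ('m, 'u) right_act \<Rightarrow> 'u set \<Rightarrow> 'u set) cat" where
  "points M \<kappa> =
     \<lparr>Obj = {(F, G). adjoint (PSh M \<kappa>) (set_cat \<kappa>) F G \<and>
                     preserves_finite_limits (PSh M \<kappa>) (set_cat \<kappa>) F},
      Hom = \<lambda>p q. nat_trans (PSh M \<kappa>) (set_cat \<kappa>) (fst p) (fst q),
      Id = \<lambda>p. \<lambda>X\<in>Obj (PSh M \<kappa>). Id (set_cat \<kappa>) (omap (fst p) X),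
      Comp = \<lambda>p q r \<beta> \<alpha>. \<lambda>X\<in>Obj (PSh M \<kappa>).
        Comp (set_cat \<kappa>) (omap (fst p) X) (omap (fst q) X) (omap (fst r) X) (\<beta> X) (\<alpha> X)\<rparr>"

definition essential_point :: "'u rel \<Rightarrow> ('m::monoid_mult, 'u) point \<Rightarrow> bool" where
  "essential_point \<kappa> p \<longleftrightarrow> (\<exists>E. adjoint (set_cat \<kappa>) (PSh TYPE('m) \<kappa>) E (fst p))"

definition essential_points ::
  "'m::monoid_mult itself \<Rightarrow> 'u rel \<Rightarrow>
     (('m, 'u) point, ('m, 'u) right_act \<Rightarrow> 'u set \<Rightarrow> 'u set) cat" where
  "essential_points M \<kappa> = full_subcategory (points M \<kappa>) (essential_point \<kappa>)"


section \<open>Auxiliary notions\<close>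

definition left_absorbing :: "'m::monoid_mult \<Rightarrow> bool" where
  "left_absorbing l \<longleftrightarrow> (\<forall>n. n * l = l)"

definition all_equivalent :: "bool list \<Rightarrow> bool" where
  "all_equivalent Ps \<longleftrightarrow> (\<forall>P\<in>set Ps. \<forall>Q\<in>set Ps. P \<longleftrightarrow> Q)"

end

(*
  If l is left absorbing, then x ~ y in a right M-set X iff x l = y l. So C(X) is identified with the
  set X l of fixed points of l, which is represented by the right ideal l M. This gives the least sub-M-set
  {x l} M of a connected X, the initial indecomposable l M, the left adjoint S |-> S x l M of C, the
  preservation of products, and the terminal essential point X |-> X l.

  Conversely, each universal property provides a connected right M-set P and a map P -> M that is fixed by
  left multiplication with every n in M; its values are left absorbing. For powers, a zigzag in Y ^ I uses the
  same word of M in all coordinates. Applied to a chain of copies of M glued along two disjoint right ideals,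
  boundedness of zigzags gives a contradiction, so any two right ideals meet; then the zigzag joining
  the identity to the constant 1 in M ^ M shortens to a span, which is the equation m c = d for all m.
*)
theory Submission
  imports Defs
begin

section \<open>Smallness and encodings into the element type of the universe\<close>

section \<open>Small sets\<close>

text \<open>Most converse directions find the absorbing element as a value of a map t from a
  non-empty M-set P to M. For an initial indecomposable and for a left adjoint of C there is exactly
  one map from P to M, so t survives every left multiplication; for a terminal essential point it is
  the transformation out of the underlying set functor that is unique. A least right ideal has no
  such t and is argued with directly. For powers the obstacle is that \<open>C(Y)^I\<close> sees the
  coordinates one at a time, each connected by a zigzag of its own length and shape. The exponents
  are chosen to exploit this: the natural numbers make the required lengths unbounded, and M itself
  makes one pair of multipliers serve all its elements at once. The other obstacle is typing.
  Objects of \<open>PSh\<close> have their elements in one type \<open>'u\<close>, while the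
  constructions live on \<open>'m\<close>, on pairs, on functions and on options. Each is shown to
  be small and then carried into \<open>'u\<close> by \<open>copy_mset\<close>.\<close>

lemma small_image: "small \<kappa> A \<Longrightarrow> small \<kappa> (f ` A)"
  unfolding small_def using card_of_image ordLeq_ordLess_trans by blast

lemma small_subset: "small \<kappa> A \<Longrightarrow> B \<subseteq> A \<Longrightarrow> small \<kappa> B"
  unfolding small_def using card_of_mono1 ordLeq_ordLess_trans by blast

lemma small_inj: "small \<kappa> (f ` A) \<Longrightarrow> inj_on f A \<Longrightarrow> small \<kappa> A"
  by (metis inv_into_image_cancel small_image subset_refl)

text \<open>Chosen as a function of \<open>A\<close> alone, so that copies of M-sets, and the
  functors built from copies, are determined by their arguments. Injectivity on \<open>A\<close> is
  guaranteed when \<open>A\<close> is small.\<close>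

definition code :: "'a set \<Rightarrow> 'a \<Rightarrow> 'u" where
  "code A = (SOME e. inj_on e A)"

locale universe =
  fixes \<kappa> :: "'u rel" and M :: "'m::monoid_mult itself"
  assumes universe: "universe_card TYPE('m) \<kappa>"
begin

lemma card_order: "Card_order \<kappa>"
  using universe by (simp add: universe_card_def)

lemma infinite_Field: "infinite (Field \<kappa>)"
  using universe
  by (metis card_of_Field_ordIso card_of_ordLeq_finite infinite_UNIV_nat ordLess_imp_ordLeq
      ordLess_ordIso_trans ordIso_symmetric universe_card_def)

lemma small_UNIV_nat: "small \<kappa> (UNIV :: nat set)"
  and small_UNIV_monoid: "small \<kappa> (UNIV :: 'm set)"
  using universe by (simp_all add: universe_card_def small_def)

lemma small_nat: "small \<kappa> (A :: nat set)"
  by (rule small_subset[OF small_UNIV_nat]) simp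

lemma small_monoid: "small \<kappa> (A :: 'm set)"
  by (rule small_subset[OF small_UNIV_monoid]) simp

lemma small_finite: "finite A \<Longrightarrow> small \<kappa> A"
  by (metis finite_imp_nat_seg_image_inj_on small_image small_nat)

text \<open>Regularity of \<kappa> enters here: an infinite regular cardinal is stable, that is, a
  small sum of small sets is small.\<close>

lemma small_Times: "small \<kappa> A \<Longrightarrow> small \<kappa> B \<Longrightarrow> small \<kappa> (A \<times> B)"
  unfolding small_def
  using stable_elim[OF regularCard_stable[OF card_order infinite_Field], of A "\<lambda>_. B"] universe
  by (simp add: universe_card_def)

lemma inj_on_code:
  assumes "small \<kappa> A"
  shows "inj_on (code A :: 'a \<Rightarrow> 'u) A"
proof -
  have "|A| \<le>o |Field \<kappa>|"
    using assms card_order unfolding small_def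
    by (meson card_of_Field_ordIso ordIso_symmetric ordLess_imp_ordLeq ordLess_ordIso_trans)
  then obtain e :: "'a \<Rightarrow> 'u" where "inj_on e A"
    using card_of_ordLeq[of A "Field \<kappa>"] by blast
  then show ?thesis
    unfolding code_def by (rule someI[where P = "\<lambda>e. inj_on e A"])
qed

text \<open>The closure condition of \<open>universe_card\<close> speaks of sets of elements of
  \<open>'u\<close>. Composition with an encoding extends it to every element type, which is what
  makes coinduced M-sets small.\<close>

lemma small_functions:
  assumes "small \<kappa> A"
  shows "small \<kappa> ((UNIV :: 'm set) \<rightarrow>\<^sub>E A)"
proof -
  let ?e = "code A :: 'a \<Rightarrow> 'u"
  have "small \<kappa> ((UNIV :: 'm set) \<rightarrow>\<^sub>E ?e ` A)"
    using universe small_image[OF assms, of ?e] by (simp add: universe_card_def small_def)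
  then have "small \<kappa> ((\<lambda>f. ?e \<circ> f) ` ((UNIV :: 'm set) \<rightarrow>\<^sub>E A))"
    by (rule small_subset) auto
  moreover have "inj_on (\<lambda>f. ?e \<circ> f) ((UNIV :: 'm set) \<rightarrow>\<^sub>E A)"
  proof (rule inj_onI)
    fix f g assume "f \<in> (UNIV :: 'm set) \<rightarrow>\<^sub>E A" "g \<in> (UNIV :: 'm set) \<rightarrow>\<^sub>E A" "?e \<circ> f = ?e \<circ> g"
    then show "f = g"
      by (intro ext inj_onD[OF inj_on_code[OF assms]]) (auto dest: fun_cong)
  qed
  ultimately show ?thesis
    by (rule small_inj)
qed

end

section \<open>Separate naturality, preservation of limits, and adjunctions from universal
  arrows\<close>

section \<open>Adjunctions\<close>

lemma categoryD:
  assumes "category A"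
  shows "x \<in> Obj A \<Longrightarrow> Id A x \<in> Hom A x x"
    and "x \<in> Obj A \<Longrightarrow> y \<in> Obj A \<Longrightarrow> z \<in> Obj A \<Longrightarrow> f \<in> Hom A x y \<Longrightarrow> g \<in> Hom A y z \<Longrightarrow>
      Comp A x y z g f \<in> Hom A x z"
    and "x \<in> Obj A \<Longrightarrow> y \<in> Obj A \<Longrightarrow> f \<in> Hom A x y \<Longrightarrow> Comp A x x y f (Id A x) = f"
    and "x \<in> Obj A \<Longrightarrow> y \<in> Obj A \<Longrightarrow> f \<in> Hom A x y \<Longrightarrow> Comp A x y y (Id A y) f = f"
    and "w \<in> Obj A \<Longrightarrow> x \<in> Obj A \<Longrightarrow> y \<in> Obj A \<Longrightarrow> z \<in> Obj A \<Longrightarrow>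
      f \<in> Hom A w x \<Longrightarrow> g \<in> Hom A x y \<Longrightarrow> h \<in> Hom A y z \<Longrightarrow>
      Comp A w x z (Comp A x y z h g) f = Comp A w y z h (Comp A w x y g f)"
  using assms unfolding category_def by blast+

lemma is_ftorD:
  assumes "is_ftor A B F"
  shows "x \<in> Obj A \<Longrightarrow> omap F x \<in> Obj B"
    and "x \<in> Obj A \<Longrightarrow> y \<in> Obj A \<Longrightarrow> f \<in> Hom A x y \<Longrightarrow> amap F x y f \<in> Hom B (omap F x) (omap F y)"
    and "x \<in> Obj A \<Longrightarrow> amap F x x (Id A x) = Id B (omap F x)"
    and "x \<in> Obj A \<Longrightarrow> y \<in> Obj A \<Longrightarrow> z \<in> Obj A \<Longrightarrow> f \<in> Hom A x y \<Longrightarrow> g \<in> Hom A y z \<Longrightarrow>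
      amap F x z (Comp A x y z g f) =
      Comp B (omap F x) (omap F y) (omap F z) (amap F y z g) (amap F x y f)"
  using assms unfolding is_ftor_def by blast+

text \<open>\<open>adjoint\<close> states naturality in both variables at once; an identity in one
  variable isolates the other.\<close>

lemma adjointE:
  assumes "adjoint A B L R" "category A" "category B"
  obtains \<phi> where
    "\<And>a b. a \<in> Obj A \<Longrightarrow> b \<in> Obj B \<Longrightarrow> bij_betw (\<phi> a b) (Hom B (omap L a) b) (Hom A a (omap R b))"
    "\<And>a b b' f k. a \<in> Obj A \<Longrightarrow> b \<in> Obj B \<Longrightarrow> b' \<in> Obj B \<Longrightarrow>
      f \<in> Hom B (omap L a) b \<Longrightarrow> k \<in> Hom B b b' \<Longrightarrow>
      \<phi> a b' (Comp B (omap L a) b b' k f) =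
      Comp A a (omap R b) (omap R b') (amap R b b' k) (\<phi> a b f)"
    "\<And>a a' b f h. a \<in> Obj A \<Longrightarrow> a' \<in> Obj A \<Longrightarrow> b \<in> Obj B \<Longrightarrow>
      h \<in> Hom A a' a \<Longrightarrow> f \<in> Hom B (omap L a) b \<Longrightarrow>
      \<phi> a' b (Comp B (omap L a') (omap L a) b f (amap L a' a h)) =
      Comp A a' a (omap R b) (\<phi> a b f) h"
proof -
  note A = categoryD[OF assms(2)] and B = categoryD[OF assms(3)]
  have "is_ftor A B L" "is_ftor B A R"
    using assms(1) by (simp_all add: adjoint_def)
  note L = is_ftorD[OF this(1)] and R = is_ftorD[OF this(2)]
  obtain \<phi> where
    bij: "\<And>a b. a \<in> Obj A \<Longrightarrow> b \<in> Obj B \<Longrightarrow> bij_betw (\<phi> a b) (Hom B (omap L a) b) (Hom A a (omap R b))"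
    and nat: "\<And>a a' b b' h f k. a \<in> Obj A \<Longrightarrow> a' \<in> Obj A \<Longrightarrow> b \<in> Obj B \<Longrightarrow> b' \<in> Obj B \<Longrightarrow>
      h \<in> Hom A a' a \<Longrightarrow> f \<in> Hom B (omap L a) b \<Longrightarrow> k \<in> Hom B b b' \<Longrightarrow>
      \<phi> a' b' (Comp B (omap L a') b b' k (Comp B (omap L a') (omap L a) b f (amap L a' a h))) =
      Comp A a' (omap R b) (omap R b') (amap R b b' k) (Comp A a' a (omap R b) (\<phi> a b f) h)"
    using assms(1) unfolding adjoint_def by blast
  have \<phi>: "\<phi> a b f \<in> Hom A a (omap R b)"
    if "a \<in> Obj A" "b \<in> Obj B" "f \<in> Hom B (omap L a) b" for a b f
    using bij[OF that(1,2)] that(3) by (auto simp: bij_betw_def)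
  show thesis
  proof
    fix a b b' f k
    assume *: "a \<in> Obj A" "b \<in> Obj B" "b' \<in> Obj B" "f \<in> Hom B (omap L a) b" "k \<in> Hom B b b'"
    show "\<phi> a b' (Comp B (omap L a) b b' k f) =
      Comp A a (omap R b) (omap R b') (amap R b b' k) (\<phi> a b f)"
      using nat[OF *(1) *(1) *(2,3) A(1)[OF *(1)] *(4,5)] * \<phi>[of a b f]
      by (simp add: L B A R)
  next
    fix a a' b f h
    assume *: "a \<in> Obj A" "a' \<in> Obj A" "b \<in> Obj B" "h \<in> Hom A a' a" "f \<in> Hom B (omap L a) b"
    have 1: "Comp B (omap L a') (omap L a) b f (amap L a' a h) \<in> Hom B (omap L a') b"
      using * by (intro B(2)) (auto intro: L)
    have 2: "Comp A a' a (omap R b) (\<phi> a b f) h \<in> Hom A a' (omap R b)"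
      using * \<phi> by (intro A(2)) (auto intro: R)
    show "\<phi> a' b (Comp B (omap L a') (omap L a) b f (amap L a' a h)) =
      Comp A a' a (omap R b) (\<phi> a b f) h"
      using nat[OF *(1,2,3) *(3) *(4,5) B(1)[OF *(3)]] * 1 2 by (simp add: L B A R)
  qed (use bij in auto)
qed

text \<open>Transposition turns a cone from \<open>y\<close> over R D into a cone from L y over D,
  so factorisations through the limit correspond on the two sides.\<close>

lemma right_adjoint_preserves_limits:
  assumes adj: "adjoint A B L R" and A: "category A" and B: "category B"
  shows "preserves_limits J B A R"
  unfolding preserves_limits_def
proof (intro allI impI, elim conjE)
  fix D x \<pi>
  assume D: "is_ftor J B D" and lim: "limit_cone J B D x \<pi>"
  obtain \<phi> where
    bij: "\<And>a b. a \<in> Obj A \<Longrightarrow> b \<in> Obj B \<Longrightarrow> bij_betw (\<phi> a b) (Hom B (omap L a) b) (Hom A a (omap R b))"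
    and nat: "\<And>a b b' f k. a \<in> Obj A \<Longrightarrow> b \<in> Obj B \<Longrightarrow> b' \<in> Obj B \<Longrightarrow>
      f \<in> Hom B (omap L a) b \<Longrightarrow> k \<in> Hom B b b' \<Longrightarrow>
      \<phi> a b' (Comp B (omap L a) b b' k f) =
      Comp A a (omap R b) (omap R b') (amap R b b' k) (\<phi> a b f)"
    using adjointE[OF assms] by metis
  note inj = inj_onD[OF bij_betw_imp_inj_on[OF bij]]
  have surj: "\<exists>f. f \<in> Hom B (omap L a) b \<and> \<phi> a b f = g"
    if "a \<in> Obj A" "b \<in> Obj B" "g \<in> Hom A a (omap R b)" for a b g
    using bij_betw_imp_surj_on[OF bij[OF that(1,2)]] that(3) by (metis imageE)
  have fL: "is_ftor A B L" and fR: "is_ftor B A R"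
    using adj by (simp_all add: adjoint_def)
  note [simp] = is_ftorD(1)[OF fL] is_ftorD(1,2)[OF fR] is_ftorD(1,2)[OF D] categoryD(2)[OF B]
  have x [simp]: "x \<in> Obj B" and \<pi> [simp]: "\<And>j. j \<in> Obj J \<Longrightarrow> \<pi> j \<in> Hom B x (omap D j)"
    and \<pi>_comp: "\<And>j k u. j \<in> Obj J \<Longrightarrow> k \<in> Obj J \<Longrightarrow> u \<in> Hom J j k \<Longrightarrow>
       Comp B x (omap D j) (omap D k) (amap D j k u) (\<pi> j) = \<pi> k"
    using lim by (simp_all add: limit_cone_def cone_def)
  have "cone J A (comp_ftor R D) (omap R x) (\<lambda>j. amap R x (omap D j) (\<pi> j))"
    unfolding cone_def comp_ftor_def
    by (simp add: is_ftorD(4)[OF fR, symmetric] \<pi>_comp)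
  moreover have "\<exists>!h. h \<in> Hom A y (omap R x) \<and>
      (\<forall>j\<in>Obj J. Comp A y (omap R x) (omap R (omap D j)) (amap R x (omap D j) (\<pi> j)) h = \<mu> j)"
    if c: "cone J A (comp_ftor R D) y \<mu>" for y \<mu>
  proof -
    have y [simp]: "y \<in> Obj A" and \<mu> [simp]: "\<And>j. j \<in> Obj J \<Longrightarrow> \<mu> j \<in> Hom A y (omap R (omap D j))"
      and \<mu>_comp: "\<And>j k u. j \<in> Obj J \<Longrightarrow> k \<in> Obj J \<Longrightarrow> u \<in> Hom J j k \<Longrightarrow>
        Comp A y (omap R (omap D j)) (omap R (omap D k)) (amap R (omap D j) (omap D k) (amap D j k u)) (\<mu> j) = \<mu> k"
      using c by (simp_all add: cone_def comp_ftor_def)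
    have "\<forall>j\<in>Obj J. \<exists>g. g \<in> Hom B (omap L y) (omap D j) \<and> \<phi> y (omap D j) g = \<mu> j"
      by (simp add: surj)
    then obtain \<nu> where \<nu> [simp]: "\<And>j. j \<in> Obj J \<Longrightarrow> \<nu> j \<in> Hom B (omap L y) (omap D j)"
      and \<phi>\<nu>: "\<And>j. j \<in> Obj J \<Longrightarrow> \<phi> y (omap D j) (\<nu> j) = \<mu> j"
      by metis
    have "cone J B D (omap L y) \<nu>"
      unfolding cone_def
    proof (intro conjI ballI)
      fix j k u assume *: "j \<in> Obj J" "k \<in> Obj J" "u \<in> Hom J j k"
      show "Comp B (omap L y) (omap D j) (omap D k) (amap D j k u) (\<nu> j) = \<nu> k"
        by (rule inj[of y "omap D k"]) (use * in \<open>simp_all add: nat \<phi>\<nu> \<mu>_comp\<close>)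
    qed simp_all
    then have ex1: "\<exists>!h. h \<in> Hom B (omap L y) x \<and> (\<forall>j\<in>Obj J. Comp B (omap L y) x (omap D j) (\<pi> j) h = \<nu> j)"
      using lim by (simp add: limit_cone_def)
    then obtain h where h: "h \<in> Hom B (omap L y) x"
      "\<And>j. j \<in> Obj J \<Longrightarrow> Comp B (omap L y) x (omap D j) (\<pi> j) h = \<nu> j"
      by blast
    show ?thesis
    proof (rule ex1I[of _ "\<phi> y x h"], intro conjI ballI)
      show "\<phi> y x h \<in> Hom A y (omap R x)"
        using bij[of y x] h(1) by (auto simp: bij_betw_def)
      show "Comp A y (omap R x) (omap R (omap D j)) (amap R x (omap D j) (\<pi> j)) (\<phi> y x h) = \<mu> j"
        if "j \<in> Obj J" for j
        using that h by (simp add: nat[symmetric] \<phi>\<nu>)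
    next
      fix g
      assume g: "g \<in> Hom A y (omap R x) \<and>
        (\<forall>j\<in>Obj J. Comp A y (omap R x) (omap R (omap D j)) (amap R x (omap D j) (\<pi> j)) g = \<mu> j)"
      obtain h' where h': "h' \<in> Hom B (omap L y) x" "\<phi> y x h' = g"
        using surj[of y x g] g by auto
      have "Comp B (omap L y) x (omap D j) (\<pi> j) h' = \<nu> j" if "j \<in> Obj J" for j
        by (rule inj[of y "omap D j"]) (use that g h' in \<open>simp_all add: nat \<phi>\<nu>\<close>)
      then have "h' = h"
        using ex1 h h' by blast
      then show "g = \<phi> y x h"
        using h' by simp
    qed
  qed
  ultimately show "limit_cone J A (comp_ftor R D) (omap R x) (\<lambda>j. amap R x (omap D j) (\<pi> j))"
    by (simp add: limit_cone_def comp_ftor_def)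
qed

text \<open>Only values of \<open>L\<close> on objects and arrows are given. Functoriality follows
  from the uniqueness in the universal property of the unit, applied to identities and
  composites.\<close>

lemma left_adjoint_from_unit:
  assumes A: "category A" and B: "category B" and R: "is_ftor B A R"
    and Lo: "\<And>a. a \<in> Obj A \<Longrightarrow> omap L a \<in> Obj B"
    and La: "\<And>a a' h. a \<in> Obj A \<Longrightarrow> a' \<in> Obj A \<Longrightarrow> h \<in> Hom A a a' \<Longrightarrow>
      amap L a a' h \<in> Hom B (omap L a) (omap L a')"
    and \<eta>: "\<And>a. a \<in> Obj A \<Longrightarrow> \<eta> a \<in> Hom A a (omap R (omap L a))"
    and nat: "\<And>a a' h. a \<in> Obj A \<Longrightarrow> a' \<in> Obj A \<Longrightarrow> h \<in> Hom A a a' \<Longrightarrow>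
      Comp A a (omap R (omap L a)) (omap R (omap L a')) (amap R (omap L a) (omap L a') (amap L a a' h)) (\<eta> a)
      = Comp A a a' (omap R (omap L a')) (\<eta> a') h"
    and univ: "\<And>a b g. a \<in> Obj A \<Longrightarrow> b \<in> Obj B \<Longrightarrow> g \<in> Hom A a (omap R b) \<Longrightarrow>
      \<exists>!f. f \<in> Hom B (omap L a) b \<and> Comp A a (omap R (omap L a)) (omap R b) (amap R (omap L a) b f) (\<eta> a) = g"
  shows "adjoint A B L R"
proof -
  define \<phi> where "\<phi> a b f = Comp A a (omap R (omap L a)) (omap R b) (amap R (omap L a) b f) (\<eta> a)" for a b f
  note [simp] = Lo La \<eta> categoryD[OF A] categoryD[OF B] is_ftorD(1-3)[OF R]
  have \<phi>: "\<phi> a b f \<in> Hom A a (omap R b)"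
    if "a \<in> Obj A" "b \<in> Obj B" "f \<in> Hom B (omap L a) b" for a b f
    using that by (simp add: \<phi>_def)
  have bij: "bij_betw (\<phi> a b) (Hom B (omap L a) b) (Hom A a (omap R b))" if "a \<in> Obj A" "b \<in> Obj B" for a b
  proof (rule bij_betw_imageI)
    show "inj_on (\<phi> a b) (Hom B (omap L a) b)"
      by (rule inj_onI) (use univ[OF that] \<phi>[OF that] in \<open>metis \<phi>_def\<close>)
    show "\<phi> a b ` Hom B (omap L a) b = Hom A a (omap R b)"
      using univ[OF that] \<phi>[OF that] by (fastforce simp: \<phi>_def)
  qed
  note inj = inj_onD[OF bij_betw_imp_inj_on[OF bij]]
  have post: "\<phi> a b' (Comp B (omap L a) b b' k f) = Comp A a (omap R b) (omap R b') (amap R b b' k) (\<phi> a b f)"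
    if "a \<in> Obj A" "b \<in> Obj B" "b' \<in> Obj B" "f \<in> Hom B (omap L a) b" "k \<in> Hom B b b'" for a b b' f k
    using that by (simp add: \<phi>_def is_ftorD(4)[OF R])
  have pre: "\<phi> a' b (Comp B (omap L a') (omap L a) b f (amap L a' a h)) = Comp A a' a (omap R b) (\<phi> a b f) h"
    if "a \<in> Obj A" "a' \<in> Obj A" "b \<in> Obj B" "h \<in> Hom A a' a" "f \<in> Hom B (omap L a) b" for a a' b f h
    using that by (simp add: \<phi>_def is_ftorD(4)[OF R] nat)
  have \<phi>L: "\<phi> a (omap L a') (amap L a a' h) = Comp A a a' (omap R (omap L a')) (\<eta> a') h"
    if "a \<in> Obj A" "a' \<in> Obj A" "h \<in> Hom A a a'" for a a' h
    using that by (simp add: \<phi>_def nat)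
  have "is_ftor A B L"
    unfolding is_ftor_def
  proof (intro conjI ballI)
    fix a assume a: "a \<in> Obj A"
    show "amap L a a (Id A a) = Id B (omap L a)"
      by (rule inj[of a "omap L a"]) (use a in \<open>simp_all add: \<phi>L, simp add: \<phi>_def\<close>)
  next
    fix a b c f g assume *: "a \<in> Obj A" "b \<in> Obj A" "c \<in> Obj A" "f \<in> Hom A a b" "g \<in> Hom A b c"
    show "amap L a c (Comp A a b c g f) = Comp B (omap L a) (omap L b) (omap L c) (amap L b c g) (amap L a b f)"
      by (rule inj[of a "omap L c"]) (use * in \<open>simp_all add: \<phi>L pre\<close>)
  qed simp_all
  moreover have "\<phi> a' b' (Comp B (omap L a') b b' k (Comp B (omap L a') (omap L a) b f (amap L a' a h))) =
      Comp A a' (omap R b) (omap R b') (amap R b b' k) (Comp A a' a (omap R b) (\<phi> a b f) h)"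
    if "a \<in> Obj A" "a' \<in> Obj A" "b \<in> Obj B" "b' \<in> Obj B" "h \<in> Hom A a' a" "f \<in> Hom B (omap L a) b"
      "k \<in> Hom B b b'" for a a' b b' h f k
    using that by (subst post) (simp_all add: pre)
  ultimately show ?thesis
    using R bij unfolding adjoint_def by blast
qed

text \<open>The dual construction: \<open>R\<close> becomes a functor by uniqueness of
  factorisations through the counit.\<close>

lemma right_adjoint_from_counit:
  assumes A: "category A" and B: "category B" and L: "is_ftor A B L"
    and Ro: "\<And>b. b \<in> Obj B \<Longrightarrow> omap R b \<in> Obj A"
    and Ra: "\<And>b b' k. b \<in> Obj B \<Longrightarrow> b' \<in> Obj B \<Longrightarrow> k \<in> Hom B b b' \<Longrightarrow>
      amap R b b' k \<in> Hom A (omap R b) (omap R b')"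
    and \<epsilon>: "\<And>b. b \<in> Obj B \<Longrightarrow> \<epsilon> b \<in> Hom B (omap L (omap R b)) b"
    and nat: "\<And>b b' k. b \<in> Obj B \<Longrightarrow> b' \<in> Obj B \<Longrightarrow> k \<in> Hom B b b' \<Longrightarrow>
      Comp B (omap L (omap R b)) (omap L (omap R b')) b' (\<epsilon> b') (amap L (omap R b) (omap R b') (amap R b b' k))
      = Comp B (omap L (omap R b)) b b' k (\<epsilon> b)"
    and univ: "\<And>a b f. a \<in> Obj A \<Longrightarrow> b \<in> Obj B \<Longrightarrow> f \<in> Hom B (omap L a) b \<Longrightarrow>
      \<exists>!g. g \<in> Hom A a (omap R b) \<and> Comp B (omap L a) (omap L (omap R b)) b (\<epsilon> b) (amap L a (omap R b) g) = f"
  shows "adjoint A B L R"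
proof -
  define \<psi> where "\<psi> a b g = Comp B (omap L a) (omap L (omap R b)) b (\<epsilon> b) (amap L a (omap R b) g)" for a b g
  note [simp] = Ro Ra \<epsilon> categoryD[OF A] categoryD[OF B] is_ftorD(1-3)[OF L]
  have \<psi>: "\<psi> a b g \<in> Hom B (omap L a) b"
    if "a \<in> Obj A" "b \<in> Obj B" "g \<in> Hom A a (omap R b)" for a b g
    using that by (simp add: \<psi>_def)
  have bij: "bij_betw (\<psi> a b) (Hom A a (omap R b)) (Hom B (omap L a) b)" if "a \<in> Obj A" "b \<in> Obj B" for a b
  proof (rule bij_betw_imageI)
    show "inj_on (\<psi> a b) (Hom A a (omap R b))"
      by (rule inj_onI) (use univ[OF that] \<psi>[OF that] in \<open>metis \<psi>_def\<close>)
    show "\<psi> a b ` Hom A a (omap R b) = Hom B (omap L a) b"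
      using univ[OF that] \<psi>[OF that] by (fastforce simp: \<psi>_def)
  qed
  note inj = inj_onD[OF bij_betw_imp_inj_on[OF bij]]
  have pre: "\<psi> a' b (Comp A a' a (omap R b) g h) = Comp B (omap L a') (omap L a) b (\<psi> a b g) (amap L a' a h)"
    if "a \<in> Obj A" "a' \<in> Obj A" "b \<in> Obj B" "h \<in> Hom A a' a" "g \<in> Hom A a (omap R b)" for a a' b g h
    using that by (simp add: \<psi>_def is_ftorD(4)[OF L])
  have post: "\<psi> a b' (Comp A a (omap R b) (omap R b') (amap R b b' k) g) = Comp B (omap L a) b b' k (\<psi> a b g)"
    if "a \<in> Obj A" "b \<in> Obj B" "b' \<in> Obj B" "g \<in> Hom A a (omap R b)" "k \<in> Hom B b b'" for a b b' g k
  proof -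
    have "\<psi> a b' (Comp A a (omap R b) (omap R b') (amap R b b' k) g) =
      Comp B (omap L a) (omap L (omap R b)) b' (Comp B (omap L (omap R b)) (omap L (omap R b')) b' (\<epsilon> b')
        (amap L (omap R b) (omap R b') (amap R b b' k))) (amap L a (omap R b) g)"
      using that by (simp add: \<psi>_def is_ftorD(4)[OF L])
    also have "\<dots> = Comp B (omap L a) b b' k (\<psi> a b g)"
      using that by (simp add: nat) (simp add: \<psi>_def)
    finally show ?thesis .
  qed
  have \<psi>R: "\<psi> (omap R b) b' (amap R b b' k) = Comp B (omap L (omap R b)) b b' k (\<epsilon> b)"
    if "b \<in> Obj B" "b' \<in> Obj B" "k \<in> Hom B b b'" for b b' k
    using that by (simp add: \<psi>_def nat)
  have R: "is_ftor B A R"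
    unfolding is_ftor_def
  proof (intro conjI ballI)
    fix b assume b: "b \<in> Obj B"
    show "amap R b b (Id B b) = Id A (omap R b)"
      by (rule inj[of "omap R b" b]) (use b in \<open>simp_all add: \<psi>R, simp add: \<psi>_def\<close>)
  next
    fix a b c f g assume *: "a \<in> Obj B" "b \<in> Obj B" "c \<in> Obj B" "f \<in> Hom B a b" "g \<in> Hom B b c"
    show "amap R a c (Comp B a b c g f) = Comp A (omap R a) (omap R b) (omap R c) (amap R b c g) (amap R a b f)"
      by (rule inj[of "omap R a" c]) (use * in \<open>simp_all add: \<psi>R post\<close>)
  qed simp_all
  \<comment> \<open>Factoring through the counit gives bijections \<psi> from the hom-sets of
    \<open>A\<close> to those of \<open>B\<close>, opposite to the direction in
    \<open>adjoint\<close>.\<close>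
  define \<phi> where "\<phi> a b = inv_into (Hom A a (omap R b)) (\<psi> a b)" for a b
  have \<phi>bij: "bij_betw (\<phi> a b) (Hom B (omap L a) b) (Hom A a (omap R b))" if "a \<in> Obj A" "b \<in> Obj B" for a b
    unfolding \<phi>_def using bij_betw_inv_into[OF bij[OF that]] .
  have \<phi>: "\<phi> a b f \<in> Hom A a (omap R b)" "\<psi> a b (\<phi> a b f) = f"
    if "a \<in> Obj A" "b \<in> Obj B" "f \<in> Hom B (omap L a) b" for a b f
    using bij[OF that(1,2)] that(3) unfolding \<phi>_def bij_betw_def
    by (metis inv_into_into, metis f_inv_into_f)
  have "\<phi> a' b' (Comp B (omap L a') b b' k (Comp B (omap L a') (omap L a) b f (amap L a' a h))) =
      Comp A a' (omap R b) (omap R b') (amap R b b' k) (Comp A a' a (omap R b) (\<phi> a b f) h)"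
    if "a \<in> Obj A" "a' \<in> Obj A" "b \<in> Obj B" "b' \<in> Obj B" "h \<in> Hom A a' a" "f \<in> Hom B (omap L a) b"
      "k \<in> Hom B b b'" for a a' b b' h f k
  proof (rule inj[of a' b'])
    have "\<psi> a' b' (Comp A a' (omap R b) (omap R b') (amap R b b' k) (Comp A a' a (omap R b) (\<phi> a b f) h)) =
      Comp B (omap L a') b b' k (\<psi> a' b (Comp A a' a (omap R b) (\<phi> a b f) h))"
      using that \<phi> by (intro post) simp_all
    then show "\<psi> a' b' (\<phi> a' b' (Comp B (omap L a') b b' k (Comp B (omap L a') (omap L a) b f (amap L a' a h)))) =
      \<psi> a' b' (Comp A a' (omap R b) (omap R b') (amap R b b' k) (Comp A a' a (omap R b) (\<phi> a b f) h))"
      using that \<phi> by (simp add: pre)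
  qed (use that \<phi> in simp_all)
  then show ?thesis
    using L R \<phi>bij unfolding adjoint_def by blast
qed

section \<open>The components functor, and indecomposability as connectedness\<close>

section \<open>Components of M-sets\<close>

lemma set_cat_simps [simp]:
  "Obj (set_cat \<kappa>) = {A. small \<kappa> A}" "Hom (set_cat \<kappa>) A B = A \<rightarrow>\<^sub>E B"
  "Id (set_cat \<kappa>) A = (\<lambda>x\<in>A. x)" "Comp (set_cat \<kappa>) A B C g f = compose A g f"
  by (simp_all add: set_cat_def)

lemma PSh_simps [simp]:
  "X \<in> Obj (PSh M \<kappa>) \<longleftrightarrow> right_mset X \<and> small \<kappa> (rcarrier X)" "Hom (PSh M \<kappa>) = rhom"
  "Id (PSh M \<kappa>) X = (\<lambda>x\<in>rcarrier X. x)" "Comp (PSh M \<kappa>) X Y Z g f = compose (rcarrier X) g f"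
  by (simp_all add: PSh_def)

lemma right_msetD:
  assumes "right_mset X" "x \<in> rcarrier X"
  shows "ract X x m \<in> rcarrier X" "ract X x 1 = x" "ract X (ract X x m) n = ract X x (m * n)"
  using assms by (simp_all add: right_mset_def)

lemma rhomD:
  assumes "f \<in> rhom X Y"
  shows "f \<in> rcarrier X \<rightarrow>\<^sub>E rcarrier Y" "f \<in> extensional (rcarrier X)"
    "x \<in> rcarrier X \<Longrightarrow> f x \<in> rcarrier Y"
    "x \<in> rcarrier X \<Longrightarrow> f (ract X x m) = ract Y (f x) m"
  using assms by (auto simp: rhom_def PiE_def)

lemma rhomI:
  assumes "\<And>x. x \<in> rcarrier X \<Longrightarrow> f x \<in> rcarrier Y"
    and "\<And>x m. x \<in> rcarrier X \<Longrightarrow> f (ract X x m) = ract Y (f x) m"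
    and "f \<in> extensional (rcarrier X)"
  shows "f \<in> rhom X Y"
  using assms by (auto simp: rhom_def PiE_def)

lemma restrict_rhomI:
  assumes "right_mset X"
    and "\<And>x. x \<in> rcarrier X \<Longrightarrow> f x \<in> rcarrier Y"
    and "\<And>x m. x \<in> rcarrier X \<Longrightarrow> f (ract X x m) = ract Y (f x) m"
  shows "(\<lambda>x\<in>rcarrier X. f x) \<in> rhom X Y"
  using assms by (auto intro!: rhomI simp: right_msetD)

lemma compose_rhom:
  assumes "right_mset X" "f \<in> rhom X Y" "g \<in> rhom Y Z"
  shows "compose (rcarrier X) g f \<in> rhom X Z"
  using assms by (auto intro!: rhomI simp: compose_def right_msetD rhomD)

lemma compose_PiE: "f \<in> A \<rightarrow>\<^sub>E B \<Longrightarrow> g \<in> B \<rightarrow>\<^sub>E C \<Longrightarrow> compose A g f \<in> A \<rightarrow>\<^sub>E C"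
  by (simp add: PiE_def) (metis IntE funcset_compose)

lemma compose_restrict_id:
  assumes "f \<in> A \<rightarrow>\<^sub>E B"
  shows "compose A f (\<lambda>x\<in>A. x) = f" "compose A (\<lambda>x\<in>B. x) f = f"
  using assms by (auto simp: PiE_def intro!: compose_Id Id_compose)

lemma compose_assoc_PiE:
  "f \<in> A \<rightarrow>\<^sub>E B \<Longrightarrow> compose A (compose B h g) f = compose A h (compose A g f)"
  by (rule compose_assoc[symmetric]) (simp add: PiE_def)

lemma category_set_cat: "category (set_cat \<kappa>)"
  unfolding category_def
  by (intro conjI ballI) (simp_all add: compose_PiE compose_restrict_id compose_assoc_PiE restrict_PiE)

lemma category_PSh: "category (PSh M \<kappa>)"
  unfolding category_def
  by (intro conjI ballI)
    (simp_all add: restrict_rhomI right_msetD compose_rhom compose_restrict_id[OF rhomD(1)]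
      compose_assoc_PiE[OF rhomD(1)])

lemma equiv_conn: "equiv (rcarrier X) (conn X)"
  by (rule equivI) (auto simp: conn_def refl_on_def intro!: symI transI elim: equivclp_sym dest: equivclp_trans)

lemma conn_step:
  assumes "right_mset X" "x \<in> rcarrier X"
  shows "(x, ract X x m) \<in> conn X"
  using assms unfolding conn_def by (auto simp: right_msetD intro!: r_into_equivclp)

text \<open>The induction principle for zigzags: a relation that is an equivalence and contains the
  single steps contains all connections. It is applied to kernels of invariants, to bounded distance
  and to spans.\<close>

lemma conn_least:
  assumes R: "equiv (rcarrier X) R" and step: "\<And>x m. x \<in> rcarrier X \<Longrightarrow> (x, ract X x m) \<in> R"
  shows "conn X \<subseteq> R"
proof
  fix p assume "p \<in> conn X"
  then obtain x y where p: "p = (x, y)" and x: "x \<in> rcarrier X"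
    and xy: "equivclp (\<lambda>v w. v \<in> rcarrier X \<and> (\<exists>m. w = ract X v m)) x y"
    by (auto simp: conn_def)
  from xy have "(x, y) \<in> R"
  proof (induction rule: equivclp_induct)
    case base
    show ?case using R x by (simp add: equiv_def refl_on_def)
  next
    case (step y z)
    then have "(y, z) \<in> R"
      using assms by (metis equivE symE)
    then show ?case using step.IH R by (metis equivE transE)
  qed
  then show "p \<in> R" by (simp add: p)
qed

lemma conn_invariant:
  assumes "right_mset X" "\<And>x m. x \<in> rcarrier X \<Longrightarrow> h (ract X x m) = h x" "(x, y) \<in> conn X"
  shows "h x = h y"
proof -
  let ?R = "{(x, y). x \<in> rcarrier X \<and> y \<in> rcarrier X \<and> h x = h y}"
  have "conn X \<subseteq> ?R"
    using assms by (intro conn_least) (auto simp: equiv_def refl_on_def sym_def trans_def right_msetD)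
  then show ?thesis using assms(3) by auto
qed

lemma class_eq_iff:
  "x \<in> rcarrier X \<Longrightarrow> y \<in> rcarrier X \<Longrightarrow> conn X `` {x} = conn X `` {y} \<longleftrightarrow> (x, y) \<in> conn X"
  using equiv_conn by (rule eq_equiv_class_iff)

lemma class_ract:
  assumes "right_mset X" "x \<in> rcarrier X"
  shows "conn X `` {ract X x m} = conn X `` {x}"
  using assms conn_step[OF assms] by (metis class_eq_iff right_msetD(1))

lemma conn_map:
  assumes "right_mset X" "right_mset Y" "f \<in> rhom X Y" "(x, y) \<in> conn X"
  shows "(f x, f y) \<in> conn Y"
proof -
  have "conn Y `` {f x} = conn Y `` {f y}"
    using assms(1) _ assms(4)
    by (rule conn_invariant) (use assms in \<open>simp add: rhomD class_ract\<close>)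
  moreover have "x \<in> rcarrier X" "y \<in> rcarrier X"
    using assms(4) by (simp_all add: conn_def)
  ultimately show ?thesis
    using assms(3) by (simp add: class_eq_iff rhomD)
qed

text \<open>\<open>components_map\<close> saturates the image of a class. A homomorphism sends a
  class into one class, so the saturation is a single class.\<close>

lemma components_map_class:
  assumes "right_mset X" "right_mset Y" "f \<in> rhom X Y" "x \<in> rcarrier X"
  shows "components_map X Y f (conn X `` {x}) = conn Y `` {f x}"
proof -
  have "conn Y `` {f y} = conn Y `` {f x}" if "y \<in> conn X `` {x}" for y
  proof -
    have "(f x, f y) \<in> conn Y" "y \<in> rcarrier X"
      using that conn_map[OF assms(1-3)] by (auto simp: conn_def)
    then show ?thesis
      using assms(3,4) by (metis class_eq_iff rhomD(3))
  qed
  then have "(\<Union>y\<in>conn X `` {x}. conn Y `` {f y}) = conn Y `` {f x}"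
    using equiv_class_self[OF equiv_conn assms(4)] by blast
  moreover have "conn Y `` (f ` (conn X `` {x})) = (\<Union>y\<in>conn X `` {x}. conn Y `` {f y})"
    by blast
  ultimately show ?thesis
    using assms(4) by (simp add: components_map_def components_def quotientI)
qed

lemma classE:
  assumes "c \<in> components X"
  obtains x where "x \<in> rcarrier X" "c = conn X `` {x}"
  using assms by (auto simp: components_def elim: quotientE)

lemma class_in_components: "x \<in> rcarrier X \<Longrightarrow> conn X `` {x} \<in> components X"
  by (simp add: components_def quotientI)

lemma components_map_in:
  assumes "right_mset X" "right_mset Y" "f \<in> rhom X Y"
  shows "components_map X Y f \<in> components X \<rightarrow>\<^sub>E components Y"
proof (rule PiE_I)
  fix c assume "c \<in> components X"
  then obtain x where "x \<in> rcarrier X" "c = conn X `` {x}"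
    by (rule classE)
  then show "components_map X Y f c \<in> components Y"
    using assms by (simp add: components_map_class class_in_components rhomD)
qed (simp add: components_map_def)

lemma small_components: "small \<kappa> (rcarrier X) \<Longrightarrow> small \<kappa> (components X)"
  unfolding components_def quotient_def by (simp add: small_image UNION_singleton_eq_range)

lemma components_map_id:
  assumes "right_mset X"
  shows "components_map X X (\<lambda>x\<in>rcarrier X. x) = (\<lambda>c\<in>components X. c)"
proof (rule extensionalityI[of _ "components X"])
  fix c assume "c \<in> components X"
  then obtain x where "x \<in> rcarrier X" "c = conn X `` {x}"
    by (rule classE)
  then show "components_map X X (\<lambda>x\<in>rcarrier X. x) c = (\<lambda>c\<in>components X. c) c"
    using assms by (simp add: components_map_class restrict_rhomI class_in_components right_msetD)
qed (simp_all add: components_map_def)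

lemma components_map_compose:
  assumes "right_mset X" "right_mset Y" "right_mset Z" "f \<in> rhom X Y" "g \<in> rhom Y Z"
  shows "components_map X Z (compose (rcarrier X) g f) =
    compose (components X) (components_map Y Z g) (components_map X Y f)"
proof (rule extensionalityI[of _ "components X"])
  fix c assume "c \<in> components X"
  then obtain x where "x \<in> rcarrier X" "c = conn X `` {x}"
    by (rule classE)
  then show "components_map X Z (compose (rcarrier X) g f) c =
    compose (components X) (components_map Y Z g) (components_map X Y f) c"
    using assms by (simp add: components_map_class compose_rhom rhomD class_in_components compose_eq)
qed (simp_all add: components_map_def compose_def)

lemma is_ftor_components:
  "is_ftor (PSh TYPE('m::monoid_mult) (\<kappa> :: 'u rel)) (set_cat \<kappa>) (components_ftor TYPE('m) TYPE('u))"
  unfolding is_ftor_def components_ftor_def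
  by (intro conjI ballI)
    (simp_all add: small_components components_map_id components_map_compose components_map_in)

text \<open>The form |C(X)| = 1 of indecomposability.\<close>

definition connected_mset :: "('m::monoid_mult, 'x) right_act \<Rightarrow> bool" where
  "connected_mset X \<longleftrightarrow> rcarrier X \<noteq> {} \<and> (\<forall>x\<in>rcarrier X. \<forall>y\<in>rcarrier X. (x, y) \<in> conn X)"

lemma right_mset_restrict: "right_mset X \<Longrightarrow> sub_mset X Y \<Longrightarrow> right_mset (restrict_mset X Y)"
  by (auto simp: right_mset_def sub_mset_def restrict_mset_def)

lemma rcarrier_restrict [simp]: "rcarrier (restrict_mset X Y) = Y"
  and ract_restrict [simp]: "ract (restrict_mset X Y) = ract X"
  by (simp_all add: restrict_mset_def)

lemma sub_mset_component:
  assumes "right_mset X" "x \<in> rcarrier X"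
  shows "sub_mset X (conn X `` {x})"
  unfolding sub_mset_def
proof (intro conjI ballI allI)
  show "conn X `` {x} \<subseteq> rcarrier X"
    by (auto simp: conn_def)
  fix y m assume "y \<in> conn X `` {x}"
  then show "ract X y m \<in> conn X `` {x}"
    using assms conn_step[of X y m] equiv_conn[of X] by (auto simp: conn_def dest: equivclp_trans)
qed

text \<open>A component and its complement are both closed under the action, so a proper component
  would split X. Conversely, the summand in which a point lands is constant along the action and
  hence on a connected X.\<close>

lemma indecomposable_iff_connected:
  assumes X: "right_mset X"
  shows "indecomposable X \<longleftrightarrow> connected_mset X"
proof
  assume ind: "indecomposable X"
  show "connected_mset X"
    unfolding connected_mset_def
  proof (intro conjI ballI)
    show "rcarrier X \<noteq> {}"
      using ind by (simp add: indecomposable_def)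
    fix x y assume x: "x \<in> rcarrier X" and y: "y \<in> rcarrier X"
    let ?K = "conn X `` {x}"
    let ?K' = "rcarrier X - ?K"
    have K: "sub_mset X ?K"
      using X x by (rule sub_mset_component)
    have K': "sub_mset X ?K'"
      unfolding sub_mset_def
    proof (intro conjI ballI allI)
      fix z m assume z: "z \<in> ?K'"
      then have "(z, ract X z m) \<in> conn X"
        using X by (auto intro: conn_step)
      then have "ract X z m \<notin> ?K"
        using z x equiv_conn[of X] by (metis DiffE Image_singleton_iff equivE symE transE)
      then show "ract X z m \<in> ?K'"
        using X z by (auto simp: right_msetD)
    qed auto
    let ?f = "\<lambda>z\<in>rcarrier X. if z \<in> ?K then Inl z else Inr z"
    let ?C = "coproduct_mset (restrict_mset X ?K) (restrict_mset X ?K')"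
    have "?f \<in> rhom X ?C"
    proof (rule restrict_rhomI[OF X])
      fix z m assume z: "z \<in> rcarrier X"
      show "(if ract X z m \<in> ?K then Inl (ract X z m) else Inr (ract X z m)) =
        ract ?C (if z \<in> ?K then Inl z else Inr z) m"
        using K K' z by (cases "z \<in> ?K") (auto simp: sub_mset_def coproduct_mset_def)
    qed (auto simp: coproduct_mset_def)
    moreover have "bij_betw ?f (rcarrier X) (rcarrier ?C)"
      by (rule bij_betw_byWitness[where f' = "case_sum id id"])
        (use K in \<open>auto simp: coproduct_mset_def sub_mset_def split: if_splits\<close>)
    ultimately have "riso X ?C"
      unfolding riso_def by blast
    then have "?K = {} \<or> ?K' = {}"
      using ind right_mset_restrict[OF X K] right_mset_restrict[OF X K'] unfolding indecomposable_def
      by (metis rcarrier_restrict)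
    moreover have "x \<in> ?K"
      using x by (rule equiv_class_self[OF equiv_conn])
    ultimately show "(x, y) \<in> conn X"
      using y by auto
  qed
next
  assume con: "connected_mset X"
  show "indecomposable X"
    unfolding indecomposable_def
  proof (intro conjI allI impI)
    show "rcarrier X \<noteq> {}"
      using con by (simp add: connected_mset_def)
    fix X1 X2 :: "('a, 'b) right_act"
    assume "right_mset X1 \<and> right_mset X2 \<and> riso X (coproduct_mset X1 X2)"
    then obtain f where f: "f \<in> rhom X (coproduct_mset X1 X2)"
      and surj: "f ` rcarrier X = rcarrier X1 <+> rcarrier X2"
      by (auto simp: riso_def bij_betw_def coproduct_mset_def)
    have inv: "isl (f (ract X x m)) = isl (f x)" if "x \<in> rcarrier X" for x m
      using that f by (cases "f x") (auto simp: rhomD coproduct_mset_def)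
    have const: "isl (f x) = isl (f y)" if "x \<in> rcarrier X" "y \<in> rcarrier X" for x y
      using con that conn_invariant[OF X, of "\<lambda>x. isl (f x)"] inv by (auto simp: connected_mset_def)
    show "rcarrier X1 = {} \<or> rcarrier X2 = {}"
    proof (rule ccontr)
      assume "\<not> (rcarrier X1 = {} \<or> rcarrier X2 = {})"
      then obtain x1 x2 where "x1 \<in> rcarrier X1" "x2 \<in> rcarrier X2"
        by blast
      then have "Inl x1 \<in> f ` rcarrier X" "Inr x2 \<in> f ` rcarrier X"
        using surj by auto
      then show False
        using const by (metis imageE sum.disc(1) sum.disc(2))
    qed
  qed
qed

section \<open>Transport of M-sets to the element type of the universe\<close>

section \<open>Copies of M-sets in the universe\<close>

definition decode :: "'a set \<Rightarrow> 'u \<Rightarrow> 'a" where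
  "decode A = inv_into A (code A)"

text \<open>Transport of structure along \<open>code\<close>: a small M-set on any element type
  acquires an isomorphic copy among the objects of \<open>PSh\<close>.\<close>

definition copy_mset :: "('m::monoid_mult, 'x) right_act \<Rightarrow> ('m, 'u) right_act" where
  "copy_mset X = \<lparr>rcarrier = code (rcarrier X) ` rcarrier X,
     ract = \<lambda>z m. code (rcarrier X) (ract X (decode (rcarrier X) z) m)\<rparr>"

context universe
begin

abbreviation "PSets \<equiv> PSh TYPE('m) \<kappa>"
abbreviation "Sets \<equiv> set_cat \<kappa> :: ('u set set, 'u set \<Rightarrow> 'u set) cat"

lemma decode_code [simp]: "small \<kappa> A \<Longrightarrow> x \<in> A \<Longrightarrow> decode A (code A x :: 'u) = x"
  by (simp add: decode_def inj_on_code)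

context
  fixes X :: "('m, 'x) right_act"
  assumes X: "right_mset X" and small: "small \<kappa> (rcarrier X)"
begin

private abbreviation "K \<equiv> copy_mset X :: ('m, 'u) right_act"

lemma code_in_copy [simp]: "x \<in> rcarrier X \<Longrightarrow> code (rcarrier X) x \<in> rcarrier K"
  by (simp add: copy_mset_def)

lemma decode_in [simp]: "z \<in> rcarrier K \<Longrightarrow> decode (rcarrier X) z \<in> rcarrier X"
  using small by (auto simp: copy_mset_def)

lemma code_decode [simp]: "z \<in> rcarrier K \<Longrightarrow> code (rcarrier X) (decode (rcarrier X) z) = z"
  using small by (auto simp: copy_mset_def)

lemma ract_copy: "z \<in> rcarrier K \<Longrightarrow>
  ract K z m = code (rcarrier X) (ract X (decode (rcarrier X) z) m)"
  by (simp add: copy_mset_def)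

lemma decode_ract [simp]: "z \<in> rcarrier K \<Longrightarrow>
  decode (rcarrier X) (ract K z m) = ract X (decode (rcarrier X) z) m"
  using small X by (simp add: ract_copy right_msetD)

lemma ract_code [simp]: "x \<in> rcarrier X \<Longrightarrow>
  ract K (code (rcarrier X) x) m = code (rcarrier X) (ract X x m)"
  using small by (simp add: ract_copy)

lemma right_mset_copy [simp]: "right_mset K"
  using X small unfolding right_mset_def
  by (auto simp: ract_copy)

lemma small_copy [simp]: "small \<kappa> (rcarrier K)"
  using small by (simp add: copy_mset_def small_image)

lemma code_rhom: "(\<lambda>x\<in>rcarrier X. code (rcarrier X) x) \<in> rhom X K"
  using X by (intro restrict_rhomI) simp_all

lemma conn_code:
  assumes "(x, y) \<in> conn X"
  shows "(code (rcarrier X) x, code (rcarrier X) y) \<in> conn K"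
proof -
  have "x \<in> rcarrier X" "y \<in> rcarrier X"
    using assms by (auto simp: conn_def)
  then show ?thesis
    using conn_map[OF X right_mset_copy code_rhom assms] by simp
qed

lemma connected_copy:
  assumes "connected_mset X"
  shows "connected_mset K"
  using assms conn_code unfolding connected_mset_def
  by (metis code_decode code_in_copy decode_in empty_iff equals0I)

end

end

section \<open>Copowers, and left adjoints of representable functors\<close>

section \<open>Functors represented by M-sets\<close>

text \<open>The coproduct of S copies of Q, or equivalently the product of Q with the constant M-set
  on S.\<close>

definition copower_mset :: "'s set \<Rightarrow> ('m::monoid_mult, 'q) right_act \<Rightarrow> ('m, 's \<times> 'q) right_act" where
  "copower_mset S Q = \<lparr>rcarrier = S \<times> rcarrier Q, ract = \<lambda>(s, q) m. (s, ract Q q m)\<rparr>"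

lemma copower_mset_simps [simp]:
  "rcarrier (copower_mset S Q) = S \<times> rcarrier Q"
  "ract (copower_mset S Q) (s, q) m = (s, ract Q q m)"
  by (simp_all add: copower_mset_def)

lemma ract_copower: "ract (copower_mset S Q) p m = (fst p, ract Q (snd p) m)"
  by (simp add: copower_mset_def case_prod_unfold)

lemma right_mset_copower: "right_mset Q \<Longrightarrow> right_mset (copower_mset S Q)"
  by (auto simp: right_mset_def)

definition copower_ftor ::
  "('m::monoid_mult, 'q) right_act \<Rightarrow> ('s set, 's \<Rightarrow> 's, ('m, 'u) right_act, 'u \<Rightarrow> 'u) ftor" where
  "copower_ftor Q = \<lparr>omap = \<lambda>S. copy_mset (copower_mset S Q),
     amap = \<lambda>S T f. \<lambda>z\<in>code (S \<times> rcarrier Q) ` (S \<times> rcarrier Q).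
       code (T \<times> rcarrier Q) (apfst f (decode (S \<times> rcarrier Q) z))\<rparr>"

lemma compose_eq_iff:
  "g \<in> extensional A \<Longrightarrow> compose A f h = g \<longleftrightarrow> (\<forall>x\<in>A. f (h x) = g x)"
  by (auto simp: compose_def extensional_def fun_eq_iff)

context universe
begin

context
  fixes Q :: "('m, 'q) right_act"
  assumes Q: "right_mset Q" and small_Q: "small \<kappa> (rcarrier Q)"
begin

private abbreviation "L \<equiv> copower_ftor Q :: ('s set, 's \<Rightarrow> 's, ('m, 'u) right_act, 'u \<Rightarrow> 'u) ftor"

private lemma omap_L: "omap L S = copy_mset (copower_mset S Q)"
  by (simp add: copower_ftor_def)

private lemma copy_copower:
  assumes "small \<kappa> S"
  shows "right_mset (omap L S)" "small \<kappa> (rcarrier (omap L S))"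
    "s \<in> S \<Longrightarrow> q \<in> rcarrier Q \<Longrightarrow> code (S \<times> rcarrier Q) (s, q) \<in> rcarrier (omap L S)"
    "s \<in> S \<Longrightarrow> q \<in> rcarrier Q \<Longrightarrow> decode (S \<times> rcarrier Q) (code (S \<times> rcarrier Q) (s, q) :: 'u) = (s, q)"
    "s \<in> S \<Longrightarrow> q \<in> rcarrier Q \<Longrightarrow> ract (omap L S) (code (S \<times> rcarrier Q) (s, q)) m =
       code (S \<times> rcarrier Q) (s, ract Q q m)"
    "z \<in> rcarrier (omap L S) \<Longrightarrow> decode (S \<times> rcarrier Q) z \<in> S \<times> rcarrier Q"
    "z \<in> rcarrier (omap L S) \<Longrightarrow> code (S \<times> rcarrier Q) (decode (S \<times> rcarrier Q) z) = z"
    "z \<in> rcarrier (omap L S) \<Longrightarrow> decode (S \<times> rcarrier Q) (ract (omap L S) z m) =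
       (fst (decode (S \<times> rcarrier Q) z), ract Q (snd (decode (S \<times> rcarrier Q) z)) m)"
proof -
  let ?X = "copower_mset S Q"
  have X: "right_mset ?X" "small \<kappa> (rcarrier ?X)"
    using assms Q small_Q by (simp_all add: right_mset_copower small_Times)
  show "right_mset (omap L S)" "small \<kappa> (rcarrier (omap L S))"
    "s \<in> S \<Longrightarrow> q \<in> rcarrier Q \<Longrightarrow> code (S \<times> rcarrier Q) (s, q) \<in> rcarrier (omap L S)"
    "s \<in> S \<Longrightarrow> q \<in> rcarrier Q \<Longrightarrow> decode (S \<times> rcarrier Q) (code (S \<times> rcarrier Q) (s, q) :: 'u) = (s, q)"
    "s \<in> S \<Longrightarrow> q \<in> rcarrier Q \<Longrightarrow> ract (omap L S) (code (S \<times> rcarrier Q) (s, q)) m =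
       code (S \<times> rcarrier Q) (s, ract Q q m)"
    "z \<in> rcarrier (omap L S) \<Longrightarrow> decode (S \<times> rcarrier Q) z \<in> S \<times> rcarrier Q"
    "z \<in> rcarrier (omap L S) \<Longrightarrow> code (S \<times> rcarrier Q) (decode (S \<times> rcarrier Q) z) = z"
    "z \<in> rcarrier (omap L S) \<Longrightarrow> decode (S \<times> rcarrier Q) (ract (omap L S) z m) =
       (fst (decode (S \<times> rcarrier Q) z), ract Q (snd (decode (S \<times> rcarrier Q) z)) m)"
    using right_mset_copy[OF X] small_copy[OF X] code_in_copy[OF X, of "(s, q)"]
      decode_code[OF X(2), of "(s, q)"] ract_code[OF X, of "(s, q)"] decode_in[OF X, of z]
      code_decode[OF X, of z] decode_ract[OF X, of z]
    by (simp_all add: omap_L ract_copower)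
qed

private lemma amap_L:
  "z \<in> rcarrier (omap L S) \<Longrightarrow> amap L S T f z = code (T \<times> rcarrier Q) (apfst f (decode (S \<times> rcarrier Q) z))"
  by (simp add: copower_ftor_def copy_mset_def)

private lemma decode_amap_L:
  assumes "small \<kappa> S" "small \<kappa> T" "f \<in> S \<rightarrow>\<^sub>E T" "z \<in> rcarrier (omap L S)"
  shows "decode (T \<times> rcarrier Q) (amap L S T f z) = apfst f (decode (S \<times> rcarrier Q) z)"
proof -
  obtain s q where "decode (S \<times> rcarrier Q) z = (s, q)" "s \<in> S" "q \<in> rcarrier Q"
    using copy_copower(6)[OF assms(1,4)] by blast
  then show ?thesis
    using assms PiE_mem[OF assms(3)] by (simp add: amap_L copy_copower)
qed

private lemma amap_L_rhom:
  assumes "small \<kappa> S" "small \<kappa> T" "f \<in> S \<rightarrow>\<^sub>E T"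
  shows "amap L S T f \<in> rhom (omap L S) (omap L T)"
proof (rule rhomI)
  fix z assume z: "z \<in> rcarrier (omap L S)"
  then obtain s q where d: "decode (S \<times> rcarrier Q) z = (s, q)" "s \<in> S" "q \<in> rcarrier Q"
    using copy_copower(6)[OF assms(1)] by blast
  then have f: "f s \<in> T" using assms(3) by auto
  then show "amap L S T f z \<in> rcarrier (omap L T)"
    using assms d z by (simp add: amap_L copy_copower)
  show "amap L S T f (ract (omap L S) z m) = ract (omap L T) (amap L S T f z) m" for m
    using assms d z f copy_copower(1)[OF assms(1)]
    by (simp add: amap_L copy_copower right_msetD)
qed (simp add: copower_ftor_def copy_mset_def)

lemma is_ftor_copower: "is_ftor (set_cat \<kappa>) PSets L"
  unfolding is_ftor_def
proof (intro conjI ballI)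
  fix S :: "'s set" assume "S \<in> Obj (set_cat \<kappa>)"
  then have S: "small \<kappa> S" by simp
  show "omap L S \<in> Obj PSets"
    using copy_copower[OF S] by simp
  have "amap L S S (\<lambda>x\<in>S. x) = (\<lambda>z\<in>rcarrier (omap L S). z)"
  proof (rule extensionalityI[of _ "rcarrier (omap L S)"])
    fix z assume z: "z \<in> rcarrier (omap L S)"
    then obtain s q where "decode (S \<times> rcarrier Q) z = (s, q)" "s \<in> S"
      using copy_copower(6)[OF S] by blast
    then show "amap L S S (\<lambda>x\<in>S. x) z = (\<lambda>z\<in>rcarrier (omap L S). z) z"
      using z copy_copower(7)[OF S z] by (simp add: amap_L)
  qed (simp_all add: copower_ftor_def copy_mset_def)
  then show "amap L S S (Id (set_cat \<kappa>) S) = Id PSets (omap L S)"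
    by simp
next
  fix S T V :: "'s set" and f g
  assume "S \<in> Obj (set_cat \<kappa>)" "T \<in> Obj (set_cat \<kappa>)" "V \<in> Obj (set_cat \<kappa>)"
    and "f \<in> Hom (set_cat \<kappa>) S T" "g \<in> Hom (set_cat \<kappa>) T V"
  then have *: "small \<kappa> S" "small \<kappa> T" "small \<kappa> V" "f \<in> S \<rightarrow>\<^sub>E T" "g \<in> T \<rightarrow>\<^sub>E V"
    by simp_all
  have "amap L S V (compose S g f) = compose (rcarrier (omap L S)) (amap L T V g) (amap L S T f)"
  proof (rule extensionalityI[of _ "rcarrier (omap L S)"])
    fix z assume z: "z \<in> rcarrier (omap L S)"
    then obtain s q where "decode (S \<times> rcarrier Q) z = (s, q)" "s \<in> S"
      using copy_copower(6)[OF *(1)] by blast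
    then show "amap L S V (compose S g f) z = compose (rcarrier (omap L S)) (amap L T V g) (amap L S T f) z"
      using z rhomD(3)[OF amap_L_rhom[OF *(1,2,4)] z] decode_amap_L[OF *(1,2,4) z]
      by (simp add: compose_eq amap_L[of "amap L S T f z"]) (simp add: amap_L compose_eq)
  qed (simp_all add: copower_ftor_def copy_mset_def compose_def)
  then show "amap L S V (Comp (set_cat \<kappa>) S T V g f) =
      Comp PSets (omap L S) (omap L T) (omap L V) (amap L T V g) (amap L S T f)"
    by simp
qed (simp add: amap_L_rhom)

text \<open>If Q represents H, a function from S to H X is a family of homomorphisms from Q to X
  indexed by S, and such a family is one homomorphism out of the copower. This provides the left
  adjoints of both the components functor and the fixed point functors.\<close>

lemma copower_adjoint:
  fixes H :: "(('m, 'u) right_act, 'u \<Rightarrow> 'u, 's set, 's \<Rightarrow> 's) ftor"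
  assumes H: "is_ftor PSets (set_cat \<kappa>) H"
    and bij: "\<And>X. X \<in> Obj PSets \<Longrightarrow> bij_betw (\<psi> X) (rhom Q X) (omap H X)"
    and nat: "\<And>X Y f k. X \<in> Obj PSets \<Longrightarrow> Y \<in> Obj PSets \<Longrightarrow> f \<in> rhom Q X \<Longrightarrow> k \<in> rhom X Y \<Longrightarrow>
      \<psi> Y (compose (rcarrier Q) k f) = amap H X Y k (\<psi> X f)"
  shows "adjoint (set_cat \<kappa>) PSets L H"
proof -
  \<comment> \<open>\<open>inc S s\<close> is the inclusion of the copy of Q with index s; the unit
    sends s to the element of H that this inclusion represents.\<close>
  define inc where "inc S s = (\<lambda>q\<in>rcarrier Q. code (S \<times> rcarrier Q) (s, q) :: 'u)" for S and s :: 's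
  define \<eta> where "\<eta> S = (\<lambda>s\<in>S. \<psi> (omap L S) (inc S s))" for S
  have inc: "inc S s \<in> rhom Q (omap L S)" if "small \<kappa> S" "s \<in> S" for S s
    unfolding inc_def using that Q by (intro restrict_rhomI) (simp_all add: copy_copower)
  have H_fun: "amap H X Y f \<in> omap H X \<rightarrow>\<^sub>E omap H Y"
    if "X \<in> Obj PSets" "Y \<in> Obj PSets" "f \<in> rhom X Y" for X Y f
    using is_ftorD(2)[OF H, of X Y f] that by simp
  have \<psi>: "\<psi> X f \<in> omap H X" if "X \<in> Obj PSets" "f \<in> rhom Q X" for X f
    using bij_betwE[OF bij[OF that(1)]] that(2) by blast
  show ?thesis
  proof (rule left_adjoint_from_unit[where \<eta> = \<eta>, OF category_set_cat category_PSh H])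
    fix S assume "S \<in> Obj (set_cat \<kappa> :: ('s set, _) cat)"
    then have S: "small \<kappa> S" by simp
    show LS: "omap L S \<in> Obj PSets"
      using copy_copower[OF S] by simp
    show "\<eta> S \<in> Hom (set_cat \<kappa>) S (omap H (omap L S))"
      using \<psi>[OF LS] inc[OF S] by (auto simp: \<eta>_def)
    {
      fix T h assume "T \<in> Obj (set_cat \<kappa> :: ('s set, _) cat)" and "h \<in> Hom (set_cat \<kappa>) S T"
      then have T: "small \<kappa> T" and h: "h \<in> S \<rightarrow>\<^sub>E T" by simp_all
      have LT: "omap L T \<in> Obj PSets"
        using copy_copower[OF T] by simp
      note Lh = amap_L_rhom[OF S T h]
      then show "amap L S T h \<in> Hom PSets (omap L S) (omap L T)"
        by simp
      have "compose S (amap H (omap L S) (omap L T) (amap L S T h)) (\<eta> S) = compose S (\<eta> T) h"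
      proof (rule extensionalityI[of _ S])
        fix s assume s: "s \<in> S"
        have "compose (rcarrier Q) (amap L S T h) (inc S s) = inc T (h s)"
        proof (rule extensionalityI[of _ "rcarrier Q"])
          fix q assume "q \<in> rcarrier Q"
          then show "compose (rcarrier Q) (amap L S T h) (inc S s) q = inc T (h s) q"
            using s S by (simp add: compose_eq inc_def amap_L copy_copower)
        qed (simp_all add: compose_def inc_def)
        then show "compose S (amap H (omap L S) (omap L T) (amap L S T h)) (\<eta> S) s = compose S (\<eta> T) h s"
          using s h nat[OF LS LT inc[OF S s] Lh] by (auto simp: compose_eq \<eta>_def)
      qed (simp_all add: compose_def)
      then show "Comp (set_cat \<kappa>) S (omap H (omap L S)) (omap H (omap L T))
          (amap H (omap L S) (omap L T) (amap L S T h)) (\<eta> S) =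
        Comp (set_cat \<kappa>) S T (omap H (omap L T)) (\<eta> T) h"
        by simp
    }
    fix X g assume X: "X \<in> Obj PSets" and "g \<in> Hom (set_cat \<kappa>) S (omap H X)"
    then have g: "g \<in> S \<rightarrow>\<^sub>E omap H X" by simp
    define \<gamma> where "\<gamma> s = inv_into (rhom Q X) (\<psi> X) (g s)" for s
    have \<gamma>: "\<gamma> s \<in> rhom Q X" "\<psi> X (\<gamma> s) = g s" if "s \<in> S" for s
    proof -
      have "g s \<in> \<psi> X ` rhom Q X"
        using g that bij_betw_imp_surj_on[OF bij[OF X]] by auto
      then show "\<gamma> s \<in> rhom Q X" "\<psi> X (\<gamma> s) = g s"
        unfolding \<gamma>_def by (rule inv_into_into, rule f_inv_into_f)
    qed
    \<comment> \<open>Read through \<psi>, the triangle says that \<open>f\<close> restricts to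
      \<open>\<gamma> s\<close> on the copy with index s. This determines \<open>f\<close> and also
      tells how to define it.\<close>
    have comp_iff: "compose S (amap H (omap L S) X f) (\<eta> S) = g \<longleftrightarrow>
        (\<forall>s\<in>S. compose (rcarrier Q) f (inc S s) = \<gamma> s)" if f: "f \<in> rhom (omap L S) X" for f
    proof -
      have "amap H (omap L S) X f (\<eta> S s) = g s \<longleftrightarrow> compose (rcarrier Q) f (inc S s) = \<gamma> s" if s: "s \<in> S" for s
      proof -
        have "compose (rcarrier Q) f (inc S s) \<in> rhom Q X"
          using Q inc[OF S s] f by (rule compose_rhom)
        then show ?thesis
          using s \<gamma>[OF s] nat[OF LS X inc[OF S s] f] inj_onD[OF bij_betw_imp_inj_on[OF bij[OF X]]]
          by (metis \<eta>_def restrict_apply')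
      qed
      moreover have "compose S (amap H (omap L S) X f) (\<eta> S) = g \<longleftrightarrow>
        (\<forall>s\<in>S. amap H (omap L S) X f (\<eta> S s) = g s)"
        using g by (intro compose_eq_iff) (simp add: PiE_def)
      ultimately show ?thesis by simp
    qed
    define f where "f = (\<lambda>z\<in>rcarrier (omap L S).
      \<gamma> (fst (decode (S \<times> rcarrier Q) z)) (snd (decode (S \<times> rcarrier Q) z)))"
    have f: "f \<in> rhom (omap L S) X"
      unfolding f_def
    proof (rule restrict_rhomI[OF copy_copower(1)[OF S]])
      fix z assume z: "z \<in> rcarrier (omap L S)"
      let ?d = "decode (S \<times> rcarrier Q)"
      have d: "fst (?d z) \<in> S" "snd (?d z) \<in> rcarrier Q"
        using copy_copower(6)[OF S z] by (simp_all add: mem_Times_iff)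
      show "\<gamma> (fst (?d z)) (snd (?d z)) \<in> rcarrier X"
        using \<gamma>(1)[OF d(1)] d(2) by (rule rhomD(3))
      show "\<gamma> (fst (?d (ract (omap L S) z m))) (snd (?d (ract (omap L S) z m))) =
        ract X (\<gamma> (fst (?d z)) (snd (?d z))) m" for m
        using rhomD(4)[OF \<gamma>(1)[OF d(1)] d(2)] copy_copower(8)[OF S z] by simp
    qed
    have comp_f: "compose (rcarrier Q) f (inc S s) = \<gamma> s" if s: "s \<in> S" for s
    proof (rule extensionalityI[of _ "rcarrier Q"])
      fix q assume "q \<in> rcarrier Q"
      then show "compose (rcarrier Q) f (inc S s) q = \<gamma> s q"
        using s S by (simp add: compose_eq f_def inc_def copy_copower)
    qed (use rhomD(2)[OF \<gamma>(1)[OF s]] in \<open>simp_all add: compose_def\<close>)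
    have uniq: "f' = f"
      if f': "f' \<in> rhom (omap L S) X" and eq: "\<forall>s\<in>S. compose (rcarrier Q) f' (inc S s) = \<gamma> s" for f'
    proof (rule extensionalityI[of _ "rcarrier (omap L S)"])
      fix z assume z: "z \<in> rcarrier (omap L S)"
      then obtain s q where d: "decode (S \<times> rcarrier Q) z = (s, q)" "s \<in> S" "q \<in> rcarrier Q"
        using copy_copower(6)[OF S] by blast
      have "f' z = compose (rcarrier Q) f' (inc S s) q"
        using copy_copower(7)[OF S z] d by (simp add: compose_eq inc_def)
      then show "f' z = f z"
        using eq d z by (simp add: f_def)
    qed (use rhomD(2)[OF f'] rhomD(2)[OF f] in simp_all)
    have "\<exists>!f. f \<in> rhom (omap L S) X \<and> compose S (amap H (omap L S) X f) (\<eta> S) = g"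
    proof (rule ex1I[of _ f], rule conjI)
      show "compose S (amap H (omap L S) X f) (\<eta> S) = g"
        using comp_iff[OF f] comp_f by simp
      fix f' assume "f' \<in> rhom (omap L S) X \<and> compose S (amap H (omap L S) X f') (\<eta> S) = g"
      then show "f' = f"
        using comp_iff[of f'] by (intro uniq) simp_all
    qed (rule f)
    then show "\<exists>!f. f \<in> Hom PSets (omap L S) X \<and>
        Comp (set_cat \<kappa>) S (omap H (omap L S)) (omap H X) (amap H (omap L S) X f) (\<eta> S) = g"
      by simp
  qed
qed

text \<open>The transition maps of the image diagram change the index and keep the element of Q.
  Over a connected shape a point of a cone therefore has the same element of Q at every vertex, and
  its indices form a matching family, which comes from a unique element of the limit of the
  sets.\<close>

lemma copower_preserves_connected_limits:
  "preserves_connected_limits \<kappa> (set_cat \<kappa>) PSets L"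
  unfolding preserves_connected_limits_def preserves_limits_def
proof (intro allI impI, elim conjE)
  fix J :: "('u, 'u) cat" and D :: "('u, 'u, 's set, 's \<Rightarrow> 's) ftor" and x \<pi>
  assume conJ: "connected_category J" and D: "is_ftor J (set_cat \<kappa>) D"
    and lim: "limit_cone J (set_cat \<kappa>) D x \<pi>"
  have x: "small \<kappa> x" and \<pi>: "\<And>j. j \<in> Obj J \<Longrightarrow> \<pi> j \<in> x \<rightarrow>\<^sub>E omap D j"
    and \<pi>_comp: "\<And>j k u. j \<in> Obj J \<Longrightarrow> k \<in> Obj J \<Longrightarrow> u \<in> Hom J j k \<Longrightarrow>
      compose x (amap D j k u) (\<pi> j) = \<pi> k"
    using lim by (simp_all add: limit_cone_def cone_def)
  have smallD: "small \<kappa> (omap D j)" if "j \<in> Obj J" for j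
    using is_ftorD(1)[OF D that] by simp
  have Du: "amap D j k u \<in> omap D j \<rightarrow>\<^sub>E omap D k" if "j \<in> Obj J" "k \<in> Obj J" "u \<in> Hom J j k" for j k u
    using is_ftorD(2)[OF D that] by simp
  have matching: "\<exists>!t. t \<in> x \<and> (\<forall>j\<in>Obj J. \<pi> j t = s j)"
    if s: "\<And>j. j \<in> Obj J \<Longrightarrow> s j \<in> omap D j"
      and comp: "\<And>j k u. j \<in> Obj J \<Longrightarrow> k \<in> Obj J \<Longrightarrow> u \<in> Hom J j k \<Longrightarrow> amap D j k u (s j) = s k" for s
  proof -
    \<comment> \<open>Elements of a limit of sets are cones from a one-element set; any value of the
      type can be its element.\<close>
    let ?p = "undefined :: 's"
    have "cone J (set_cat \<kappa>) D {?p} (\<lambda>j. \<lambda>_\<in>{?p}. s j)"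
      using s comp by (auto simp: cone_def small_finite compose_def intro!: ext)
    then have ex1: "\<exists>!h. h \<in> {?p} \<rightarrow>\<^sub>E x \<and> (\<forall>j\<in>Obj J. compose {?p} (\<pi> j) h = (\<lambda>_\<in>{?p}. s j))"
      using lim by (simp add: limit_cone_def)
    have eq: "compose {?p} (\<pi> j) h = (\<lambda>_\<in>{?p}. s j) \<longleftrightarrow> \<pi> j (h ?p) = s j" for j h
      by (auto simp: compose_def fun_eq_iff)
    define cmp where "cmp h \<longleftrightarrow> h \<in> {?p} \<rightarrow>\<^sub>E x \<and> (\<forall>j\<in>Obj J. \<pi> j (h ?p) = s j)" for h
    have "\<exists>!h. cmp h"
      using ex1 unfolding eq cmp_def .
    then obtain h where h: "cmp h" and uniq: "\<And>g. cmp g \<Longrightarrow> g = h"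
      by blast
    show ?thesis
    proof (rule ex1I[of _ "h ?p"])
      fix t assume "t \<in> x \<and> (\<forall>j\<in>Obj J. \<pi> j t = s j)"
      then have "(\<lambda>_\<in>{?p}. t) = h"
        by (intro uniq) (simp add: cmp_def)
      then show "t = h ?p"
        by auto
    next
      show "h ?p \<in> x \<and> (\<forall>j\<in>Obj J. \<pi> j (h ?p) = s j)"
        using h PiE_mem[of h "{?p}" "\<lambda>_. x"] by (simp add: cmp_def)
    qed
  qed
  \<comment> \<open>Connected shapes are non-empty. The element of Q is read off at the vertex
    \<open>j0\<close>.\<close>
  obtain j0 where j0: "j0 \<in> Obj J"
    using conJ by (auto simp: connected_category_def)
  let ?dx = "decode (x \<times> rcarrier Q)"
  let ?d = "\<lambda>j. decode (omap D j \<times> rcarrier Q)"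
  let ?\<pi> = "\<lambda>j. amap L x (omap D j) (\<pi> j)"
  note L\<pi> = amap_L_rhom[OF x smallD \<pi>] and dL\<pi> = decode_amap_L[OF x smallD \<pi>]
  have "cone J PSets (comp_ftor L D) (omap L x) ?\<pi>"
    unfolding cone_def
  proof (intro conjI ballI)
    show "omap L x \<in> Obj PSets"
      using copy_copower[OF x] by simp
    fix j assume j: "j \<in> Obj J"
    show "?\<pi> j \<in> Hom PSets (omap L x) (omap (comp_ftor L D) j)"
      using L\<pi>[OF j j] by (simp add: comp_ftor_def)
    fix k u assume k: "k \<in> Obj J" and u: "u \<in> Hom J j k"
    show "Comp PSets (omap L x) (omap (comp_ftor L D) j) (omap (comp_ftor L D) k)
        (amap (comp_ftor L D) j k u) (?\<pi> j) = ?\<pi> k"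
      using is_ftorD(4)[OF is_ftor_copower, of x "omap D j" "omap D k" "\<pi> j" "amap D j k u"]
        x smallD[OF j] smallD[OF k] \<pi>[OF j] Du[OF j k u] \<pi>_comp[OF j k u]
      by (simp add: comp_ftor_def)
  qed
  moreover have "\<exists>!h. h \<in> Hom PSets y (omap L x) \<and>
      (\<forall>j\<in>Obj J. Comp PSets y (omap L x) (omap (comp_ftor L D) j) (?\<pi> j) h = \<mu> j)"
    if c: "cone J PSets (comp_ftor L D) y \<mu>" for y \<mu>
  proof -
    have y: "right_mset y" and \<mu>: "\<And>j. j \<in> Obj J \<Longrightarrow> \<mu> j \<in> rhom y (omap L (omap D j))"
      and \<mu>_comp: "\<And>j k u. j \<in> Obj J \<Longrightarrow> k \<in> Obj J \<Longrightarrow> u \<in> Hom J j k \<Longrightarrow>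
        compose (rcarrier y) (amap L (omap D j) (omap D k) (amap D j k u)) (\<mu> j) = \<mu> k"
      using c by (simp_all add: cone_def comp_ftor_def)
    define s where "s t j = fst (?d j (\<mu> j t))" for t j
    define r where "r t j = snd (?d j (\<mu> j t))" for t j
    have sr: "s t j \<in> omap D j" "r t j \<in> rcarrier Q" "?d j (\<mu> j t) = (s t j, r t j)"
      if "t \<in> rcarrier y" "j \<in> Obj J" for t j
      using copy_copower(6)[OF smallD[OF that(2)] rhomD(3)[OF \<mu>[OF that(2)] that(1)]]
      by (auto simp: s_def r_def mem_Times_iff)
    have comp: "amap D j k u (s t j) = s t k \<and> r t j = r t k"
      if "t \<in> rcarrier y" "j \<in> Obj J" "k \<in> Obj J" "u \<in> Hom J j k" for t j k u
    proof -
      have "?d k (\<mu> k t) = apfst (amap D j k u) (?d j (\<mu> j t))"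
        using decode_amap_L[OF smallD[OF that(2)] smallD[OF that(3)] Du[OF that(2-4)]
            rhomD(3)[OF \<mu>[OF that(2)] that(1)]] fun_cong[OF \<mu>_comp[OF that(2-4)], of t] that(1)
        by (simp add: compose_eq)
      then show ?thesis
        using that by (simp add: sr)
    qed
    have r_const: "r t j = r t j0" if t: "t \<in> rcarrier y" and j: "j \<in> Obj J" for t j
    proof -
      have "equivclp (\<lambda>v w. v \<in> Obj J \<and> w \<in> Obj J \<and> Hom J v w \<noteq> {}) j0 j"
        using conJ j j0 by (simp add: connected_category_def)
      then show ?thesis
      proof (induction rule: equivclp_induct)
        case (step v w)
        then obtain u where "v \<in> Obj J" "w \<in> Obj J" "u \<in> Hom J v w \<or> u \<in> Hom J w v"
          by blast
        then show ?case
          using comp[OF t, of v w u] comp[OF t, of w v u] step.IH by auto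
      qed simp
    qed
    define a where "a t = (THE a. a \<in> x \<and> (\<forall>j\<in>Obj J. \<pi> j a = s t j))" for t
    have a_ex1: "\<exists>!a. a \<in> x \<and> (\<forall>j\<in>Obj J. \<pi> j a = s t j)" if "t \<in> rcarrier y" for t
      using that sr comp by (intro matching) auto
    have a: "a t \<in> x \<and> (\<forall>j\<in>Obj J. \<pi> j (a t) = s t j)" if "t \<in> rcarrier y" for t
      unfolding a_def by (rule theI'[OF a_ex1[OF that]])
    have a_eq: "b = a t" if "t \<in> rcarrier y" "b \<in> x" "\<And>j. j \<in> Obj J \<Longrightarrow> \<pi> j b = s t j" for b t
      unfolding a_def using a_ex1[OF that(1)] that(2,3) by (intro the1_equality[symmetric]) simp_all
    have sr_act: "s (ract y t m) j = s t j \<and> r (ract y t m) j = ract Q (r t j) m"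
      if "t \<in> rcarrier y" "j \<in> Obj J" for t j m
      unfolding s_def r_def
      using rhomD(4)[OF \<mu>[OF that(2)] that(1)]
        copy_copower(8)[OF smallD[OF that(2)] rhomD(3)[OF \<mu>[OF that(2)] that(1)]]
      by simp
    have a_act: "a (ract y t m) = a t" if "t \<in> rcarrier y" for t m
      using that a[OF that] y by (intro a_eq[symmetric]) (simp_all add: right_msetD sr_act)
    define h where "h = (\<lambda>t\<in>rcarrier y. code (x \<times> rcarrier Q) (a t, r t j0) :: 'u)"
    have h: "h \<in> rhom y (omap L x)"
      unfolding h_def using y x a sr j0
      by (intro restrict_rhomI) (simp_all add: copy_copower a_act sr_act)
    have key: "compose (rcarrier y) (?\<pi> j) g = \<mu> j \<longleftrightarrow> (\<forall>t\<in>rcarrier y. apfst (\<pi> j) (?dx (g t)) = (s t j, r t j))"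
      if g: "g \<in> rhom y (omap L x)" and j: "j \<in> Obj J" for g j
    proof -
      have "compose (rcarrier y) (?\<pi> j) g = \<mu> j \<longleftrightarrow> (\<forall>t\<in>rcarrier y. ?\<pi> j (g t) = \<mu> j t)"
        using rhomD(2)[OF \<mu>[OF j]] by (rule compose_eq_iff)
      also have "\<dots> \<longleftrightarrow> (\<forall>t\<in>rcarrier y. ?d j (?\<pi> j (g t)) = ?d j (\<mu> j t))"
        using copy_copower(7)[OF smallD[OF j]] rhomD(3)[OF L\<pi>[OF j j]] rhomD(3)[OF g] rhomD(3)[OF \<mu>[OF j]]
        by metis
      also have "\<dots> \<longleftrightarrow> (\<forall>t\<in>rcarrier y. apfst (\<pi> j) (?dx (g t)) = (s t j, r t j))"
        using dL\<pi>[OF j j] rhomD(3)[OF g] sr j by (intro ball_cong) simp_all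
      finally show ?thesis .
    qed
    have dh: "?dx (h t) = (a t, r t j0)" if "t \<in> rcarrier y" for t
      using that a sr(2)[OF that j0] x by (simp add: h_def copy_copower)
    have cone_h: "compose (rcarrier y) (?\<pi> j) h = \<mu> j" if "j \<in> Obj J" for j
      unfolding key[OF h that] using that a r_const by (simp add: dh)
    have uniq: "g = h"
      if g: "g \<in> rhom y (omap L x)" and eq: "\<forall>j\<in>Obj J. compose (rcarrier y) (?\<pi> j) g = \<mu> j" for g
    proof (rule extensionalityI[of _ "rcarrier y"])
      fix t assume t: "t \<in> rcarrier y"
      obtain b q where d: "?dx (g t) = (b, q)" "b \<in> x" "q \<in> rcarrier Q"
        using copy_copower(6)[OF x rhomD(3)[OF g t]] by blast
      have *: "\<pi> j b = s t j \<and> q = r t j" if "j \<in> Obj J" for j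
        using eq t that key[OF g that] d by fastforce
      then have "?dx (g t) = ?dx (h t)"
        using a_eq[OF t d(2)] j0 by (simp add: d dh[OF t])
      then show "g t = h t"
        using copy_copower(7)[OF x] rhomD(3)[OF g t] rhomD(3)[OF h t] by metis
    qed (use rhomD(2)[OF g] rhomD(2)[OF h] in simp_all)
    have "\<exists>!h. h \<in> rhom y (omap L x) \<and> (\<forall>j\<in>Obj J. compose (rcarrier y) (?\<pi> j) h = \<mu> j)"
    proof (rule ex1I[of _ h], intro conjI ballI)
      fix g assume "g \<in> rhom y (omap L x) \<and> (\<forall>j\<in>Obj J. compose (rcarrier y) (?\<pi> j) g = \<mu> j)"
      then show "g = h"
        by (intro uniq) (erule conjunct1, erule conjunct2)
    qed (use h cone_h in simp_all)
    then show ?thesis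
      by (simp add: comp_ftor_def)
  qed
  ultimately show "limit_cone J PSets (comp_ftor L D) (omap L x) ?\<pi>"
    by (simp add: limit_cone_def)
qed

end

lemma bij_betw_eval_singleton: "bij_betw (\<lambda>g. g p) ({p} \<rightarrow>\<^sub>E A) A"
proof (rule bij_betw_byWitness[where f' = "\<lambda>a. \<lambda>_\<in>{p}. a"])
  show "\<forall>g\<in>{p} \<rightarrow>\<^sub>E A. (\<lambda>_\<in>{p}. g p) = g"
    by (auto simp: PiE_def extensional_def fun_eq_iff)
  show "(\<lambda>a. \<lambda>_\<in>{p}. a) ` A \<subseteq> {p} \<rightarrow>\<^sub>E A"
    unfolding image_subset_iff by simp
qed auto

text \<open>H X is the set of functions from a point to H X, hence by adjunction the set of
  homomorphisms from E(1) to X; so P is E(1).\<close>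

lemma left_adjoint_representation:
  assumes adj: "adjoint Sets PSets E H"
  obtains P \<theta> where "P \<in> Obj PSets"
    "\<And>X. X \<in> Obj PSets \<Longrightarrow> bij_betw (\<theta> X) (rhom P X) (omap H X)"
    "\<And>X Y f k. X \<in> Obj PSets \<Longrightarrow> Y \<in> Obj PSets \<Longrightarrow> f \<in> rhom P X \<Longrightarrow> k \<in> rhom X Y \<Longrightarrow>
      \<theta> Y (compose (rcarrier P) k f) = amap H X Y k (\<theta> X f)"
proof -
  \<comment> \<open>A one-element set of the type \<open>'u set set\<close>.\<close>
  let ?I = "{{}} :: 'u set set"
  have I: "?I \<in> Obj Sets"
    by (simp add: small_finite)
  have E: "is_ftor Sets PSets E" and H: "is_ftor PSets Sets H"
    using adj by (simp_all add: adjoint_def)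
  obtain \<phi> where
    bij: "\<And>a b. a \<in> Obj Sets \<Longrightarrow> b \<in> Obj PSets \<Longrightarrow> bij_betw (\<phi> a b) (Hom PSets (omap E a) b) (Hom Sets a (omap H b))"
    and nat: "\<And>a b b' f k. a \<in> Obj Sets \<Longrightarrow> b \<in> Obj PSets \<Longrightarrow> b' \<in> Obj PSets \<Longrightarrow>
      f \<in> Hom PSets (omap E a) b \<Longrightarrow> k \<in> Hom PSets b b' \<Longrightarrow>
      \<phi> a b' (Comp PSets (omap E a) b b' k f) =
      Comp Sets a (omap H b) (omap H b') (amap H b b' k) (\<phi> a b f)"
    using adjointE[OF adj category_set_cat category_PSh] by metis
  show thesis
  proof
    show "omap E ?I \<in> Obj PSets"
      using is_ftorD(1)[OF E I] .
    show "bij_betw (\<lambda>f. \<phi> ?I X f {}) (rhom (omap E ?I) X) (omap H X)" if "X \<in> Obj PSets" for X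
      using bij_betw_trans[OF bij[OF I that, simplified] bij_betw_eval_singleton] by (simp add: comp_def)
    show "\<phi> ?I Y (compose (rcarrier (omap E ?I)) k f) {} = amap H X Y k (\<phi> ?I X f {})"
      if "X \<in> Obj PSets" "Y \<in> Obj PSets" "f \<in> rhom (omap E ?I) X" "k \<in> rhom X Y" for X Y f k
      using nat[OF I that(1,2), of f k] that(3,4) by (simp add: compose_eq)
  qed
qed

end

section \<open>Least sub-M-sets and initial indecomposables\<close>

section \<open>Absorbing elements\<close>

lemma regular_mset_simps [simp]: "rcarrier regular_mset = UNIV" "ract regular_mset m n = m * n"
  by (simp_all add: regular_mset_def)

lemma right_mset_regular: "right_mset regular_mset"
  by (simp add: right_mset_def mult.assoc)

lemma connected_regular: "connected_mset regular_mset"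
proof -
  have "conn regular_mset `` {m} = conn regular_mset `` {1 :: 'a}" for m
    using class_ract[OF right_mset_regular, of 1 m] by simp
  then have "(x, y) \<in> conn regular_mset" for x y :: 'a
    by (metis UNIV_I class_eq_iff regular_mset_simps(1))
  then show ?thesis
    by (simp add: connected_mset_def)
qed

lemma ract_absorbing:
  assumes "left_absorbing l" "right_mset X" "x \<in> rcarrier X"
  shows "ract X (ract X x m) l = ract X x l"
  using assms by (simp add: left_absorbing_def right_msetD)

lemma conn_iff_absorbing:
  assumes "left_absorbing l" "right_mset X" "x \<in> rcarrier X" "y \<in> rcarrier X"
  shows "(x, y) \<in> conn X \<longleftrightarrow> ract X x l = ract X y l"
proof
  assume xy: "(x, y) \<in> conn X"
  show "ract X x l = ract X y l"
    by (rule conn_invariant[where h = "\<lambda>x. ract X x l", OF assms(2) _ xy])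
      (rule ract_absorbing[OF assms(1,2)])
next
  assume "ract X x l = ract X y l"
  then show "(x, y) \<in> conn X"
    using class_ract[OF assms(2,3), of l] class_ract[OF assms(2,4), of l] class_eq_iff[OF assms(3,4)]
    by simp
qed

text \<open>All points of a connected X have the same product e with l, so e lies in every non-empty
  sub-M-set. An endomorphism f of the sub-M-set generated by e satisfies f e = f (e l) = (f e) l =
  e, and is therefore the identity. The free element type lets this serve for right ideals of M as
  well as for objects of \<open>PSh\<close>.\<close>

lemma absorbing_imp_minimal_sub:
  fixes X :: "('m::monoid_mult, 'x) right_act"
  assumes l: "left_absorbing (l::'m)" and X: "right_mset X" and con: "connected_mset X"
  shows "\<exists>Y. minimal_nonempty_sub X Y \<and> trivial_endomorphisms (restrict_mset X Y)"
proof -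
  obtain x where x: "x \<in> rcarrier X"
    using con by (auto simp: connected_mset_def)
  define e where "e = ract X x l"
  let ?Y = "range (ract X e)"
  have e: "e \<in> rcarrier X"
    using X x by (simp add: e_def right_msetD)
  have yl: "ract X y l = e" if "y \<in> rcarrier X" for y
    using con that x conn_iff_absorbing[OF l X that x] by (simp add: connected_mset_def e_def)
  have Y: "sub_mset X ?Y"
    using X e by (auto simp: sub_mset_def right_msetD)
  have least: "?Y \<subseteq> Z" if Z: "sub_mset X Z" "Z \<noteq> {}" for Z
  proof -
    obtain z where "z \<in> Z" using Z(2) by blast
    then have "e \<in> Z" using Z(1) yl by (metis sub_mset_def subsetD)
    then show ?thesis using Z(1) by (auto simp: sub_mset_def)
  qed
  have min: "minimal_nonempty_sub X ?Y"
    unfolding minimal_nonempty_sub_def using Y least by auto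
  have e_in: "e \<in> ?Y"
    using yl[OF e] by (metis rangeI)
  have "f = (\<lambda>y\<in>?Y. y)" if f: "f \<in> rhom (restrict_mset X ?Y) (restrict_mset X ?Y)" for f
  proof (rule extensionalityI[of _ ?Y])
    have "f e = e"
      using rhomD(4)[OF f, of e l] rhomD(3)[OF f, of e] e_in yl[OF e] yl[of "f e"] Y
      by (auto simp: sub_mset_def)
    fix y assume "y \<in> ?Y"
    then show "f y = (\<lambda>y\<in>?Y. y) y"
      using rhomD(4)[OF f, of e] e_in \<open>f e = e\<close> by auto
  qed (use rhomD(2)[OF f] in simp_all)
  moreover have "(\<lambda>y\<in>?Y. y) \<in> rhom (restrict_mset X ?Y) (restrict_mset X ?Y)"
    using restrict_rhomI[OF right_mset_restrict[OF X Y], of "\<lambda>y. y" "restrict_mset X ?Y"] by simp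
  ultimately show ?thesis
    using min by (auto simp: trivial_endomorphisms_def)
qed

text \<open>Left multiplication by \<open>n\<close> maps the least sub-\<open>M\<close>-set onto a sub-\<open>M\<close>-set that contains it, so the
  part of it that stays inside is again non-empty and hence everything.\<close>

lemma minimal_sub_imp_absorbing:
  fixes e :: "'m::monoid_mult \<Rightarrow> 'x"
  assumes X: "right_mset X" and bij: "bij_betw e UNIV (rcarrier X)"
    and act: "\<And>m n. ract X (e m) n = e (m * n)"
    and min: "minimal_nonempty_sub X Y" and triv: "trivial_endomorphisms (restrict_mset X Y)"
  shows "\<exists>l::'m. left_absorbing l"
proof -
  \<comment> \<open>X is M with its elements relabelled by \<open>e\<close>, so that M itself and
    its copy \<open>N\<close> are treated together; \<open>d\<close> reads the labels back.\<close>
  define d where "d = inv e"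
  have de: "d (e m) = m" for m
    unfolding d_def using bij by (simp add: bij_betw_def)
  have ed: "e (d x) = x" if "x \<in> rcarrier X" for x
    unfolding d_def using bij that by (simp add: bij_betw_def f_inv_into_f)
  have d_act: "d (ract X x n) = d x * n" if "x \<in> rcarrier X" for x n
    using act[of "d x" n] that by (simp add: ed de)
  have Y: "sub_mset X Y" "Y \<noteq> {}" and least: "\<And>Z. sub_mset X Z \<Longrightarrow> Z \<noteq> {} \<Longrightarrow> Y \<subseteq> Z"
    using min by (auto simp: minimal_nonempty_sub_def)
  have YX: "y \<in> rcarrier X" if "y \<in> Y" for y
    using Y(1) that by (auto simp: sub_mset_def)
  obtain y0 where y0: "y0 \<in> Y"
    using Y(2) by blast
  have "n * d y0 = d y0" for n
  proof -
    define t where "t y = e (n * d y)" for y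
    have t_act: "t (ract X y m) = ract X (t y) m" if "y \<in> Y" for y m
      using that by (simp add: t_def d_act YX act mult.assoc)
    have t_in: "t y \<in> rcarrier X" for y
      using bij by (auto simp: t_def bij_betw_def)
    have Y_act: "ract X y m \<in> Y" if "y \<in> Y" for y m
      using Y(1) that by (simp add: sub_mset_def)
    have "sub_mset X (t ` Y)"
      unfolding sub_mset_def using t_in Y_act by (auto simp: t_act[symmetric])
    then have "Y \<subseteq> t ` Y"
      using Y(2) by (intro least) simp_all
    then have "{y \<in> Y. t y \<in> Y} \<noteq> {}"
      using y0 by auto
    moreover have "sub_mset X {y \<in> Y. t y \<in> Y}"
      unfolding sub_mset_def using YX Y_act by (auto simp: t_act)
    ultimately have "Y \<subseteq> {y \<in> Y. t y \<in> Y}"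
      by (intro least)
    then have "(\<lambda>y\<in>Y. t y) \<in> rhom (restrict_mset X Y) (restrict_mset X Y)"
      using restrict_rhomI[OF right_mset_restrict[OF X Y(1)], of t "restrict_mset X Y"]
      by (auto simp: t_act)
    then have "(\<lambda>y\<in>Y. t y) = (\<lambda>y\<in>Y. y)"
      using triv by (simp add: trivial_endomorphisms_def)
    then have "t y0 = y0"
      using y0 by (metis restrict_apply')
    then show ?thesis
      unfolding t_def by (metis de)
  qed
  then show ?thesis
    by (auto simp: left_absorbing_def)
qed

text \<open>For idempotent e this is a retract of M, by left multiplication with e, and it
  represents the functor that sends X to the fixed points of e in X.\<close>

definition principal_ideal :: "'m::monoid_mult \<Rightarrow> ('m, 'm) right_act" where
  "principal_ideal e = restrict_mset regular_mset (range ((*) e))"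

lemma principal_simps [simp]:
  "rcarrier (principal_ideal e) = range ((*) e)" "ract (principal_ideal e) m n = m * n"
  by (simp_all add: principal_ideal_def)

lemma right_mset_principal: "right_mset (principal_ideal e)"
  by (auto simp: right_mset_def mult.assoc)

lemma principal_mem:
  fixes e :: "'m::monoid_mult"
  assumes "e * e = e"
  shows "q \<in> range ((*) e) \<longleftrightarrow> e * q = q"
proof -
  have "e * (e * x) = e * x" for x
    using assms by (metis mult.assoc)
  then show ?thesis
    by (auto intro: range_eqI[OF sym])
qed

text \<open>Yoneda for e M: the generator e = e e is fixed by e, hence so is its image, and the
  image of e determines the homomorphism.\<close>

lemma rhom_principal:
  assumes "e * e = e" "f \<in> rhom (principal_ideal e) X"
  shows "f e \<in> rcarrier X" "ract X (f e) e = f e" "e * q = q \<Longrightarrow> f q = ract X (f e) q"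
proof -
  have e: "e \<in> rcarrier (principal_ideal e)"
    using assms(1) by (simp add: principal_mem)
  show "f e \<in> rcarrier X" "ract X (f e) e = f e" "e * q = q \<Longrightarrow> f q = ract X (f e) q"
    using rhomD(3)[OF assms(2) e] rhomD(4)[OF assms(2) e, of e] rhomD(4)[OF assms(2) e, of q] assms(1)
    by simp_all
qed

lemma principal_rhom:
  assumes "right_mset X" "x \<in> rcarrier X"
  shows "(\<lambda>q\<in>range ((*) e). ract X x q) \<in> rhom (principal_ideal e) X"
  using restrict_rhomI[OF right_mset_principal, of e "ract X x" X] assms
  by (simp add: right_msetD)

lemma connected_principal:
  assumes "left_absorbing l"
  shows "connected_mset (principal_ideal l)"
proof -
  have "(x, y) \<in> conn (principal_ideal l)" if "x \<in> range ((*) l)" "y \<in> range ((*) l)" for x y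
    using that assms conn_iff_absorbing[OF assms right_mset_principal, of x l y]
    by (simp add: left_absorbing_def)
  then show ?thesis
    by (simp add: connected_mset_def)
qed

context universe
begin

lemma Obj_indecomposable: "X \<in> Obj (full_subcategory PSets indecomposable) \<longleftrightarrow>
    right_mset X \<and> small \<kappa> (rcarrier X) \<and> connected_mset X"
  using indecomposable_iff_connected[of X] by (auto simp: full_subcategory_def PSh_def)

lemma Hom_indecomposable: "Hom (full_subcategory PSets indecomposable) = rhom"
  by (simp add: full_subcategory_def)

text \<open>M as an object of \<open>PSh\<close>: the test object on which initial indecomposables,
  least sub-M-sets, left adjoints of C and terminal points are evaluated.\<close>

abbreviation "N \<equiv> copy_mset (regular_mset :: ('m, 'm) right_act) :: ('m, 'u) right_act"

lemma small_regular: "small \<kappa> (rcarrier (regular_mset :: ('m, 'm) right_act))"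
  by (rule small_monoid)

lemma regular_copy:
  "right_mset N"
  "small \<kappa> (rcarrier N)"
  "connected_mset N"
  using right_mset_copy[OF right_mset_regular small_regular] small_copy[OF right_mset_regular small_regular]
    connected_copy[OF right_mset_regular small_regular connected_regular] by simp_all

lemma minimal_subs_imp_absorbing:
  assumes "\<forall>X\<in>Obj PSets. indecomposable X \<longrightarrow>
    (\<exists>Y. minimal_nonempty_sub X Y \<and> trivial_endomorphisms (restrict_mset X Y))"
  shows "\<exists>l::'m. left_absorbing l"
proof -
  obtain Y where "minimal_nonempty_sub N Y" "trivial_endomorphisms (restrict_mset N Y)"
    using assms regular_copy by (auto simp: indecomposable_iff_connected)
  moreover have "bij_betw (code UNIV :: 'm \<Rightarrow> 'u) UNIV (rcarrier N)"
    using inj_on_code[OF small_UNIV_monoid] by (simp add: bij_betw_def copy_mset_def)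
  moreover have "ract N (code UNIV m) n = code UNIV (m * n)" for m n
    using ract_code[OF right_mset_regular small_regular, of m n] by simp
  ultimately show ?thesis
    using regular_copy(1) by (intro minimal_sub_imp_absorbing[of N "code UNIV" Y])
qed

text \<open>Left multiplication commutes with the right action, so it is an endomorphism of
  \<open>N\<close>. The common fixed points of these endomorphisms are the codes of left absorbing
  elements.\<close>

definition left_mult :: "'m \<Rightarrow> 'u \<Rightarrow> 'u" where
  "left_mult n = (\<lambda>z\<in>rcarrier N.
     code (UNIV :: 'm set) (n * decode UNIV z))"

lemma left_mult_rhom:
  "left_mult n \<in> rhom N N"
  unfolding left_mult_def
proof (rule restrict_rhomI[OF regular_copy(1)])
  fix z assume z: "z \<in> rcarrier N"
  note K = right_mset_regular[where 'a = 'm] small_regular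
  show "code (UNIV :: 'm set) (n * decode UNIV z) \<in> rcarrier N"
    using code_in_copy[OF K, of "n * decode UNIV z"] by simp
  show "code (UNIV :: 'm set) (n * decode UNIV (ract N z m)) =
     ract N (code (UNIV :: 'm set) (n * decode UNIV z)) m" for m
    using decode_ract[OF K z, of m] ract_code[OF K, of "n * decode UNIV z" m] by (simp add: mult.assoc)
qed

lemma invariant_imp_absorbing:
  assumes z: "z \<in> rcarrier N"
    and inv: "\<And>n. left_mult n z = z"
  shows "left_absorbing (decode UNIV z :: 'm)"
  unfolding left_absorbing_def
proof
  fix n :: 'm
  have "decode (UNIV :: 'm set) (left_mult n z) = n * decode UNIV z"
    using z decode_code[OF small_UNIV_monoid, of "n * decode UNIV z"] by (simp add: left_mult_def)
  then show "n * decode UNIV z = (decode UNIV z :: 'm)"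
    by (simp add: inv)
qed

text \<open>The unique map from the initial object to \<open>N\<close>, followed by
  \<open>left_mult n\<close>, is again a map to \<open>N\<close> and so the same map.
  Indecomposability of the initial object supplies a point at which to evaluate it.\<close>

lemma initial_imp_absorbing:
  assumes "has_initial (full_subcategory PSets indecomposable)"
  shows "\<exists>l::'m. left_absorbing l"
proof -
  obtain X where "X \<in> Obj (full_subcategory PSets indecomposable)"
    and "\<forall>Y\<in>Obj (full_subcategory PSets indecomposable). \<exists>!f. f \<in> rhom X Y"
    using assms unfolding has_initial_def Hom_indecomposable by blast
  then have X: "right_mset X" "connected_mset X" and ex1: "\<exists>!f. f \<in> rhom X N"
    using regular_copy by (simp_all add: Obj_indecomposable)
  obtain t where t: "t \<in> rhom X N"
    using ex1 by blast
  obtain x where x: "x \<in> rcarrier X"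
    using X(2) by (auto simp: connected_mset_def)
  have "left_mult n (t x) = t x" for n
  proof -
    have "compose (rcarrier X) (left_mult n) t = t"
      using ex1 t compose_rhom[OF X(1) t left_mult_rhom] by blast
    then show ?thesis
      using x by (metis compose_eq)
  qed
  then show ?thesis
    using invariant_imp_absorbing[OF rhomD(3)[OF t x]] by blast
qed

text \<open>A map f from l M to X has f l = (f l) l, and in a connected X this equals x l for every
  point x. So f is forced to be q -> x q, independently of the choice of x.\<close>

lemma absorbing_imp_initial:
  assumes l: "left_absorbing (l::'m)"
  shows "has_initial (full_subcategory PSets indecomposable)"
proof -
  have ll: "l * l = l"
    using l by (simp add: left_absorbing_def)
  note K = right_mset_principal[of l] small_monoid[of "rcarrier (principal_ideal l)"]
  let ?K = "copy_mset (principal_ideal l) :: ('m, 'u) right_act"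
  let ?c = "code (rcarrier (principal_ideal l)) :: 'm \<Rightarrow> 'u" and ?d = "decode (rcarrier (principal_ideal l)) :: 'u \<Rightarrow> 'm"
  have "\<exists>!f. f \<in> rhom ?K X" if X: "right_mset X" and con: "connected_mset X" for X :: "('m, 'u) right_act"
  proof -
    obtain x where x: "x \<in> rcarrier X"
      using con by (auto simp: connected_mset_def)
    let ?f = "\<lambda>z\<in>rcarrier ?K. ract X x (?d z)"
    show ?thesis
    proof (rule ex1I[of _ ?f])
      show "?f \<in> rhom ?K X"
        using X x decode_ract[OF K] by (intro restrict_rhomI right_mset_copy K) (simp_all add: right_msetD)
    next
      fix f assume f: "f \<in> rhom ?K X"
      have l_in: "?c l \<in> rcarrier ?K"
        using ll by (intro code_in_copy K) (metis principal_simps(1) rangeI)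
      have fl: "f (?c l) \<in> rcarrier X"
        using f l_in by (rule rhomD(3))
      have act: "f (?c (l * m)) = ract X (f (?c l)) m" for m
        using rhomD(4)[OF f l_in, of m] ract_code[OF K, of l m] ll by (simp add: principal_mem)
      have "f (?c l) = ract X x l"
        using act[of l] con conn_iff_absorbing[OF l X fl x] fl x by (simp add: ll connected_mset_def)
      show "f = ?f"
      proof (rule extensionalityI[of _ "rcarrier ?K"])
        fix z assume z: "z \<in> rcarrier ?K"
        have "l * ?d z = ?d z"
          using decode_in[OF K z] ll by (simp add: principal_mem)
        then have "f z = ract X (f (?c l)) (?d z)"
          using act[of "?d z"] code_decode[OF K z] by simp
        then show "f z = ?f z"
          using z X x \<open>l * ?d z = ?d z\<close> \<open>f (?c l) = ract X x l\<close> by (simp add: right_msetD)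
      qed (use rhomD(2)[OF f] in simp_all)
    qed
  qed
  then show ?thesis
    unfolding has_initial_def Hom_indecomposable
    using right_mset_copy[OF K] small_copy[OF K] connected_copy[OF K connected_principal[OF l]]
    by (intro bexI[of _ ?K] ballI) (simp_all add: Obj_indecomposable)
qed

end

section \<open>Products of components and of tensor products with the terminal left M-set\<close>

section \<open>Products of components\<close>

text \<open>The common core of product preservation for C and for the tensor product. Surjectivity
  lifts a family of classes to a family of representatives by choice; injectivity is the condition
  that \<open>r\<close> holds as soon as it holds in each coordinate.\<close>

lemma bij_betw_quotient_product:
  assumes r: "equiv P r" and s: "\<And>i. i \<in> I \<Longrightarrow> equiv (X i) (s i)"
    and f: "\<And>i p. i \<in> I \<Longrightarrow> p \<in> P \<Longrightarrow> f i p \<in> X i"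
    and surj: "\<And>x. x \<in> (\<Pi>\<^sub>E i\<in>I. X i) \<Longrightarrow> \<exists>p\<in>P. \<forall>i\<in>I. f i p = x i"
    and rel: "\<And>p q. p \<in> P \<Longrightarrow> q \<in> P \<Longrightarrow> (p, q) \<in> r \<longleftrightarrow> (\<forall>i\<in>I. (f i p, f i q) \<in> s i)"
  shows "bij_betw (\<lambda>c. \<lambda>i\<in>I. s i `` (f i ` c)) (P // r) (\<Pi>\<^sub>E i\<in>I. X i // s i)"
proof -
  have cls: "s i `` (f i ` (r `` {p})) = s i `` {f i p}" if i: "i \<in> I" and p: "p \<in> P" for i p
  proof -
    have "s i `` {f i q} = s i `` {f i p}" if "q \<in> r `` {p}" for q
    proof -
      have "(p, q) \<in> r" "q \<in> P"
        using that r by (auto simp: equiv_def refl_on_def)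
      then show ?thesis
        using eq_equiv_class_iff[OF s[OF i] f[OF i p] f[OF i]] rel p i by metis
    qed
    then have "(\<Union>q\<in>r `` {p}. s i `` {f i q}) = s i `` {f i p}"
      using equiv_class_self[OF r p] by blast
    moreover have "s i `` (f i ` (r `` {p})) = (\<Union>q\<in>r `` {p}. s i `` {f i q})"
      by blast
    ultimately show ?thesis by simp
  qed
  show ?thesis
  proof (rule bij_betw_imageI)
    show "inj_on (\<lambda>c. \<lambda>i\<in>I. s i `` (f i ` c)) (P // r)"
    proof (rule inj_onI)
      fix c d assume "c \<in> P // r" "d \<in> P // r"
        and eq: "(\<lambda>i\<in>I. s i `` (f i ` c)) = (\<lambda>i\<in>I. s i `` (f i ` d))"
      then obtain p q where p: "p \<in> P" "c = r `` {p}" and q: "q \<in> P" "d = r `` {q}"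
        by (auto elim!: quotientE)
      have "(f i p, f i q) \<in> s i" if i: "i \<in> I" for i
      proof -
        have "s i `` {f i p} = s i `` {f i q}"
          using fun_cong[OF eq, of i] i p q by (simp add: cls)
        then show ?thesis
          using eq_equiv_class_iff[OF s[OF i] f[OF i p(1)] f[OF i q(1)]] by simp
      qed
      then show "c = d"
        using rel[OF p(1) q(1)] p q by (simp add: equiv_class_eq[OF r])
    qed
    show "(\<lambda>c. \<lambda>i\<in>I. s i `` (f i ` c)) ` (P // r) = (\<Pi>\<^sub>E i\<in>I. X i // s i)"
    proof (intro equalityI subsetI)
      fix g assume "g \<in> (\<lambda>c. \<lambda>i\<in>I. s i `` (f i ` c)) ` (P // r)"
      then obtain p where "p \<in> P" "g = (\<lambda>i\<in>I. s i `` (f i ` (r `` {p})))"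
        by (auto elim!: quotientE)
      then show "g \<in> (\<Pi>\<^sub>E i\<in>I. X i // s i)"
        using f by (auto simp: cls intro!: quotientI)
    next
      fix g assume g: "g \<in> (\<Pi>\<^sub>E i\<in>I. X i // s i)"
      then have "\<forall>i\<in>I. \<exists>x. x \<in> X i \<and> g i = s i `` {x}"
        by (fastforce elim: quotientE)
      then obtain x where x: "\<And>i. i \<in> I \<Longrightarrow> x i \<in> X i \<and> g i = s i `` {x i}"
        by metis
      obtain p where p: "p \<in> P" "\<forall>i\<in>I. f i p = x i"
        using surj[of "\<lambda>i\<in>I. x i"] x by auto
      have "g = (\<lambda>i\<in>I. s i `` (f i ` (r `` {p})))"
        by (rule extensionalityI[of _ I]) (use g x p in \<open>auto simp: cls PiE_def\<close>)
      then show "g \<in> (\<lambda>c. \<lambda>i\<in>I. s i `` (f i ` c)) ` (P // r)"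
        using p(1) by (auto intro!: image_eqI quotientI)
    qed
  qed
qed

lemma product_mset_simps [simp]:
  "rcarrier (product_mset I X) = (\<Pi>\<^sub>E i\<in>I. rcarrier (X i))"
  "ract (product_mset I X) x m = (\<lambda>i\<in>I. ract (X i) (x i) m)"
  by (simp_all add: product_mset_def)

lemma right_mset_product:
  "(\<And>i. i \<in> I \<Longrightarrow> right_mset (X i)) \<Longrightarrow> right_mset (product_mset I X)"
  by (subst right_mset_def)
    (auto simp: right_msetD PiE_iff intro!: extensionalityI[of _ I])

text \<open>With l available, being connected is the single equation x l = y l, and equations in a
  product are checked coordinatewise. Zigzags in the factors could not be combined directly, as they
  need not have a common shape.\<close>

lemma conn_product_absorbing:
  fixes X :: "'i \<Rightarrow> ('m::monoid_mult, 'x) right_act"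
  assumes l: "left_absorbing (l::'m)" and X: "\<And>i. i \<in> I \<Longrightarrow> right_mset (X i)"
    and x: "x \<in> (\<Pi>\<^sub>E i\<in>I. rcarrier (X i))" and y: "y \<in> (\<Pi>\<^sub>E i\<in>I. rcarrier (X i))"
  shows "(x, y) \<in> conn (product_mset I X) \<longleftrightarrow> (\<forall>i\<in>I. (x i, y i) \<in> conn (X i))"
proof -
  have "(\<lambda>i\<in>I. ract (X i) (x i) l) = (\<lambda>i\<in>I. ract (X i) (y i) l) \<longleftrightarrow>
      (\<forall>i\<in>I. ract (X i) (x i) l = ract (X i) (y i) l)"
    by (auto simp: restrict_def fun_eq_iff)
  then show ?thesis
    using conn_iff_absorbing[OF l right_mset_product[of I X], of x y] X x y
    by (simp add: conn_iff_absorbing[OF l X] PiE_iff)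
qed

lemma absorbing_imp_products:
  assumes "left_absorbing (l::'m::monoid_mult)"
  shows "components_preserves_products TYPE('m) \<kappa>"
  unfolding components_preserves_products_def
proof (intro allI impI, elim conjE)
  fix I :: "'a set" and X :: "'a \<Rightarrow> ('m, 'a) right_act"
  assume "\<forall>i\<in>I. X i \<in> Obj (PSh TYPE('m) \<kappa>)"
  then have X: "right_mset (X i)" if "i \<in> I" for i
    using that by simp
  have "bij_betw (\<lambda>c. \<lambda>i\<in>I. conn (X i) `` ((\<lambda>x. x i) ` c))
      (components (product_mset I X)) (\<Pi>\<^sub>E i\<in>I. components (X i))"
    unfolding components_def
  proof (rule bij_betw_quotient_product)
    show "equiv (rcarrier (product_mset I X)) (conn (product_mset I X))"
      by (rule equiv_conn)
    show "equiv (rcarrier (X i)) (conn (X i))" for i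
      by (rule equiv_conn)
    show "\<exists>p\<in>rcarrier (product_mset I X). \<forall>i\<in>I. p i = x i"
      if "x \<in> (\<Pi>\<^sub>E i\<in>I. rcarrier (X i))" for x
      using that by auto
    show "(p, q) \<in> conn (product_mset I X) \<longleftrightarrow> (\<forall>i\<in>I. (p i, q i) \<in> conn (X i))"
      if "p \<in> rcarrier (product_mset I X)" "q \<in> rcarrier (product_mset I X)" for p q
      using that by (intro conn_product_absorbing[OF assms X]) simp_all
  qed auto
  then show "bij_betw (\<lambda>c. \<lambda>i\<in>I. components_map (product_mset I X) (X i) (\<lambda>x. x i) c)
      (components (product_mset I X)) (\<Pi>\<^sub>E i\<in>I. components (X i))"
    by (rule bij_betw_cong[THEN iffD1, rotated]) (simp add: components_map_def)
qed

lemma equiv_tensor_rel: "equiv (rcarrier X \<times> lcarrier B) (tensor_rel X B)"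
  by (rule equivI) (auto simp: tensor_rel_def refl_on_def intro!: symI transI elim: equivclp_sym dest: equivclp_trans)

text \<open>With the trivial action on one point, the generating pair of (x m, b) and (x, m b) is a
  step of \<open>conn\<close> read backwards. This is the identification of C(X) with the tensor
  product of X and 1.\<close>

lemma tensor_rel_terminal:
  assumes X: "right_mset X"
  shows "((x, b), (y, c)) \<in> tensor_rel X terminal_left_mset \<longleftrightarrow> (x, y) \<in> conn X"
proof
  let ?T = "tensor_rel X terminal_left_mset"
  assume "((x, b), (y, c)) \<in> ?T"
  then have x: "x \<in> rcarrier X" and
    "equivclp (\<lambda>v w. \<exists>x\<in>rcarrier X. \<exists>b\<in>lcarrier (terminal_left_mset :: ('a, unit) left_act).
       \<exists>m. v = (ract X x m, b) \<and> w = (x, lact terminal_left_mset m b)) (x, b) (y, c)"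
    by (auto simp: tensor_rel_def)
  \<comment> \<open>Writing \<open>fst (y, c)\<close> keeps the end of the zigzag a single term over
    which the induction can generalise.\<close>
  from this(2) have "(x, fst (y, c)) \<in> conn X"
  proof (induction rule: equivclp_induct)
    case base
    show ?case
      using x equiv_conn[of X] by (simp add: conn_def)
  next
    case (step v w)
    then have "(fst v, fst w) \<in> conn X"
      using conn_step[OF X] equiv_conn[of X] by (fastforce elim: equivE dest: symD)
    then show ?case
      using step.IH equiv_conn[of X] by (metis equivE transE)
  qed
  then show "(x, y) \<in> conn X"
    by simp
next
  let ?T = "tensor_rel X terminal_left_mset"
  assume xy: "(x, y) \<in> conn X"
  have "?T `` {(ract X z m, ())} = ?T `` {(z, ())}" if "z \<in> rcarrier X" for z m
  proof (rule equiv_class_eq[OF equiv_tensor_rel])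
    show "((ract X z m, ()), (z, ())) \<in> ?T"
      using that X unfolding tensor_rel_def
      by (auto simp: terminal_left_mset_def right_msetD intro!: r_into_equivclp)
  qed
  then have "?T `` {(x, ())} = ?T `` {(y, ())}"
    by (rule conn_invariant[where h = "\<lambda>z. ?T `` {(z, ())}", OF X _ xy])
  moreover have "(y, ()) \<in> rcarrier X \<times> lcarrier (terminal_left_mset :: ('a, unit) left_act)"
    using xy by (simp add: conn_def terminal_left_mset_def)
  ultimately have "((x, ()), (y, ())) \<in> ?T"
    by (rule eq_equiv_class[OF _ equiv_tensor_rel])
  then show "((x, b), (y, c)) \<in> ?T"
    by simp
qed

lemma absorbing_imp_product_flat:
  assumes l: "left_absorbing (l::'m::monoid_mult)"
  shows "product_flat \<kappa> (terminal_left_mset :: ('m, unit) left_act)"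
  unfolding product_flat_def
proof (intro conjI allI impI)
  show "left_mset (terminal_left_mset :: ('m, unit) left_act)"
    "lcarrier (terminal_left_mset :: ('m, unit) left_act) \<noteq> {}"
    by (simp_all add: left_mset_def terminal_left_mset_def)
  fix I :: "'a set" and X :: "'a \<Rightarrow> ('m, 'a) right_act"
  assume "small \<kappa> I \<and> (\<forall>i\<in>I. X i \<in> Obj (PSh TYPE('m) \<kappa>))"
  then have X: "right_mset (X i)" if "i \<in> I" for i
    using that by simp
  let ?T = "terminal_left_mset :: ('m, unit) left_act"
  have "bij_betw (\<lambda>c. \<lambda>i\<in>I. tensor_rel (X i) ?T `` ((\<lambda>(x, b). (x i, b)) ` c))
      (tensor (product_mset I X) ?T) (\<Pi>\<^sub>E i\<in>I. tensor (X i) ?T)"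
    unfolding tensor_def
  proof (rule bij_betw_quotient_product)
    fix x assume x: "x \<in> (\<Pi>\<^sub>E i\<in>I. rcarrier (X i) \<times> lcarrier ?T)"
    then have "(\<lambda>i\<in>I. fst (x i), ()) \<in> rcarrier (product_mset I X) \<times> lcarrier ?T"
      by (auto simp: terminal_left_mset_def dest: PiE_mem)
    then show "\<exists>p\<in>rcarrier (product_mset I X) \<times> lcarrier ?T. \<forall>i\<in>I. (\<lambda>(x, b). (x i, b)) p = x i"
      by (rule bexI[rotated]) (auto simp: prod_eq_iff)
  next
    fix p q assume "p \<in> rcarrier (product_mset I X) \<times> lcarrier ?T" "q \<in> rcarrier (product_mset I X) \<times> lcarrier ?T"
    then show "(p, q) \<in> tensor_rel (product_mset I X) ?T \<longleftrightarrow>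
      (\<forall>i\<in>I. ((\<lambda>(x, b). (x i, b)) p, (\<lambda>(x, b). (x i, b)) q) \<in> tensor_rel (X i) ?T)"
      using conn_product_absorbing[where I = I and X = X and x = "fst p" and y = "fst q", OF l X]
      by (cases p, cases q) (simp add: tensor_rel_terminal right_mset_product X)
  next
    show "equiv (rcarrier (product_mset I X) \<times> lcarrier ?T) (tensor_rel (product_mset I X) ?T)"
      by (rule equiv_tensor_rel)
    show "equiv (rcarrier (X i) \<times> lcarrier ?T) (tensor_rel (X i) ?T)" for i
      by (rule equiv_tensor_rel)
  qed auto
  then show "bij_betw (\<lambda>c. \<lambda>i\<in>I. tensor_map (product_mset I X) (X i) ?T (\<lambda>x. x i) c)
      (tensor (product_mset I X) ?T) (\<Pi>\<^sub>E i\<in>I. tensor (X i) ?T)"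
    by (rule bij_betw_cong[THEN iffD1, rotated]) (simp add: tensor_map_def)
qed

lemma products_imp_powers:
  assumes "components_preserves_products TYPE('m::monoid_mult) \<kappa>"
  shows "components_preserves_powers TYPE('m) \<kappa>"
  unfolding components_preserves_powers_def
proof (intro allI impI)
  fix I :: "'a set" and Y :: "('m, 'a) right_act"
  assume "small \<kappa> I \<and> Y \<in> Obj (PSh TYPE('m) \<kappa>)"
  then show "bij_betw (\<lambda>c. \<lambda>i\<in>I. components_map (product_mset I (\<lambda>_. Y)) Y (\<lambda>y. y i) c)
      (components (product_mset I (\<lambda>_. Y))) (I \<rightarrow>\<^sub>E components Y)"
    using assms[unfolded components_preserves_products_def, rule_format, of I "\<lambda>_. Y"] by simp
qed

section \<open>From preservation of powers to an absorbing element\<close>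

section \<open>Powers\<close>

text \<open>The projections in the comparison maps are plain functions, while \<open>rhom\<close>
  consists of extensional ones. Since \<open>components_map\<close> sees only values on the carrier,
  the two may be exchanged.\<close>

lemma components_map_cong:
  assumes "\<And>x. x \<in> rcarrier X \<Longrightarrow> f x = g x"
  shows "components_map X Y f = components_map X Y g"
proof -
  have "f ` c = g ` c" if "c \<in> components X" for c
    using that assms by (intro image_cong refl) (auto simp: conn_def elim!: classE)
  then show ?thesis
    unfolding components_map_def by (intro restrict_ext) simp
qed

lemma components_map_projection:
  assumes "\<And>i. i \<in> I \<Longrightarrow> right_mset (X i)" "i \<in> I" "x \<in> rcarrier (product_mset I X)"
  shows "components_map (product_mset I X) (X i) (\<lambda>x. x i) (conn (product_mset I X) `` {x}) = conn (X i) `` {x i}"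
proof -
  let ?P = "product_mset I X"
  have P: "right_mset ?P"
    using assms(1) by (rule right_mset_product)
  let ?p = "\<lambda>x\<in>rcarrier ?P. x i"
  have "?p \<in> rhom ?P (X i)"
    using assms(2) by (intro restrict_rhomI P) (auto simp: PiE_iff)
  then have "components_map ?P (X i) ?p (conn ?P `` {x}) = conn (X i) `` {?p x}"
    using assms by (intro components_map_class P) auto
  moreover have "components_map ?P (X i) (\<lambda>x. x i) = components_map ?P (X i) ?p"
    by (rule components_map_cong) simp
  ultimately show ?thesis
    using assms(3) by simp
qed

context universe
begin

text \<open>Injectivity of the comparison map, moved from \<open>'u\<close> to arbitrary small index
  sets and M-sets: points of a power that are connected in each coordinate are connected.\<close>

lemma powers_imp_conn:
  assumes powers: "components_preserves_powers TYPE('m) \<kappa>"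
    and Y: "right_mset (Y :: ('m, 'y) right_act)" "small \<kappa> (rcarrier Y)" and I: "small \<kappa> (I :: 'i set)"
    and x: "x \<in> I \<rightarrow>\<^sub>E rcarrier Y" and y: "y \<in> I \<rightarrow>\<^sub>E rcarrier Y"
    and xy: "\<And>i. i \<in> I \<Longrightarrow> (x i, y i) \<in> conn Y"
  shows "(x, y) \<in> conn (product_mset I (\<lambda>_. Y))"
proof -
  let ?K = "copy_mset Y :: ('m, 'u) right_act"
  let ?j = "code I :: 'i \<Rightarrow> 'u"
  let ?P = "product_mset (?j ` I) (\<lambda>_. ?K)"
  let ?\<Phi> = "\<lambda>c. \<lambda>k\<in>?j ` I. components_map ?P ?K (\<lambda>z. z k) c"
  \<comment> \<open>\<open>enc\<close> re-indexes a family along the code of \<open>I\<close> and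
    encodes its values; the homomorphism \<open>h\<close> below brings the connection back.\<close>
  define enc where "enc x = (\<lambda>k\<in>?j ` I. code (rcarrier Y) (x (decode I k)) :: 'u)" for x
  have K: "right_mset ?K" "small \<kappa> (rcarrier ?K)"
    using Y by simp_all
  have enc: "enc x \<in> rcarrier ?P" if "x \<in> I \<rightarrow>\<^sub>E rcarrier Y" for x
    using that Y I by (auto simp: enc_def PiE_iff)
  have P: "right_mset ?P"
    using K by (intro right_mset_product)
  have inj: "inj_on ?\<Phi> (components ?P)"
    using powers K small_image[OF I, of ?j]
    by (simp add: components_preserves_powers_def bij_betw_def)
  have "?\<Phi> (conn ?P `` {enc x}) = ?\<Phi> (conn ?P `` {enc y})"
  proof (rule restrict_ext)
    fix k assume "k \<in> ?j ` I"
    then obtain i where i: "i \<in> I" "k = ?j i"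
      by blast
    have "conn ?K `` {enc x k} = conn ?K `` {enc y k}"
      using conn_code[OF Y xy[OF i(1)]] i I equiv_class_eq[OF equiv_conn] by (simp add: enc_def)
    then show "components_map ?P ?K (\<lambda>z. z k) (conn ?P `` {enc x}) =
      components_map ?P ?K (\<lambda>z. z k) (conn ?P `` {enc y})"
      using components_map_projection[where X = "\<lambda>_. ?K", OF K(1) \<open>k \<in> ?j ` I\<close>] enc[OF x] enc[OF y]
      by simp
  qed
  then have "conn ?P `` {enc x} = conn ?P `` {enc y}"
    using enc x y by (intro inj_onD[OF inj]) (simp_all add: class_in_components)
  then have conn: "(enc x, enc y) \<in> conn ?P"
    using class_eq_iff[OF enc[OF x] enc[OF y]] by simp
  define h where "h = (\<lambda>z\<in>rcarrier ?P. \<lambda>i\<in>I. decode (rcarrier Y) (z (?j i)))"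
  have "h \<in> rhom ?P (product_mset I (\<lambda>_. Y))"
    unfolding h_def using Y by (intro restrict_rhomI P) (auto simp: PiE_iff)
  then have "(h (enc x), h (enc y)) \<in> conn (product_mset I (\<lambda>_. Y))"
    using conn by (rule conn_map[OF P right_mset_product[OF Y(1)]])
  moreover have "h (enc x) = x" if "x \<in> I \<rightarrow>\<^sub>E rcarrier Y" for x
    by (rule extensionalityI[of _ I])
      (use that enc[OF that] Y I in \<open>auto simp: h_def enc_def PiE_iff simp del: product_mset_simps\<close>)
  ultimately show ?thesis
    using x y by simp
qed

end

text \<open>For disjoint right ideals \<open>A\<close> and \<open>B\<close>, the \<open>M\<close>-set \<open>chain A B\<close> glues countably many copies of
  \<open>M\<close> in a row: in the \<open>n\<close>-th copy, \<open>A\<close> is collapsed to the fixed point \<open>(n, None)\<close> and \<open>B\<close> to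
  the fixed point \<open>(n + 1, None)\<close>.\<close>

definition chain :: "'m set \<Rightarrow> 'm set \<Rightarrow> ('m::monoid_mult, nat \<times> 'm option) right_act" where
  "chain A B = \<lparr>rcarrier = {(n, p). \<forall>m. p = Some m \<longrightarrow> m \<notin> A \<union> B},
     ract = \<lambda>(n, p) x. case p of None \<Rightarrow> (n, None) | Some m \<Rightarrow>
       if m * x \<in> A then (n, None) else if m * x \<in> B then (Suc n, None) else (n, Some (m * x))\<rparr>"

lemma chain_simps [simp]:
  "(n, None) \<in> rcarrier (chain A B)"
  "(n, Some m) \<in> rcarrier (chain A B) \<longleftrightarrow> m \<notin> A \<and> m \<notin> B"
  "ract (chain A B) (n, None) x = (n, None)"
  "ract (chain A B) (n, Some m) x =
     (if m * x \<in> A then (n, None) else if m * x \<in> B then (Suc n, None) else (n, Some (m * x)))"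
  by (auto simp: chain_def)

text \<open>A product that has entered A or B stays there, which matches the collapsed points being
  fixed. Disjointness ensures that an element of B cannot later pass the test for A.\<close>

lemma right_mset_chain:
  assumes "sub_mset regular_mset A" "sub_mset regular_mset B" "A \<inter> B = {}"
  shows "right_mset (chain A B)"
proof -
  have ideal: "m * n \<in> A" if "m \<in> A" for m n using assms(1) that by (simp add: sub_mset_def)
  moreover have "m * n \<in> B" if "m \<in> B" for m n using assms(2) that by (simp add: sub_mset_def)
  moreover have "m \<notin> B" if "m \<in> A" for m using assms(3) that by blast
  moreover have "m * n \<notin> A" if "m \<in> B" for m n using assms(2,3) that by (auto simp: sub_mset_def)
  ultimately have "ract (chain A B) v x \<in> rcarrier (chain A B) \<and> ract (chain A B) v 1 = v \<and>
    ract (chain A B) (ract (chain A B) v x) y = ract (chain A B) v (x * y)"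
    if "v \<in> rcarrier (chain A B)" for v x y
    using that by (cases v; cases "snd v") (auto simp flip: mult.assoc)
  then show ?thesis
    unfolding right_mset_def by blast
qed

text \<open>The unit of the n-th copy is sent to \<open>(n, None)\<close> by an element of A and to
  \<open>(n + 1, None)\<close> by an element of B. It is itself not collapsed: a right ideal
  containing 1 is all of M and would meet the other one.\<close>

lemma chain_connected:
  assumes "sub_mset regular_mset A" "sub_mset regular_mset B" "A \<inter> B = {}" "A \<noteq> {}" "B \<noteq> {}"
  shows "((0, None), (n, None)) \<in> conn (chain A B)"
proof (induction n)
  case 0
  show ?case by (simp add: conn_def)
next
  case (Suc n)
  note C = right_mset_chain[OF assms(1-3)]
  obtain a b where a: "a \<in> A" and b: "b \<in> B"
    using assms(4,5) by blast
  have "1 * b \<in> A" if "1 \<in> A"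
    using assms(1) that unfolding sub_mset_def by (metis regular_mset_simps(2))
  then have "1 \<notin> A"
    using assms(3) b by auto
  have "1 * a \<in> B" if "1 \<in> B"
    using assms(2) that unfolding sub_mset_def by (metis regular_mset_simps(2))
  then have "1 \<notin> B"
    using assms(3) a by auto
  with \<open>1 \<notin> A\<close> have 1: "(n, Some 1) \<in> rcarrier (chain A B)"
    by simp
  have "b \<notin> A" using assms(3) b by blast
  have "conn (chain A B) `` {(n, None)} = conn (chain A B) `` {(Suc n, None)}"
    using class_ract[OF C 1, of a] class_ract[OF C 1, of b] a b \<open>b \<notin> A\<close> by simp
  then have "((n, None), (Suc n, None)) \<in> conn (chain A B)"
    by (simp add: class_eq_iff)
  moreover have "trans (conn (chain A B))"
    using equiv_conn by (rule equivE)
  ultimately show ?case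
    using Suc.IH by (blast dest: transD)
qed

context universe
begin

text \<open>Along a zigzag in the power \<open>chain A B ^ \<nat>\<close> the position in the chain changes by a bounded
  amount, uniformly in the coordinates.\<close>

lemma powers_imp_right_ideals_meet:
  assumes powers: "components_preserves_powers TYPE('m) \<kappa>"
    and A: "sub_mset regular_mset A" "A \<noteq> {}" and B: "sub_mset regular_mset B" "B \<noteq> {}"
  shows "A \<inter> B \<noteq> ({} :: 'm set)"
proof
  assume AB: "A \<inter> B = {}"
  let ?C = "chain A B" and ?P = "product_mset (UNIV :: nat set) (\<lambda>_. chain A B)"
  note C = right_mset_chain[OF A(1) B(1) AB]
  \<comment> \<open>Exhibits \<open>'m option\<close> as an image of \<open>nat \<times> 'm\<close>,
    with index 0 giving \<open>None\<close>; so it is small.\<close>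
  define g :: "nat \<times> 'm \<Rightarrow> 'm option" where "g = (\<lambda>(n, m). if n = 0 then None else Some m)"
  have "p \<in> g ` (UNIV \<times> UNIV)" for p
  proof (cases p)
    case None
    then show ?thesis
      by (intro image_eqI[of _ _ "(0, 1)"]) (simp_all add: g_def)
  next
    case (Some m)
    then show ?thesis
      by (intro image_eqI[of _ _ "(1, m)"]) (simp_all add: g_def)
  qed
  then have "small \<kappa> (UNIV :: 'm option set)"
    by (intro small_subset[OF small_image[OF small_Times[OF small_UNIV_nat small_UNIV_monoid]]] subsetI)
  then have small_C: "small \<kappa> (rcarrier ?C)"
    using small_subset[OF small_Times[OF small_UNIV_nat], of UNIV "rcarrier ?C"] by simp
  \<comment> \<open>The n-th coordinate has to travel from position 0 to position n, so the
    coordinates together admit no common bound on the distance.\<close>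
  let ?x = "\<lambda>_::nat. (0::nat, None :: 'm option)" and ?y = "\<lambda>n::nat. (n, None :: 'm option)"
  have xy: "(?x, ?y) \<in> conn ?P"
    using chain_connected[OF A(1) B(1) AB A(2) B(2)]
    by (intro powers_imp_conn[OF powers C small_C small_UNIV_nat]) (simp_all add: PiE_UNIV_domain)
  \<comment> \<open>The bound \<open>k\<close> is chosen before the coordinate \<open>i\<close>;
    this uniformity is what a zigzag in the power provides.\<close>
  define R where "R = {(x, y). x \<in> rcarrier ?P \<and> y \<in> rcarrier ?P \<and>
    (\<exists>k. \<forall>i. fst (x i) \<le> fst (y i) + k \<and> fst (y i) \<le> fst (x i) + k)}"
  have "conn ?P \<subseteq> R"
  proof (rule conn_least)
    have "(x, z) \<in> R" if xy: "(x, y) \<in> R" and yz: "(y, z) \<in> R" for x y z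
    proof -
      obtain k where k: "\<And>i. fst (x i) \<le> fst (y i) + k \<and> fst (y i) \<le> fst (x i) + k"
        using xy by (auto simp: R_def)
      obtain k' where k': "\<And>i. fst (y i) \<le> fst (z i) + k' \<and> fst (z i) \<le> fst (y i) + k'"
        using yz by (auto simp: R_def)
      have "fst (x i) \<le> fst (z i) + (k + k') \<and> fst (z i) \<le> fst (x i) + (k + k')" for i
        using k[of i] k'[of i] by linarith
      then show ?thesis
        using xy yz unfolding R_def by blast
    qed
    moreover have "(y, x) \<in> R" if "(x, y) \<in> R" for x y
      using that unfolding R_def by blast
    moreover have "(x, x) \<in> R" if "x \<in> rcarrier ?P" for x
      using that unfolding R_def by auto
    moreover have "R \<subseteq> rcarrier ?P \<times> rcarrier ?P"
      unfolding R_def by blast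
    ultimately show "equiv (rcarrier ?P) R"
      by (intro equivI refl_onI symI transI) blast+
    fix x m assume x: "x \<in> rcarrier ?P"
    \<comment> \<open>The action either keeps the position or moves from copy n to the collapsed
      point n + 1, so one step costs at most 1.\<close>
    have "fst v \<le> fst (ract ?C v m) + 1 \<and> fst (ract ?C v m) \<le> fst v + 1" for v
      by (cases v; cases "snd v") auto
    then have "\<exists>k. \<forall>i. fst (x i) \<le> fst (ract ?P x m i) + k \<and> fst (ract ?P x m i) \<le> fst (x i) + k"
      by (intro exI[of _ 1]) simp
    then show "(x, ract ?P x m) \<in> R"
      using x right_msetD(1)[OF right_mset_product x, of m] C unfolding R_def by blast
  qed
  then obtain k where "\<And>i. fst (?y i) \<le> fst (?x i) + k"
    using xy unfolding R_def by blast
  \<comment> \<open>At coordinate k + 1 the bound reads k + 1 \<le> k.\<close>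
  from this[of "Suc k"] show False
    by simp
qed

text \<open>Since right ideals meet, zigzags in a power shorten to a single span. Connecting the identity of
  \<open>M ^ M\<close> to the constant \<open>1\<close> by a span gives \<open>m * c = d\<close> for all \<open>m\<close>.\<close>

lemma powers_imp_absorbing:
  assumes powers: "components_preserves_powers TYPE('m) \<kappa>"
  shows "\<exists>l::'m. left_absorbing l"
proof -
  have ore: "\<exists>p q. a * p = b * q" for a b :: 'm
  proof -
    have "sub_mset regular_mset (range ((*) c))" for c :: 'm
      by (auto simp: sub_mset_def mult.assoc)
    then have "range ((*) a) \<inter> range ((*) b) \<noteq> {}"
      by (intro powers_imp_right_ideals_meet[OF powers]) simp_all
    then show ?thesis
      by fastforce
  qed
  let ?P = "product_mset (UNIV :: 'm set) (\<lambda>_. regular_mset :: ('m, 'm) right_act)"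
  \<comment> \<open>Points joined by a span with legs \<open>c\<close> and \<open>d\<close>, the
    same for all coordinates.\<close>
  define R :: "('m \<Rightarrow> 'm) rel" where "R = {(x, y). \<exists>c d. \<forall>i. x i * c = y i * d}"
  have "conn ?P \<subseteq> R"
  proof (rule conn_least)
    have "(x, z) \<in> R" if xy: "(x, y) \<in> R" and yz: "(y, z) \<in> R" for x y z
    proof -
      obtain c d where cd: "\<And>i. x i * c = y i * d"
        using xy by (auto simp: R_def)
      obtain e f where ef: "\<And>i. y i * e = z i * f"
        using yz by (auto simp: R_def)
      \<comment> \<open>A common right multiple of the inner legs merges two adjacent spans into
        one. This is the use of intersecting right ideals.\<close>
      obtain p q where pq: "d * p = e * q"
        using ore by blast
      have "x i * (c * p) = z i * (f * q)" for i
        using cd[of i] ef[of i] pq by (metis mult.assoc)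
      then show ?thesis
        unfolding R_def by blast
    qed
    moreover have "(y, x) \<in> R" if xy: "(x, y) \<in> R" for x y
    proof -
      obtain c d where "\<And>i. x i * c = y i * d"
        using xy by (auto simp: R_def)
      then have "\<And>i. y i * d = x i * c"
        by simp
      then show ?thesis
        unfolding R_def by blast
    qed
    moreover have "(x, x) \<in> R" for x
      unfolding R_def by blast
    moreover have "R \<subseteq> rcarrier ?P \<times> rcarrier ?P"
      by (simp add: PiE_UNIV_domain)
    ultimately show "equiv (rcarrier ?P) R"
      by (intro equivI refl_onI symI transI) blast+
    fix x :: "'m \<Rightarrow> 'm" and m
    \<comment> \<open>A single step is a span with legs \<open>m\<close> and 1.\<close>
    have "\<forall>i. x i * m = ract ?P x m i * 1"
      by simp
    then show "(x, ract ?P x m) \<in> R"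
      unfolding R_def by blast
  qed
  moreover have "(\<lambda>i. i, \<lambda>_. 1) \<in> conn ?P"
    using connected_regular[where 'a = 'm]
    by (intro powers_imp_conn[OF powers right_mset_regular small_regular small_UNIV_monoid])
      (simp_all add: connected_mset_def PiE_UNIV_domain)
  ultimately have "(\<lambda>i. i, \<lambda>_. 1) \<in> R"
    by (rule subsetD)
  then obtain c d :: 'm where "\<forall>i. i * c = 1 * d"
    by (auto simp: R_def)
  \<comment> \<open>The coordinate i = 1 gives c = d, and then i c = c for every i.\<close>
  then have "left_absorbing c"
    by (metis left_absorbing_def mult_1)
  then show ?thesis
    by blast
qed

section \<open>Colocality: the left adjoint of C\<close>

section \<open>The left adjoint of the components functor\<close>

text \<open>By Yoneda a homomorphism from l M is an element fixed by l, and the class of x contains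
  exactly one such element, namely x l.\<close>

lemma bij_betw_components_absorbing:
  assumes l: "left_absorbing (l::'m)" and X: "right_mset X"
  shows "bij_betw (\<lambda>f. conn X `` {f l}) (rhom (principal_ideal l) X) (components X)"
proof (rule bij_betw_imageI)
  have ll: "l * l = l"
    using l by (simp add: left_absorbing_def)
  show "inj_on (\<lambda>f. conn X `` {f l}) (rhom (principal_ideal l) X)"
  proof (rule inj_onI)
    fix f g assume f: "f \<in> rhom (principal_ideal l) X" and g: "g \<in> rhom (principal_ideal l) X"
      and "conn X `` {f l} = conn X `` {g l}"
    then have "f l = g l"
      using rhom_principal[OF ll f] rhom_principal[OF ll g]
      by (metis class_eq_iff conn_iff_absorbing[OF l X])
    show "f = g"
    proof (rule extensionalityI[of _ "rcarrier (principal_ideal l)"])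
      fix q assume "q \<in> rcarrier (principal_ideal l)"
      then have "l * q = q"
        using ll by (simp add: principal_mem)
      then show "f q = g q"
        using rhom_principal(3)[OF ll f] rhom_principal(3)[OF ll g] \<open>f l = g l\<close> by simp
    qed (use rhomD(2)[OF f] rhomD(2)[OF g] in simp_all)
  qed
  show "(\<lambda>f. conn X `` {f l}) ` rhom (principal_ideal l) X = components X"
  proof (intro equalityI subsetI)
    fix c assume "c \<in> (\<lambda>f. conn X `` {f l}) ` rhom (principal_ideal l) X"
    then show "c \<in> components X"
      by (auto intro!: class_in_components rhom_principal(1)[OF ll])
  next
    fix c assume "c \<in> components X"
    then obtain x where x: "x \<in> rcarrier X" "c = conn X `` {x}"
      by (rule classE)
    have "l \<in> range ((*) l)"
      using ll by (metis rangeI)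
    then have "c = conn X `` {(\<lambda>q\<in>range ((*) l). ract X x q) l}"
      using x class_ract[OF X x(1)] by simp
    then show "c \<in> (\<lambda>f. conn X `` {f l}) ` rhom (principal_ideal l) X"
      using principal_rhom[OF X x(1)] by (rule image_eqI)
  qed
qed

lemma absorbing_imp_components_adjoint:
  assumes l: "left_absorbing (l::'m)"
  shows "adjoint Sets PSets (copower_ftor (principal_ideal l)) (components_ftor TYPE('m) TYPE('u))"
proof (rule copower_adjoint[where \<psi> = "\<lambda>X f. conn X `` {f l}"])
  have ll: "l * l = l"
    using l by (simp add: left_absorbing_def)
  show "right_mset (principal_ideal l)" "small \<kappa> (rcarrier (principal_ideal l))"
    by (rule right_mset_principal, rule small_monoid)
  show "is_ftor PSets Sets (components_ftor TYPE('m) TYPE('u))"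
    by (rule is_ftor_components)
  show "bij_betw (\<lambda>f. conn X `` {f l}) (rhom (principal_ideal l) X) (omap (components_ftor TYPE('m) TYPE('u)) X)"
    if "X \<in> Obj PSets" for X
    using that bij_betw_components_absorbing[OF l, of X] by (simp add: components_ftor_def)
  show "conn Y `` {compose (rcarrier (principal_ideal l)) k f l} =
      amap (components_ftor TYPE('m) TYPE('u)) X Y k (conn X `` {f l})"
    if "X \<in> Obj PSets" "Y \<in> Obj PSets" "f \<in> rhom (principal_ideal l) X" "k \<in> rhom X Y" for X Y f k
    using that components_map_class[of X Y k "f l"] rhom_principal(1)[OF ll that(3)] ll
    by (simp add: components_ftor_def compose_eq principal_mem)
qed

text \<open>Maps from the representing object P to \<open>N\<close> correspond to the components of
  \<open>N\<close>, of which there is one. So the map from P to \<open>N\<close> is unique and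
  unchanged by \<open>left_mult n\<close>.\<close>

lemma components_adjoint_imp_absorbing:
  assumes "adjoint Sets PSets c (components_ftor TYPE('m) TYPE('u))"
  shows "\<exists>l::'m. left_absorbing l"
proof -
  obtain P \<theta> where P: "P \<in> Obj PSets"
    and bij: "\<And>X. X \<in> Obj PSets \<Longrightarrow> bij_betw (\<theta> X) (rhom P X) (omap (components_ftor TYPE('m) TYPE('u)) X)"
    using left_adjoint_representation[OF assms] by metis
  \<comment> \<open>If P were empty, the empty function would map it to the empty M-set, whose set
    of components is empty, against the bijection.\<close>
  obtain p where p: "p \<in> rcarrier P"
  proof (cases "rcarrier P = {}")
    case True
    let ?X = "\<lparr>rcarrier = {}, ract = \<lambda>x m. x\<rparr> :: ('m, 'u) right_act"
    have "?X \<in> Obj PSets"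
      by (simp add: right_mset_def small_finite)
    then have "bij_betw (\<theta> ?X) (rhom P ?X) {}"
      using bij[of ?X] by (simp add: components_ftor_def components_def)
    moreover have "(\<lambda>_. undefined) \<in> rhom P ?X"
      using True by (auto simp: rhom_def)
    ultimately show ?thesis
      by (auto simp: bij_betw_def)
  qed blast
  obtain c where "components N = {c}"
  proof -
    obtain x where x: "x \<in> rcarrier N"
      using regular_copy(3) by (auto simp: connected_mset_def)
    have "c = conn N `` {x}" if "c \<in> components N" for c
    proof -
      from that obtain y where "y \<in> rcarrier N" "c = conn N `` {y}"
        by (rule classE)
      then show ?thesis
        using class_eq_iff[of y N x] x regular_copy(3) by (simp add: connected_mset_def)
    qed
    then have "components N = {conn N `` {x}}"
      using class_in_components[OF x] by blast
    then show ?thesis by (rule that)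
  qed
  then have N: "bij_betw (\<theta> N) (rhom P N) {c}"
    using bij[of N] regular_copy by (simp add: components_ftor_def)
  then obtain t where t: "t \<in> rhom P N"
    by (auto simp: bij_betw_def)
  have "left_mult n (t p) = t p" for n
  proof -
    have k: "compose (rcarrier P) (left_mult n) t \<in> rhom P N"
      using P t left_mult_rhom by (intro compose_rhom) simp_all
    have "compose (rcarrier P) (left_mult n) t = t"
      using N k t bij_betwE[OF N] by (intro inj_onD[OF bij_betw_imp_inj_on[OF N]]) auto
    then show ?thesis
      using p by (metis compose_eq)
  qed
  then show ?thesis
    using invariant_imp_absorbing[OF rhomD(3)[OF t p]] by blast
qed

end

section \<open>Points split off by idempotents, and terminal essential points\<close>

section \<open>Essential points\<close>

definition fixed :: "'m::monoid_mult \<Rightarrow> ('m, 'x) right_act \<Rightarrow> 'x set" where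
  "fixed e X = {x \<in> rcarrier X. ract X x e = x}"

text \<open>An idempotent \<open>e\<close> yields the essential point whose inverse image functor sends \<open>X\<close> to \<open>X e\<close>. Its
  value is encoded as a set of singletons because the category of sets has elements of type \<open>'u set\<close>.\<close>

definition splitting_ftor :: "'m::monoid_mult \<Rightarrow> ('m, 'u) psh_to_set" where
  "splitting_ftor e = \<lparr>omap = \<lambda>X. (\<lambda>x. {x}) ` fixed e X,
     amap = \<lambda>X Y f. \<lambda>A\<in>(\<lambda>x. {x}) ` fixed e X. f ` A\<rparr>"

text \<open>For idempotent e such an f is determined by its restriction to the left M-set M e, so
  this is the set of functions from M e to S. Since X e is the tensor product of X with M e, it is
  the value at S of the right adjoint.\<close>

definition coinduced_mset :: "'m::monoid_mult \<Rightarrow> 's set \<Rightarrow> ('m, 'm \<Rightarrow> 's) right_act" where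
  "coinduced_mset e S = \<lparr>rcarrier = {f. \<forall>n. f n \<in> S \<and> f (n * e) = f n}, ract = \<lambda>f m n. f (m * n)\<rparr>"

definition coinduced_ftor :: "'m::monoid_mult \<Rightarrow> ('m, 'u) set_to_psh" where
  "coinduced_ftor e = \<lparr>omap = \<lambda>S. copy_mset (coinduced_mset e S),
     amap = \<lambda>S T k. \<lambda>z\<in>rcarrier (copy_mset (coinduced_mset e S)).
       code (rcarrier (coinduced_mset e T)) (\<lambda>n. k (decode (rcarrier (coinduced_mset e S)) z n))\<rparr>"

lemma fixed_iff: "x \<in> fixed e X \<longleftrightarrow> x \<in> rcarrier X \<and> ract X x e = x"
  by (simp add: fixed_def)

lemma rhom_fixed: "f \<in> rhom X Y \<Longrightarrow> x \<in> fixed e X \<Longrightarrow> f x \<in> fixed e Y"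
  using rhomD(3,4)[of f X Y x] by (auto simp: fixed_iff) metis

lemma singleton_in_image [simp]: "{x} \<in> (\<lambda>x. {x}) ` A \<longleftrightarrow> x \<in> A"
  by auto

lemma splitting_ftor_simps [simp]:
  "omap (splitting_ftor e) X = (\<lambda>x. {x}) ` fixed e X"
  "x \<in> fixed e X \<Longrightarrow> amap (splitting_ftor e) X Y f {x} = {f x}"
  by (simp_all add: splitting_ftor_def)

lemma amap_splitting_extensional: "amap (splitting_ftor e) X Y f \<in> extensional ((\<lambda>x. {x}) ` fixed e X)"
  by (simp add: splitting_ftor_def)

lemma coinduced_mset_simps [simp]:
  "f \<in> rcarrier (coinduced_mset e S) \<longleftrightarrow> (\<forall>n. f n \<in> S \<and> f (n * e) = f n)"
  "ract (coinduced_mset e S) f m n = f (m * n)"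
  by (simp_all add: coinduced_mset_def)

lemma right_mset_coinduced: "right_mset (coinduced_mset e S)"
  unfolding right_mset_def by (auto simp: fun_eq_iff mult.assoc) (metis mult.assoc)

lemma is_ftor_splitting: "is_ftor (PSh M \<kappa>) (set_cat \<kappa>) (splitting_ftor e)"
  unfolding is_ftor_def
proof (intro conjI ballI)
  fix X assume "X \<in> Obj (PSh M \<kappa>)"
  then have "small \<kappa> (fixed e X)"
    by (auto simp: fixed_def intro: small_subset)
  then show "omap (splitting_ftor e) X \<in> Obj (set_cat \<kappa>)"
    by (simp add: small_image)
  have "amap (splitting_ftor e) X X (\<lambda>x\<in>rcarrier X. x) = (\<lambda>A\<in>omap (splitting_ftor e) X. A)"
    by (rule extensionalityI[OF amap_splitting_extensional]) (auto simp: fixed_iff)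
  then show "amap (splitting_ftor e) X X (Id (PSh M \<kappa>) X) = Id (set_cat \<kappa>) (omap (splitting_ftor e) X)"
    by simp
next
  fix X Y :: "('a, 'b) right_act" and f
  assume "f \<in> Hom (PSh M \<kappa>) X Y"
  then have "amap (splitting_ftor e) X Y f \<in> omap (splitting_ftor e) X \<rightarrow>\<^sub>E omap (splitting_ftor e) Y"
    using amap_splitting_extensional[of e X Y f] by (auto simp: PiE_iff rhom_fixed)
  then show "amap (splitting_ftor e) X Y f \<in>
      Hom (set_cat \<kappa>) (omap (splitting_ftor e) X) (omap (splitting_ftor e) Y)"
    by simp
next
  fix X Y Z :: "('a, 'b) right_act" and f g
  assume f: "f \<in> Hom (PSh M \<kappa>) X Y" and g: "g \<in> Hom (PSh M \<kappa>) Y Z"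
  have "amap (splitting_ftor e) X Z (compose (rcarrier X) g f) =
      compose (omap (splitting_ftor e) X) (amap (splitting_ftor e) Y Z g) (amap (splitting_ftor e) X Y f)"
  proof (rule extensionalityI[OF amap_splitting_extensional])
    fix A assume "A \<in> (\<lambda>x. {x}) ` fixed e X"
    then obtain x where x: "A = {x}" "x \<in> fixed e X"
      by blast
    have "f x \<in> fixed e Y"
      using f x(2) by (simp add: rhom_fixed)
    then show "amap (splitting_ftor e) X Z (compose (rcarrier X) g f) A =
      compose (omap (splitting_ftor e) X) (amap (splitting_ftor e) Y Z g) (amap (splitting_ftor e) X Y f) A"
      using x by (simp add: compose_eq fixed_iff)
  qed (simp add: compose_def)
  then show "amap (splitting_ftor e) X Z (Comp (PSh M \<kappa>) X Y Z g f) =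
    Comp (set_cat \<kappa>) (omap (splitting_ftor e) X) (omap (splitting_ftor e) Y) (omap (splitting_ftor e) Z)
      (amap (splitting_ftor e) Y Z g) (amap (splitting_ftor e) X Y f)"
    by simp
qed

lemma nat_trans_setD:
  assumes "\<alpha> \<in> nat_trans A (set_cat \<kappa>) F G"
  shows "\<alpha> \<in> extensional (Obj A)"
    and "X \<in> Obj A \<Longrightarrow> \<alpha> X \<in> omap F X \<rightarrow>\<^sub>E omap G X"
    and "X \<in> Obj A \<Longrightarrow> Y \<in> Obj A \<Longrightarrow> f \<in> Hom A X Y \<Longrightarrow> w \<in> omap F X \<Longrightarrow>
      \<alpha> Y (amap F X Y f w) = amap G X Y f (\<alpha> X w)"
proof -
  have \<alpha>: "\<alpha> \<in> (\<Pi>\<^sub>E X\<in>Obj A. omap F X \<rightarrow>\<^sub>E omap G X)"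
    and nat: "\<forall>X\<in>Obj A. \<forall>Y\<in>Obj A. \<forall>f\<in>Hom A X Y.
      compose (omap F X) (\<alpha> Y) (amap F X Y f) = compose (omap F X) (amap G X Y f) (\<alpha> X)"
    using assms by (simp_all add: nat_trans_def)
  show "\<alpha> \<in> extensional (Obj A)" "X \<in> Obj A \<Longrightarrow> \<alpha> X \<in> omap F X \<rightarrow>\<^sub>E omap G X"
    using \<alpha> unfolding PiE_iff by simp_all
  show "\<alpha> Y (amap F X Y f w) = amap G X Y f (\<alpha> X w)"
    if "X \<in> Obj A" "Y \<in> Obj A" "f \<in> Hom A X Y" "w \<in> omap F X"
  proof -
    have "compose (omap F X) (\<alpha> Y) (amap F X Y f) = compose (omap F X) (amap G X Y f) (\<alpha> X)"
      using nat that(1-3) by blast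
    from fun_cong[OF this, of w] show ?thesis
      using that(4) by (simp add: compose_eq)
  qed
qed

lemma nat_trans_setI:
  assumes "\<alpha> \<in> extensional (Obj A)"
    and "\<And>X. X \<in> Obj A \<Longrightarrow> \<alpha> X \<in> omap F X \<rightarrow>\<^sub>E omap G X"
    and "\<And>X Y f w. X \<in> Obj A \<Longrightarrow> Y \<in> Obj A \<Longrightarrow> f \<in> Hom A X Y \<Longrightarrow> w \<in> omap F X \<Longrightarrow>
      \<alpha> Y (amap F X Y f w) = amap G X Y f (\<alpha> X w)"
  shows "\<alpha> \<in> nat_trans A (set_cat \<kappa>) F G"
  unfolding nat_trans_def
proof (intro CollectI conjI ballI)
  show "\<alpha> \<in> (\<Pi>\<^sub>E X\<in>Obj A. Hom (set_cat \<kappa>) (omap F X) (omap G X))"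
    unfolding PiE_iff[of \<alpha>] using assms(1,2) by simp
  show "Comp (set_cat \<kappa>) (omap F X) (omap F Y) (omap G Y) (\<alpha> Y) (amap F X Y f) =
      Comp (set_cat \<kappa>) (omap F X) (omap G X) (omap G Y) (amap G X Y f) (\<alpha> X)"
    if "X \<in> Obj A" "Y \<in> Obj A" "f \<in> Hom A X Y" for X Y f
    using assms(3)[OF that] by (auto simp: compose_def intro: restrict_ext)
qed

context universe
begin

lemma splitting_left_adjoint:
  assumes e: "e * e = (e::'m)"
  shows "adjoint Sets PSets (copower_ftor (principal_ideal e)) (splitting_ftor e)"
proof (rule copower_adjoint[where \<psi> = "\<lambda>X f. {f e}"])
  show "right_mset (principal_ideal e)" "small \<kappa> (rcarrier (principal_ideal e))"
    by (rule right_mset_principal, rule small_monoid)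
  show "is_ftor PSets Sets (splitting_ftor e)"
    by (rule is_ftor_splitting)
  show "bij_betw (\<lambda>f. {f e}) (rhom (principal_ideal e) X) (omap (splitting_ftor e) X)" if "X \<in> Obj PSets" for X
  proof -
    have X: "right_mset X"
      using that by simp
    have e_in: "e \<in> range ((*) e)"
      using e by (metis rangeI)
    show ?thesis
    proof (rule bij_betw_byWitness[where f' = "\<lambda>A. \<lambda>q\<in>range ((*) e). ract X (the_elem A) q"])
      show "\<forall>f\<in>rhom (principal_ideal e) X. (\<lambda>q\<in>range ((*) e). ract X (the_elem {f e}) q) = f"
      proof
        fix f assume f: "f \<in> rhom (principal_ideal e) X"
        show "(\<lambda>q\<in>range ((*) e). ract X (the_elem {f e}) q) = f"
        proof (rule extensionalityI[of _ "range ((*) e)"])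
          fix q assume q: "q \<in> range ((*) e)"
          then have "e * q = q"
            using e by (simp add: principal_mem)
          then show "(\<lambda>q\<in>range ((*) e). ract X (the_elem {f e}) q) q = f q"
            using q rhom_principal(3)[OF e f] by simp
        qed (use rhomD(2)[OF f] in simp_all)
      qed
      show "\<forall>A\<in>omap (splitting_ftor e) X. {(\<lambda>q\<in>range ((*) e). ract X (the_elem A) q) e} = A"
        using e_in by (auto simp: fixed_iff)
      show "(\<lambda>f. {f e}) ` rhom (principal_ideal e) X \<subseteq> omap (splitting_ftor e) X"
        using rhom_principal(1,2)[OF e] by (auto simp: fixed_iff)
      show "(\<lambda>A. \<lambda>q\<in>range ((*) e). ract X (the_elem A) q) ` omap (splitting_ftor e) X \<subseteq> rhom (principal_ideal e) X"
        using principal_rhom[OF X] by (auto simp: fixed_iff)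
    qed
  qed
  show "{compose (rcarrier (principal_ideal e)) k f e} = amap (splitting_ftor e) X Y k {f e}"
    if "f \<in> rhom (principal_ideal e) X" for X Y f k
    using rhom_principal(1,2)[OF e that] e by (simp add: compose_eq fixed_iff principal_mem)
qed

lemma small_coinduced:
  assumes "small \<kappa> S"
  shows "small \<kappa> (rcarrier (coinduced_mset (e::'m) S))"
  by (rule small_subset[OF small_functions[OF assms]]) (auto simp: PiE_UNIV_domain)

text \<open>A function f on the fixed points of e transposes to the homomorphism that sends x to n
  -> f (x n e); the counit evaluates at 1.\<close>

lemma splitting_right_adjoint:
  assumes e: "e * e = (e::'m)"
  shows "adjoint PSets Sets (splitting_ftor e) (coinduced_ftor e)"
proof -
  let ?F = "splitting_ftor e :: ('m, 'u) psh_to_set" and ?R = "coinduced_ftor e :: ('m, 'u) set_to_psh"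
  let ?K = "\<lambda>S :: 'u set set. rcarrier (coinduced_mset e S)"
  define d where "d S = (decode (?K S) :: 'u \<Rightarrow> 'm \<Rightarrow> 'u set)" for S
  \<comment> \<open>Evaluation at the unit, with \<open>the_elem\<close> undoing the encoding by
    singletons.\<close>
  define \<epsilon> where "\<epsilon> S = (\<lambda>A\<in>omap ?F (omap ?R S). d S (the_elem A) 1)" for S
  have co: "right_mset (coinduced_mset e S)" "small \<kappa> S \<Longrightarrow> small \<kappa> (?K S)" for S :: "'u set set"
    by (rule right_mset_coinduced, rule small_coinduced)
  have omap_R: "omap ?R S = copy_mset (coinduced_mset e S)" for S
    by (simp add: coinduced_ftor_def)
  have d_in: "d S z \<in> ?K S" and code_d: "code (?K S) (d S z) = z"
    and d_ract: "d S (ract (omap ?R S) z m) n = d S z (m * n)"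
    if "small \<kappa> S" "z \<in> rcarrier (omap ?R S)" for S z m n
    using that co[of S]
    by (simp_all add: omap_R d_def del: coinduced_mset_simps(1))
  have d_code: "d S (code (?K S) f) = f" and code_in: "code (?K S) f \<in> rcarrier (omap ?R S)"
    if "small \<kappa> S" "f \<in> ?K S" for S f
    using that co[of S] by (simp_all add: omap_R d_def del: coinduced_mset_simps(1))
  have R: "right_mset (omap ?R S)" "small \<kappa> (rcarrier (omap ?R S))" if "small \<kappa> S" for S
    using that co by (simp_all add: omap_R)
  have amap_R: "amap ?R S T k z = code (?K T) (\<lambda>n. k (d S z n))" if "z \<in> rcarrier (omap ?R S)" for S T k z
    using that by (simp add: coinduced_ftor_def d_def)
  have k_in: "(\<lambda>n. k (d S z n)) \<in> ?K T"
    if "small \<kappa> S" "k \<in> S \<rightarrow>\<^sub>E T" "z \<in> rcarrier (omap ?R S)" for S T k z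
    using that d_in[OF that(1,3)] by auto
  have amap_R_rhom: "amap ?R S T k \<in> rhom (omap ?R S) (omap ?R T)"
    if S: "small \<kappa> S" and T: "small \<kappa> T" and k: "k \<in> S \<rightarrow>\<^sub>E T" for S T k
  proof (rule rhomI)
    fix z m assume z: "z \<in> rcarrier (omap ?R S)"
    show "amap ?R S T k z \<in> rcarrier (omap ?R T)"
      using code_in[OF T k_in[OF S k z]] z by (simp add: amap_R)
    have z': "ract (omap ?R S) z m \<in> rcarrier (omap ?R S)"
      using R(1)[OF S] z by (rule right_msetD)
    have "amap ?R S T k (ract (omap ?R S) z m) = code (?K T) (\<lambda>n. k (d S z (m * n)))"
      using z z' S by (simp add: amap_R d_ract)
    also have "\<dots> = ract (omap ?R T) (code (?K T) (\<lambda>n. k (d S z n))) m"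
      using ract_code[OF co(1) co(2)[OF T] k_in[OF S k z], of m]
      by (simp add: omap_R) (simp add: coinduced_mset_def)
    finally show "amap ?R S T k (ract (omap ?R S) z m) = ract (omap ?R T) (amap ?R S T k z) m"
      using z by (simp add: amap_R)
  qed (simp add: coinduced_ftor_def)
  have \<epsilon>_app: "\<epsilon> S {z} = d S z 1" if "z \<in> fixed e (omap ?R S)" for S z
    using that by (simp add: \<epsilon>_def)
  show ?thesis
  proof (rule right_adjoint_from_counit[where \<epsilon> = \<epsilon>, OF category_PSh category_set_cat is_ftor_splitting])
    fix S assume "S \<in> Obj Sets"
    then have S: "small \<kappa> S" by simp
    then show "omap ?R S \<in> Obj PSets"
      using R by simp
    show "\<epsilon> S \<in> Hom Sets (omap ?F (omap ?R S)) S"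
      using d_in[OF S] by (auto simp: \<epsilon>_def fixed_iff)
    {
      fix T k assume "T \<in> Obj Sets" "k \<in> Hom Sets S T"
      then have T: "small \<kappa> T" and k: "k \<in> S \<rightarrow>\<^sub>E T" by simp_all
      note Rk = amap_R_rhom[OF S T k]
      then show "amap ?R S T k \<in> Hom PSets (omap ?R S) (omap ?R T)"
        by simp
      have "compose (omap ?F (omap ?R S)) (\<epsilon> T) (amap ?F (omap ?R S) (omap ?R T) (amap ?R S T k))
        = compose (omap ?F (omap ?R S)) k (\<epsilon> S)"
      proof (rule extensionalityI[of _ "omap ?F (omap ?R S)"])
        fix A assume "A \<in> omap ?F (omap ?R S)"
        then obtain z where z: "A = {z}" "z \<in> fixed e (omap ?R S)"
          by auto
        then have "d T (amap ?R S T k z) 1 = k (d S z 1)"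
          using d_code[OF T k_in[OF S k]] by (simp add: amap_R fixed_iff)
        then show "compose (omap ?F (omap ?R S)) (\<epsilon> T) (amap ?F (omap ?R S) (omap ?R T) (amap ?R S T k)) A
          = compose (omap ?F (omap ?R S)) k (\<epsilon> S) A"
          using z rhom_fixed[OF Rk z(2)] by (simp add: compose_eq \<epsilon>_app)
      qed (simp_all add: compose_def)
      then show "Comp Sets (omap ?F (omap ?R S)) (omap ?F (omap ?R T)) T (\<epsilon> T)
          (amap ?F (omap ?R S) (omap ?R T) (amap ?R S T k))
        = Comp Sets (omap ?F (omap ?R S)) S T k (\<epsilon> S)"
        by simp
    }
    fix X f assume "X \<in> Obj PSets" and "f \<in> Hom Sets (omap ?F X) S"
    then have X: "right_mset X" and f: "f \<in> (\<lambda>x. {x}) ` fixed e X \<rightarrow>\<^sub>E S" by simp_all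
    have fixed_act: "ract X x (n * e) \<in> fixed e X" if "x \<in> rcarrier X" for x n
      using X that e by (simp add: fixed_iff right_msetD mult.assoc)
    have comp_iff: "compose (omap ?F X) (\<epsilon> S) (amap ?F X (omap ?R S) g) = f \<longleftrightarrow>
        (\<forall>x\<in>fixed e X. d S (g x) 1 = f {x})" if g: "g \<in> rhom X (omap ?R S)" for g
    proof -
      have "compose (omap ?F X) (\<epsilon> S) (amap ?F X (omap ?R S) g) = f \<longleftrightarrow>
        (\<forall>A\<in>omap ?F X. \<epsilon> S (amap ?F X (omap ?R S) g A) = f A)"
        using f by (intro compose_eq_iff) (simp add: PiE_def)
      also have "\<dots> \<longleftrightarrow> (\<forall>x\<in>fixed e X. d S (g x) 1 = f {x})"
        using \<epsilon>_app[OF rhom_fixed[OF g]] by simp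
      finally show ?thesis .
    qed
    define h where "h x = (\<lambda>n. f {ract X x (n * e)})" for x
    have h: "h x \<in> ?K S" if "x \<in> rcarrier X" for x
      using f fixed_act[OF that] e by (auto simp: h_def mult.assoc)
    define g where "g = (\<lambda>x\<in>rcarrier X. code (?K S) (h x) :: 'u)"
    have g: "g \<in> rhom X (omap ?R S)"
      unfolding g_def
    proof (rule restrict_rhomI[OF X])
      fix x m assume x: "x \<in> rcarrier X"
      show "code (?K S) (h x) \<in> rcarrier (omap ?R S)"
        using S h[OF x] by (rule code_in)
      have "h (ract X x m) = ract (coinduced_mset e S) (h x) m"
        using X x by (simp add: h_def fun_eq_iff right_msetD mult.assoc)
      then show "code (?K S) (h (ract X x m)) = ract (omap ?R S) (code (?K S) (h x)) m"
        using ract_code[OF co(1) co(2)[OF S] h[OF x], of m] by (simp add: omap_R)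
    qed
    have "d S (g x) 1 = f {x}" if "x \<in> fixed e X" for x
      using that d_code[OF S h] by (simp add: g_def h_def fixed_iff)
    then have comp_g: "compose (omap ?F X) (\<epsilon> S) (amap ?F X (omap ?R S) g) = f"
      using comp_iff[OF g] by simp
    have uniq: "g' = g"
      if g': "g' \<in> rhom X (omap ?R S)" and eq: "compose (omap ?F X) (\<epsilon> S) (amap ?F X (omap ?R S) g') = f" for g'
    proof (rule extensionalityI[of _ "rcarrier X"])
      fix x assume x: "x \<in> rcarrier X"
      note g'x = rhomD(3)[OF g' x]
      \<comment> \<open>Invariance replaces n by n e, and equivariance moves n e into the argument,
        where x n e is fixed by e and the counit condition applies.\<close>
      have "d S (g' x) n = h x n" for n
      proof -
        have "d S (g' x) n = d S (g' x) (n * e)"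
          using d_in[OF S g'x] by simp
        also have "\<dots> = d S (g' (ract X x (n * e))) 1"
          using rhomD(4)[OF g' x] d_ract[OF S g'x] by simp
        also have "\<dots> = h x n"
          using comp_iff[OF g'] eq fixed_act[OF x] by (simp add: h_def)
        finally show ?thesis .
      qed
      then have "d S (g' x) = h x" ..
      then show "g' x = g x"
        using code_d[OF S g'x] x by (simp add: g_def)
    qed (use rhomD(2)[OF g'] rhomD(2)[OF g] in simp_all)
    have "\<exists>!g. g \<in> rhom X (omap ?R S) \<and> compose (omap ?F X) (\<epsilon> S) (amap ?F X (omap ?R S) g) = f"
    proof (rule ex1I[of _ g], rule conjI)
      fix g' assume "g' \<in> rhom X (omap ?R S) \<and> compose (omap ?F X) (\<epsilon> S) (amap ?F X (omap ?R S) g') = f"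
      then show "g' = g"
        by (intro uniq) (erule conjunct1, erule conjunct2)
    qed (rule g, rule comp_g)
    then show "\<exists>!g. g \<in> Hom PSets X (omap ?R S) \<and>
        Comp Sets (omap ?F X) (omap ?F (omap ?R S)) S (\<epsilon> S) (amap ?F X (omap ?R S) g) = f"
      by simp
  qed
qed

lemma Obj_essential_points: "p \<in> Obj (essential_points TYPE('m) \<kappa>) \<longleftrightarrow>
    adjoint PSets Sets (fst p) (snd p) \<and> preserves_finite_limits PSets Sets (fst p) \<and>
    (\<exists>E. adjoint Sets PSets E (fst p))"
  by (auto simp: essential_points_def full_subcategory_def points_def essential_point_def)

lemma Hom_essential_points:
  "Hom (essential_points TYPE('m) \<kappa>) p q = nat_trans PSets Sets (fst p) (fst q)"
  by (simp add: essential_points_def full_subcategory_def points_def)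

text \<open>Having a left adjoint as well, X -> X e preserves limits, in particular the finite ones
  required of an inverse image functor.\<close>

lemma splitting_essential_point:
  assumes "e * e = (e::'m)"
  shows "(splitting_ftor e, coinduced_ftor e) \<in> Obj (essential_points TYPE('m) \<kappa>)"
  using splitting_left_adjoint[OF assms] splitting_right_adjoint[OF assms]
    right_adjoint_preserves_limits[OF splitting_left_adjoint[OF assms] category_set_cat category_PSh]
  unfolding Obj_essential_points preserves_finite_limits_def by auto

text \<open>A left adjoint sends a covering family to a jointly surjective one. If z were missed,
  the characteristic function of z and the constant function would agree on the image of every
  piece; their transposes would then agree on a cover of X, hence everywhere, and so would the two
  functions.\<close>

lemma left_adjoint_covers:
  assumes adj: "adjoint PSets Sets F G" and X: "X \<in> Obj PSets"
    and sub: "\<And>K. K \<in> \<K> \<Longrightarrow> sub_mset X K" and cover: "rcarrier X \<subseteq> \<Union>\<K>"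
    and z: "z \<in> omap F X"
  obtains K where "K \<in> \<K>" "z \<in> amap F (restrict_mset X K) X (\<lambda>x\<in>K. x) ` omap F (restrict_mset X K)"
proof (rule ccontr)
  assume "\<not> thesis"
  then have no: "z \<notin> amap F (restrict_mset X K) X (\<lambda>x\<in>K. x) ` omap F (restrict_mset X K)" if "K \<in> \<K>" for K
    using that \<open>\<And>K. K \<in> \<K> \<Longrightarrow> z \<in> _ K \<Longrightarrow> thesis\<close> by blast
  have F: "is_ftor PSets Sets F"
    using adj by (simp add: adjoint_def)
  obtain \<phi> where
    bij: "\<And>a b. a \<in> Obj PSets \<Longrightarrow> b \<in> Obj Sets \<Longrightarrow> bij_betw (\<phi> a b) (Hom Sets (omap F a) b) (Hom PSets a (omap G b))"
    and nat: "\<And>a a' b f h. a \<in> Obj PSets \<Longrightarrow> a' \<in> Obj PSets \<Longrightarrow> b \<in> Obj Sets \<Longrightarrow>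
      h \<in> Hom PSets a' a \<Longrightarrow> f \<in> Hom Sets (omap F a) b \<Longrightarrow>
      \<phi> a' b (Comp Sets (omap F a') (omap F a) b f (amap F a' a h)) =
      Comp PSets a' a (omap G b) (\<phi> a b f) h"
    using adjointE[OF adj category_PSh category_set_cat] by metis
  \<comment> \<open>A two-element set of truth values: \<open>{undefined}\<close> is non-empty and
    so differs from \<open>{}\<close>.\<close>
  let ?S = "{{}, {undefined}} :: 'u set set"
  define u where "u = (\<lambda>w\<in>omap F X. {} :: 'u set)"
  define v where "v = (\<lambda>w\<in>omap F X. if w = z then {undefined} else {} :: 'u set)"
  have S: "?S \<in> Obj Sets"
    by (simp add: small_finite)
  have u: "u \<in> Hom Sets (omap F X) ?S" and v: "v \<in> Hom Sets (omap F X) ?S"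
    by (auto simp: u_def v_def)
  have \<phi>: "\<phi> X ?S u \<in> rhom X (omap G ?S)" "\<phi> X ?S v \<in> rhom X (omap G ?S)"
    using bij_betwE[OF bij[OF X S]] u v by simp_all
  have "\<phi> X ?S u = \<phi> X ?S v"
  proof (rule extensionalityI[of _ "rcarrier X"])
    fix x assume "x \<in> rcarrier X"
    then obtain K where K: "K \<in> \<K>" "x \<in> K"
      using cover by blast
    let ?K = "restrict_mset X K" and ?i = "\<lambda>x\<in>K. x"
    have K_sub: "K \<subseteq> rcarrier X"
      using sub[OF K(1)] by (simp add: sub_mset_def)
    then have KO: "?K \<in> Obj PSets"
      using X right_mset_restrict[OF _ sub[OF K(1)]] by (auto intro: small_subset)
    have i: "?i \<in> Hom PSets ?K X"
      using KO K_sub restrict_rhomI[of ?K "\<lambda>x. x" X] by auto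
    have Fi: "amap F ?K X ?i \<in> omap F ?K \<rightarrow>\<^sub>E omap F X"
      using is_ftorD(2)[OF F KO X i] by simp
    have "compose (omap F ?K) u (amap F ?K X ?i) = compose (omap F ?K) v (amap F ?K X ?i)"
      using no[OF K(1)] Fi by (auto simp: compose_def u_def v_def fun_eq_iff)
    then have "compose K (\<phi> X ?S u) ?i = compose K (\<phi> X ?S v) ?i"
      using nat[OF X KO S i u] nat[OF X KO S i v] by simp
    from fun_cong[OF this, of x] show "\<phi> X ?S u x = \<phi> X ?S v x"
      using K(2) by (simp add: compose_eq)
  qed (use rhomD(2)[OF \<phi>(1)] rhomD(2)[OF \<phi>(2)] in simp_all)
  then have "u = v"
    using inj_onD[OF bij_betw_imp_inj_on[OF bij[OF X S]] _ u v] by simp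
  then have "u z = v z"
    by simp
  then show False
    using z by (simp add: u_def v_def)
qed

text \<open>The representing object \<open>P\<close> is connected: the identity of \<open>P\<close>, an element of the value of the
  inverse image functor at \<open>P\<close>, comes from one of the components of \<open>P\<close>.\<close>

lemma essential_point_representation:
  assumes p: "p \<in> Obj (essential_points TYPE('m) \<kappa>)"
  obtains P \<theta> where "P \<in> Obj PSets" "connected_mset P"
    "\<And>X. X \<in> Obj PSets \<Longrightarrow> bij_betw (\<theta> X) (rhom P X) (omap (fst p) X)"
    "\<And>X Y f k. X \<in> Obj PSets \<Longrightarrow> Y \<in> Obj PSets \<Longrightarrow> f \<in> rhom P X \<Longrightarrow> k \<in> rhom X Y \<Longrightarrow>
      \<theta> Y (compose (rcarrier P) k f) = amap (fst p) X Y k (\<theta> X f)"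
proof -
  obtain E where adj: "adjoint PSets Sets (fst p) (snd p)" and E: "adjoint Sets PSets E (fst p)"
    using p unfolding Obj_essential_points by blast
  obtain P \<theta> where P: "P \<in> Obj PSets"
    and bij: "\<And>X. X \<in> Obj PSets \<Longrightarrow> bij_betw (\<theta> X) (rhom P X) (omap (fst p) X)"
    and nat: "\<And>X Y f k. X \<in> Obj PSets \<Longrightarrow> Y \<in> Obj PSets \<Longrightarrow> f \<in> rhom P X \<Longrightarrow> k \<in> rhom X Y \<Longrightarrow>
      \<theta> Y (compose (rcarrier P) k f) = amap (fst p) X Y k (\<theta> X f)"
    using left_adjoint_representation[OF E] by metis
  have P': "right_mset P" "small \<kappa> (rcarrier P)"
    using P by simp_all
  let ?id = "\<lambda>x\<in>rcarrier P. x"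
  have id: "?id \<in> rhom P P"
    using P'(1) by (intro restrict_rhomI) (simp_all add: right_msetD)
  have sub: "sub_mset P K" if "K \<in> components P" for K
    using that sub_mset_component[OF P'(1)] by (auto elim!: classE)
  have cover: "rcarrier P \<subseteq> \<Union>(components P)"
    using class_in_components equiv_class_self[OF equiv_conn] by fast
  have "\<theta> P ?id \<in> omap (fst p) P"
    using bij_betwE[OF bij[OF P]] id by blast
  then obtain K where K: "K \<in> components P"
    and "\<theta> P ?id \<in> amap (fst p) (restrict_mset P K) P (\<lambda>x\<in>K. x) ` omap (fst p) (restrict_mset P K)"
    using left_adjoint_covers[OF adj P sub cover] by blast
  then obtain w where w: "w \<in> omap (fst p) (restrict_mset P K)"
    "\<theta> P ?id = amap (fst p) (restrict_mset P K) P (\<lambda>x\<in>K. x) w"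
    by blast
  let ?K = "restrict_mset P K" and ?i = "\<lambda>x\<in>K. x"
  have K_sub: "K \<subseteq> rcarrier P"
    using sub[OF K] by (simp add: sub_mset_def)
  then have KO: "?K \<in> Obj PSets"
    using P' right_mset_restrict[OF _ sub[OF K]] by (auto intro: small_subset)
  have i: "?i \<in> rhom ?K P"
    using KO K_sub restrict_rhomI[of ?K "\<lambda>x. x" P] by auto
  obtain g where g: "g \<in> rhom P ?K" "w = \<theta> ?K g"
    using w(1) bij_betw_imp_surj_on[OF bij[OF KO]] by blast
  have "\<theta> P ?id = \<theta> P (compose (rcarrier P) ?i g)"
    using nat[OF KO P g(1) i] w(2) g(2) by simp
  \<comment> \<open>The identity of P factors through the inclusion of the component K, so K is all
    of P.\<close>
  then have eq: "?id = compose (rcarrier P) ?i g"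
    by (rule inj_onD[OF bij_betw_imp_inj_on[OF bij[OF P]] _ id compose_rhom[OF P'(1) g(1) i]])
  have "x \<in> K" if "x \<in> rcarrier P" for x
    using fun_cong[OF eq, of x] that rhomD(3)[OF g(1) that] by (simp add: compose_eq)
  then have "rcarrier P = K"
    using K_sub by blast
  moreover obtain x where x: "x \<in> rcarrier P" "K = conn P `` {x}"
    using K by (rule classE)
  ultimately have "(x, y) \<in> conn P" if "y \<in> rcarrier P" for y
    using that by blast
  then have "conn P `` {y} = conn P `` {x}" if "y \<in> rcarrier P" for y
    using that x(1) class_eq_iff[of x P y] by simp
  then have "(y, z) \<in> conn P" if "y \<in> rcarrier P" "z \<in> rcarrier P" for y z
    using that class_eq_iff[of y P z] by simp
  then have "connected_mset P"
    using x(1) by (auto simp: connected_mset_def)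
  then show thesis
    using that P bij nat by blast
qed

text \<open>The idempotent 1 gives the underlying set functor, of which x -> x m is a natural
  endomorphism. Uniqueness of the transformation \<tau> into the terminal point yields \<tau> (x m)
  = \<tau> x. At the generator of \<open>N\<close>, acting by n and applying
  \<open>left_mult n\<close> have the same result, so this invariance becomes invariance of the
  representing map t under left multiplication.\<close>

lemma terminal_imp_absorbing:
  assumes "has_terminal (essential_points TYPE('m) \<kappa>)"
  shows "\<exists>l::'m. left_absorbing l"
proof -
  obtain p where p: "p \<in> Obj (essential_points TYPE('m) \<kappa>)"
    and final: "\<And>q. q \<in> Obj (essential_points TYPE('m) \<kappa>) \<Longrightarrow>
      \<exists>!f. f \<in> Hom (essential_points TYPE('m) \<kappa>) q p"
    using assms unfolding has_terminal_def by blast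
  let ?U = "splitting_ftor (1::'m) :: ('m, 'u) psh_to_set"
  have ex1: "\<exists>!\<alpha>. \<alpha> \<in> nat_trans PSets Sets ?U (fst p)"
    using final[OF splitting_essential_point[of 1]] by (simp add: Hom_essential_points)
  then obtain \<tau> where \<tau>: "\<tau> \<in> nat_trans PSets Sets ?U (fst p)"
    by blast
  note \<tau>_in = nat_trans_setD(2)[OF \<tau>]
  have \<tau>_nat: "\<tau> Y {f x} = amap (fst p) X Y f (\<tau> X {x})"
    if "X \<in> Obj PSets" "Y \<in> Obj PSets" "f \<in> rhom X Y" "x \<in> rcarrier X" for X Y f x
    using that nat_trans_setD(3)[OF \<tau> that(1,2), of f "{x}"] by (simp add: fixed_iff right_msetD)
  have \<tau>_inv: "\<tau> X {ract X x m} = \<tau> X {x}" if X: "X \<in> Obj PSets" and x: "x \<in> rcarrier X" for X x m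
  proof -
    \<comment> \<open>\<tau> after right translation by m; natural because homomorphisms commute
      with the action.\<close>
    define \<sigma> where "\<sigma> = (\<lambda>X\<in>Obj PSets. \<lambda>A\<in>omap ?U X. \<tau> X {ract X (the_elem A) m})"
    have "\<sigma> \<in> nat_trans PSets Sets ?U (fst p)"
    proof (rule nat_trans_setI)
      show "\<sigma> X \<in> omap ?U X \<rightarrow>\<^sub>E omap (fst p) X" if "X \<in> Obj PSets" for X
        using that PiE_mem[OF \<tau>_in[OF that]] by (auto simp: \<sigma>_def fixed_iff right_msetD)
      fix X Y f A assume X: "X \<in> Obj PSets" and Y: "Y \<in> Obj PSets" and "f \<in> Hom PSets X Y" and "A \<in> omap ?U X"
      then obtain x where f: "f \<in> rhom X Y" and x: "A = {x}" "x \<in> fixed 1 X" "x \<in> rcarrier X"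
        by (auto simp: fixed_iff)
      then show "\<sigma> Y (amap ?U X Y f A) = amap (fst p) X Y f (\<sigma> X A)"
        using X Y rhom_fixed[OF f x(2)] \<tau>_nat[OF X Y f, of "ract X x m"] rhomD(4)[OF f x(3), of m]
        by (simp add: \<sigma>_def right_msetD)
    qed (simp add: \<sigma>_def)
    then have "\<sigma> = \<tau>"
      using ex1 \<tau> by blast
    then have "\<sigma> X {x} = \<tau> X {x}"
      by simp
    then show ?thesis
      using X x by (simp add: \<sigma>_def fixed_iff right_msetD)
  qed
  obtain P \<theta> where P: "P \<in> Obj PSets" "connected_mset P"
    and bij: "\<And>X. X \<in> Obj PSets \<Longrightarrow> bij_betw (\<theta> X) (rhom P X) (omap (fst p) X)"
    and nat: "\<And>X Y f k. X \<in> Obj PSets \<Longrightarrow> Y \<in> Obj PSets \<Longrightarrow> f \<in> rhom P X \<Longrightarrow> k \<in> rhom X Y \<Longrightarrow>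
      \<theta> Y (compose (rcarrier P) k f) = amap (fst p) X Y k (\<theta> X f)"
    using essential_point_representation[OF p] by metis
  have N: "N \<in> Obj PSets"
    using regular_copy by simp
  let ?c = "code (UNIV :: 'm set) :: 'm \<Rightarrow> 'u"
  have c: "?c n \<in> rcarrier N" and c_act: "ract N (?c 1) n = ?c n"
    and c_mult: "left_mult n (?c 1) = ?c n" for n
    using code_in_copy[OF right_mset_regular small_regular] ract_code[OF right_mset_regular small_regular, of 1 n]
      decode_code[OF small_UNIV_monoid]
    by (simp_all add: left_mult_def)
  have "\<tau> N {?c 1} \<in> omap (fst p) N"
    using PiE_mem[OF \<tau>_in[OF N], of "{?c 1}"] c[of 1] regular_copy(1) by (simp add: fixed_iff right_msetD)
  then obtain t where t: "t \<in> rhom P N" "\<tau> N {?c 1} = \<theta> N t"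
    using bij_betw_imp_surj_on[OF bij[OF N]] by blast
  obtain x where x: "x \<in> rcarrier P"
    using P(2) by (auto simp: connected_mset_def)
  have "left_mult n (t x) = t x" for n
  proof -
    have "\<theta> N (compose (rcarrier P) (left_mult n) t) = \<tau> N {?c n}"
      using nat[OF N N t(1) left_mult_rhom] \<tau>_nat[OF N N left_mult_rhom c] t(2) c_mult by metis
    also have "\<dots> = \<theta> N t"
      using \<tau>_inv[OF N c[of 1], of n] t(2) c_act by simp
    finally have "compose (rcarrier P) (left_mult n) t = t"
      using P(1) compose_rhom[OF _ t(1) left_mult_rhom] t(1)
      by (intro inj_onD[OF bij_betw_imp_inj_on[OF bij[OF N]]]) simp_all
    from fun_cong[OF this, of x] show ?thesis
      using x by (simp add: compose_eq)
  qed
  then show ?thesis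
    using invariant_imp_absorbing[OF rhomD(3)[OF t(1) x]] by blast
qed

text \<open>By Yoneda, transformations from the functor represented by P to X -> X l are the
  elements of P fixed by l. A connected P has exactly one, x l for any point x.\<close>

lemma absorbing_imp_terminal:
  assumes l: "left_absorbing (l::'m)"
  shows "has_terminal (essential_points TYPE('m) \<kappa>)"
proof -
  have ll: "l * l = l"
    using l by (simp add: left_absorbing_def)
  let ?F = "splitting_ftor l :: ('m, 'u) psh_to_set"
  have "\<exists>!\<alpha>. \<alpha> \<in> nat_trans PSets Sets (fst p) ?F" if p: "p \<in> Obj (essential_points TYPE('m) \<kappa>)" for p
  proof -
    obtain P \<theta> where P: "P \<in> Obj PSets" "connected_mset P"
      and bij: "\<And>X. X \<in> Obj PSets \<Longrightarrow> bij_betw (\<theta> X) (rhom P X) (omap (fst p) X)"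
      and nat: "\<And>X Y f k. X \<in> Obj PSets \<Longrightarrow> Y \<in> Obj PSets \<Longrightarrow> f \<in> rhom P X \<Longrightarrow> k \<in> rhom X Y \<Longrightarrow>
        \<theta> Y (compose (rcarrier P) k f) = amap (fst p) X Y k (\<theta> X f)"
      using essential_point_representation[OF p] by metis
    have P': "right_mset P"
      using P(1) by simp
    obtain x where x: "x \<in> rcarrier P"
      using P(2) by (auto simp: connected_mset_def)
    define e where "e = ract P x l"
    have e: "e \<in> fixed l P"
      using P' x ll by (simp add: e_def fixed_iff right_msetD)
    have e_unique: "y = e" if "y \<in> fixed l P" for y
      using that conn_iff_absorbing[OF l P', of y x] P(2) x by (simp add: e_def fixed_iff connected_mset_def)
    \<comment> \<open>The inverse of \<theta> recovers the homomorphism from P that an element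
      \<open>w\<close> represents, and \<alpha> evaluates it at the fixed point
      \<open>e\<close>.\<close>
    define \<alpha> where "\<alpha> = (\<lambda>X\<in>Obj PSets. \<lambda>w\<in>omap (fst p) X. {inv_into (rhom P X) (\<theta> X) w e})"
    have \<alpha>_app: "\<alpha> X (\<theta> X f) = {f e}" if "X \<in> Obj PSets" "f \<in> rhom P X" for X f
      using that bij_betwE[OF bij[OF that(1)]] bij_betw_imp_inj_on[OF bij[OF that(1)]]
      by (simp add: \<alpha>_def)
    have \<theta>_surj: "\<exists>f\<in>rhom P X. w = \<theta> X f" if "X \<in> Obj PSets" "w \<in> omap (fst p) X" for X w
      using that bij_betw_imp_surj_on[OF bij[OF that(1)]] by blast
    have "\<alpha> \<in> nat_trans PSets Sets (fst p) ?F"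
    proof (rule nat_trans_setI)
      show "\<alpha> X \<in> omap (fst p) X \<rightarrow>\<^sub>E omap ?F X" if X: "X \<in> Obj PSets" for X
      proof (rule PiE_I)
        fix w assume "w \<in> omap (fst p) X"
        then obtain f where "f \<in> rhom P X" "w = \<theta> X f"
          using \<theta>_surj[OF X] by blast
        then show "\<alpha> X w \<in> omap ?F X"
          using \<alpha>_app[OF X] rhom_fixed[OF _ e] by simp
      qed (use X in \<open>simp add: \<alpha>_def\<close>)
      fix X Y k w assume X: "X \<in> Obj PSets" and Y: "Y \<in> Obj PSets" and "k \<in> Hom PSets X Y"
        and "w \<in> omap (fst p) X"
      then obtain f where k: "k \<in> rhom X Y" and f: "f \<in> rhom P X" "w = \<theta> X f"
        using \<theta>_surj[OF X] by auto
      have "\<alpha> Y (amap (fst p) X Y k w) = {compose (rcarrier P) k f e}"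
        using nat[OF X Y f(1) k] \<alpha>_app[OF Y compose_rhom[OF P' f(1) k]] f(2) by simp
      then show "\<alpha> Y (amap (fst p) X Y k w) = amap ?F X Y k (\<alpha> X w)"
        using e f \<alpha>_app[OF X f(1)] rhom_fixed[OF f(1) e] by (simp add: compose_eq fixed_iff)
    qed (simp add: \<alpha>_def)
    moreover have "\<beta> = \<alpha>" if \<beta>: "\<beta> \<in> nat_trans PSets Sets (fst p) ?F" for \<beta>
    proof (rule extensionalityI[of _ "Obj PSets"])
      note \<beta>_in = nat_trans_setD(2)[OF \<beta>]
      let ?id = "\<lambda>x\<in>rcarrier P. x"
      have id: "?id \<in> rhom P P"
        using P' by (intro restrict_rhomI) (simp_all add: right_msetD)
      have \<theta>id: "\<theta> P ?id \<in> omap (fst p) P"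
        using bij_betwE[OF bij[OF P(1)]] id by blast
      then have "\<beta> P (\<theta> P ?id) \<in> omap ?F P"
        using PiE_mem[OF \<beta>_in[OF P(1)]] by blast
      then have \<beta>_id: "\<beta> P (\<theta> P ?id) = {e}"
        using e_unique by auto
      fix X assume X: "X \<in> Obj PSets"
      show "\<beta> X = \<alpha> X"
      proof (rule extensionalityI[of _ "omap (fst p) X"])
        fix w assume "w \<in> omap (fst p) X"
        then obtain f where f: "f \<in> rhom P X" "w = \<theta> X f"
          using \<theta>_surj[OF X] by blast
        have "\<theta> X f = amap (fst p) P X f (\<theta> P ?id)"
          using nat[OF P(1) X id f(1)] compose_restrict_id(1)[OF rhomD(1)[OF f(1)]] by simp
        then have "\<beta> X (\<theta> X f) = amap ?F P X f {e}"
          using nat_trans_setD(3)[OF \<beta> P(1) X _ \<theta>id] f(1) \<beta>_id by simp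
        then show "\<beta> X w = \<alpha> X w"
          using e f \<alpha>_app[OF X f(1)] by simp
      qed (use \<beta>_in[OF X] X in \<open>simp_all add: PiE_iff \<alpha>_def\<close>)
    qed (use nat_trans_setD(1)[OF \<beta>] in \<open>simp_all add: \<alpha>_def\<close>)
    ultimately show ?thesis
      by blast
  qed
  then show ?thesis
    unfolding has_terminal_def Hom_essential_points
    using splitting_essential_point[OF ll] by (intro bexI[of _ "(?F, coinduced_ftor l)"]) simp_all
qed

end

theorem theorem2p56:
  fixes \<kappa> :: "'u rel"
  assumes "universe_card TYPE('m::monoid_mult) \<kappa>"
  shows "all_equivalent
    [ \<exists>l::'m. left_absorbing l,
      \<exists>R::'m set. minimal_nonempty_sub regular_mset R \<and>
        trivial_endomorphisms (restrict_mset regular_mset R),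
      has_initial (full_subcategory (PSh TYPE('m) \<kappa>) indecomposable),
      \<forall>X\<in>Obj (PSh TYPE('m) \<kappa>). indecomposable X \<longrightarrow>
        (\<exists>Y. minimal_nonempty_sub X Y \<and> trivial_endomorphisms (restrict_mset X Y)),
      has_terminal (essential_points TYPE('m) \<kappa>),
      \<exists>c. adjoint (set_cat \<kappa>) (PSh TYPE('m) \<kappa>) c (components_ftor TYPE('m) TYPE('u)) \<and>
        preserves_connected_limits \<kappa> (set_cat \<kappa>) (PSh TYPE('m) \<kappa>) c,
      \<exists>c. adjoint (set_cat \<kappa>) (PSh TYPE('m) \<kappa>) c (components_ftor TYPE('m) TYPE('u)),
      components_preserves_products TYPE('m) \<kappa> \<and>
        product_flat \<kappa> (terminal_left_mset :: ('m, unit) left_act),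
      components_preserves_powers TYPE('m) \<kappa> ]"
    (is "all_equivalent [?absorbing, ?ideal, ?initial, ?subs, ?terminal, ?connected, ?colocal, ?products, ?powers]")
proof -
  interpret universe \<kappa> "TYPE('m)"
    by unfold_locales (rule assms)
  have ideal: "?ideal \<longleftrightarrow> ?absorbing"
  proof
    assume ?ideal
    then show ?absorbing
      using minimal_sub_imp_absorbing[OF right_mset_regular, of id] by auto
  qed (use absorbing_imp_minimal_sub right_mset_regular connected_regular in blast)
  have initial: "?initial \<longleftrightarrow> ?absorbing"
    using initial_imp_absorbing absorbing_imp_initial by blast
  have subs: "?subs \<longleftrightarrow> ?absorbing"
  proof
    assume ?absorbing
    then show ?subs
      using absorbing_imp_minimal_sub indecomposable_iff_connected by fastforce
  qed (rule minimal_subs_imp_absorbing)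
  have terminal: "?terminal \<longleftrightarrow> ?absorbing"
    using terminal_imp_absorbing absorbing_imp_terminal by blast
  \<comment> \<open>Preservation of connected limits is available because the left adjoint is given
    explicitly as the copower with l M.\<close>
  have "?absorbing \<Longrightarrow> ?connected"
    using absorbing_imp_components_adjoint
      copower_preserves_connected_limits[OF right_mset_principal small_monoid] by blast
  moreover have "?colocal \<Longrightarrow> ?absorbing"
    using components_adjoint_imp_absorbing by blast
  ultimately have connected: "?connected \<longleftrightarrow> ?absorbing" and colocal: "?colocal \<longleftrightarrow> ?absorbing"
    by blast+
  \<comment> \<open>Products and powers are handled by a cycle: a power is the product of a constant
    family, and powers lead back to an absorbing element.\<close>
  have "?absorbing \<Longrightarrow> ?products"
    using absorbing_imp_products absorbing_imp_product_flat by blast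
  moreover have "?products \<Longrightarrow> ?powers"
    using products_imp_powers by blast
  ultimately have products: "?products \<longleftrightarrow> ?absorbing" and powers: "?powers \<longleftrightarrow> ?absorbing"
    using powers_imp_absorbing by blast+
  show ?thesis
    unfolding all_equivalent_def ideal initial subs terminal connected colocal products powers by simp
qed

end
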